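(* Let $m\ge 4$ be even, $\nu=\frac{m-2}{2}$, and let $G_0(\lambda,x)$ be the convolution kernel of the resolvent $G_0(\lambda)=(-\Delta-\lambda^2)^{-1}$ on $\mathbb{R}^m$, $\operatorname{Im}\lambda\ge 0$ (boundary values being taken for real $\lambda$). Then for $x\ne 0$ \[ G_0(\lambda,x)=\sum_{j=0}^{\nu}T_j^{(a)}\left[e^{i\lambda|x|(1+2a)}\frac{(\lambda|x|)^j}{|x|^{m-2}}\right]. \]
   Context: For $j=0,\dots,\nu$ the superposing operator $T_j^{(a)}$ over the parameter $a>0$ is \[ T_j^{(a)}[f(x,a)]=C_{m,j}\int_0^\infty(1+a)^{-(2\nu-j+\frac12)}f(x,a)\frac{da}{\sqrt a},\qquad C_{m,j}=(-2i)^j\frac{\Gamma(2\nu-j+\frac12)}{2^{m-1}\pi^{\frac m2}\Gamma(\frac{m-1}2)}\binom{\nu}{j}. \] The kernel $G_0(\lambda,x)$ is given for $\operatorname{Im}\lambda\ge0$ by the Whittaker formula \[ G_0(\lambda,x)=\frac{e^{i\lambda|x|}}{2(2\pi)^{\frac{m-1}{2}}\Gamma(\frac{m-1}{2})|x|^{m-2}}\int_0^\infty e^{-t}t^{\frac{m-3}2}\left(\frac t2-i\lambda|x|\right)^{\frac{m-3}2}dt, \] where $z^{1/2}$ is the branch of the square root cut along the negative real axis with $z^{1/2}>0$ for $z>0$. *)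

theory Defs
  imports "HOL-Analysis.Analysis"
begin

section \<open>The Laplacian on square-integrable functions\<close>

definition partial :: "'a::euclidean_space \<Rightarrow> ('a \<Rightarrow> complex) \<Rightarrow> 'a \<Rightarrow> complex" where
  "partial b f x = frechet_derivative f (at x) b"

fun Ck :: "nat \<Rightarrow> ('a::euclidean_space \<Rightarrow> complex) \<Rightarrow> bool" where
  "Ck 0 f \<longleftrightarrow> continuous_on UNIV f"
| "Ck (Suc k) f \<longleftrightarrow> (\<forall>x. f differentiable (at x)) \<and> (\<forall>b\<in>Basis. Ck k (partial b f))"

definition test_function :: "('a::euclidean_space \<Rightarrow> complex) \<Rightarrow> bool" where
  "test_function \<phi> \<longleftrightarrow> (\<forall>k. Ck k \<phi>) \<and> compact (closure {x. \<phi> x \<noteq> 0})"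

definition laplacian :: "('a::euclidean_space \<Rightarrow> complex) \<Rightarrow> 'a \<Rightarrow> complex" where
  "laplacian \<phi> x = (\<Sum>b\<in>Basis. partial b (partial b \<phi>) x)"

definition L2 :: "('a::euclidean_space \<Rightarrow> complex) set" where
  "L2 = {f \<in> borel_measurable lborel. integrable lborel (\<lambda>x. (cmod (f x))\<^sup>2)}"

text \<open>
  The graph of the self-adjoint operator \<open>-\<Delta>\<close> on \<open>L2\<close>: \<open>g\<close> is the distributional \<open>-\<Delta>u\<close>, and
  both are square-integrable, so the domain is the Sobolev space \<open>H\<^sup>2\<close>. Elements of \<open>L2\<close> are
  functions rather than classes, so \<open>g\<close> is determined by \<open>u\<close> only almost everywhere.
\<close>

definition neg_laplace_graph :: "('a::euclidean_space \<Rightarrow> complex) \<Rightarrow> ('a \<Rightarrow> complex) \<Rightarrow> bool" where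
  "neg_laplace_graph u g \<longleftrightarrow> u \<in> L2 \<and> g \<in> L2 \<and>
     (\<forall>\<phi>. test_function \<phi> \<longrightarrow>
        (LINT x|lborel. u x * (- laplacian \<phi> x)) = (LINT x|lborel. g x * \<phi> x))"

text \<open>
  \<open>is_resolvent \<mu> f u\<close> means \<open>u = (-\<Delta> - \<mu>\<^sup>2)\<^sup>-\<^sup>1 f\<close> in \<open>L2\<close>. It is used only for \<open>Im \<mu> > 0\<close>, where
  \<open>\<mu>\<^sup>2\<close> lies outside the spectrum \<open>[0, \<infinity>)\<close>, so that \<open>u\<close> exists and is unique almost everywhere.
\<close>

definition is_resolvent ::
    "complex \<Rightarrow> ('a::euclidean_space \<Rightarrow> complex) \<Rightarrow> ('a \<Rightarrow> complex) \<Rightarrow> bool" where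
  "is_resolvent \<mu> f u \<longleftrightarrow>
     (\<exists>g. neg_laplace_graph u g \<and> (AE x in lborel. g x - \<mu>\<^sup>2 * u x = f x))"

section \<open>The convolution kernel of the resolvent\<close>

definition is_convolution_kernel ::
    "(('a::euclidean_space \<Rightarrow> complex) \<Rightarrow> ('a \<Rightarrow> complex) \<Rightarrow> bool) \<Rightarrow> ('a \<Rightarrow> complex) \<Rightarrow> bool" where
  "is_convolution_kernel R K \<longleftrightarrow> (\<forall>f\<in>L2.
     (AE x in lborel. integrable lborel (\<lambda>y. K (x - y) * f y)) \<and>
     R f (\<lambda>x. LINT y|lborel. K (x - y) * f y))"

text \<open>
  As an integral kernel, \<open>G \<mu>\<close> is determined only almost everywhere. Continuity away from the
  origin selects the representative that can be evaluated at a point. For real \<open>\<mu>\<close>, where the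
  resolvent does not exist on \<open>L2\<close>, \<open>G \<mu>\<close> is the boundary value \<open>G (\<mu> + \<i>0)\<close>.
\<close>

definition free_resolvent_kernel :: "(complex \<Rightarrow> 'a::euclidean_space \<Rightarrow> complex) \<Rightarrow> bool" where
  "free_resolvent_kernel G \<longleftrightarrow>
     (\<forall>\<mu>. Im \<mu> > 0 \<longrightarrow>
        continuous_on (- {0}) (G \<mu>) \<and> is_convolution_kernel (is_resolvent \<mu>) (G \<mu>)) \<and>
     (\<forall>\<mu> x. Im \<mu> = 0 \<longrightarrow> x \<noteq> 0 \<longrightarrow>
        ((\<lambda>\<epsilon>. G (\<mu> + \<i> * complex_of_real \<epsilon>) x) \<longlongrightarrow> G \<mu> x) (at_right 0))"

section \<open>The superposing operators\<close>

definition nu :: "nat \<Rightarrow> nat" where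
  "nu m = (m - 2) div 2"

definition C_coeff :: "nat \<Rightarrow> nat \<Rightarrow> complex" where
  "C_coeff m j = (- 2 * \<i>) ^ j *
     complex_of_real
       (Gamma (2 * real (nu m) - real j + 1/2) /
        (2 ^ (m - 1) * pi powr (real m / 2) * Gamma ((real m - 1) / 2)) *
        real (nu m choose j))"

definition T_op :: "nat \<Rightarrow> nat \<Rightarrow> ('a \<Rightarrow> real \<Rightarrow> complex) \<Rightarrow> 'a \<Rightarrow> complex" where
  "T_op m j f x = C_coeff m j *
     (LINT a:{0<..}|lborel.
        complex_of_real ((1 + a) powr - (2 * real (nu m) - real j + 1/2)) * f x a /
        complex_of_real (sqrt a))"

end

theory Submission
  imports Defs
begin

text \<open>
  For \<open>Im \<mu> > 0\<close> put \<open>\<kappa> = -\<i>\<mu>\<close>. Inserting the Gamma integral for \<open>(1 + a)\<^sup>-\<^sup>q\<close> and summing over \<open>j\<close> by the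
  binomial theorem turns the right-hand side into the Whittaker formula
  \<open>c r\<^sup>-\<^sup>2\<^sup>\<nu> e\<^sup>-\<^sup>z \<integral> e\<^sup>-\<^sup>t t\<^sup>p (t + 2z)\<^sup>\<nu> S(t + 2z) dt\<close> with \<open>z = \<kappa>r\<close>, \<open>p = \<nu> - 1/2\<close> and
  \<open>S(w) = \<integral> e\<^sup>-\<^sup>w\<^sup>a a\<^sup>-\<^sup>1\<^sup>/\<^sup>2 da\<close>. Since \<open>S' = -S/(2w)\<close>, no branch of a complex power is needed, and an
  integration by parts gives the radial Helmholtz equation. Replacing \<open>\<bar>x\<bar>\<close> by \<open>(\<bar>x\<bar>\<^sup>2 + \<epsilon>\<^sup>2)\<^sup>1\<^sup>/\<^sup>2\<close> turns this function
  \<open>E\<close> into a smooth one whose image under \<open>-\<Delta> - \<mu>\<^sup>2\<close> is an approximate identity, so \<open>E\<close> is an integrable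
  fundamental solution.

  Any resolvent kernel \<open>K\<close> agrees with \<open>E\<close>: if \<open>u = K * f\<close>, test \<open>(-\<Delta> - \<mu>\<^sup>2)u = f\<close> against the translates
  \<open>\<psi>(\<cdot> + y)\<close>, multiply by \<open>E(y)\<close> and integrate in \<open>y\<close>; Fubini gives \<open>\<integral> u \<psi> = \<integral> (E * f) \<psi>\<close>. Letting \<open>f\<close> be the
  indicator of a small ball and \<open>\<psi>\<close> a bump near \<open>z\<close>, continuity yields \<open>K z = E z\<close>. Real \<open>\<mu>\<close> follow by
  dominated convergence.
\<close>

section \<open>Test functions and integration by parts\<close>

text \<open>The profile blows up like |x|^(2 - m) at the origin, so Green's formula cannot be
  applied to it on all of space, and cutting out a ball would bring in surface integrals. With the
  smoothed radius every integration by parts is a directional one over the whole space, and the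
  usual boundary term turns into a volume term whose total mass is a layer-cake integral. That mass
  fixes the constant: m (m - 2) sqrt pi Gamma(m - 2), the limit of the rescaled density, times the
  volume of the unit ball is the inverse of the factor common to all \<open>C_coeff m j\<close>, by
  Legendre duplication. About \<open>K\<close> only continuity off 0 and the mapping property on
  \<open>L2\<close> are known, no bound near 0 or at infinity. It therefore enters through u = K * f
  and its values near one point; the weak equation is moved around by translating test functions,
  and Fubini rests on the integrability of E, which comes from the decay for Im mu > 0. For real mu
  this decay is lost; then the factor (1 + a)^(-q) with q at least 3/2 makes the a-integrals
  converge uniformly.\<close>

definition Cc :: "('a::euclidean_space \<Rightarrow> complex) \<Rightarrow> bool" where
  "Cc f \<longleftrightarrow> continuous_on UNIV f \<and> (\<exists>R. \<forall>x. norm x > R \<longrightarrow> f x = 0)"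

lemma Cc_compact:
  assumes "continuous_on UNIV f" "compact (closure {x. f x \<noteq> 0})"
  shows "Cc f"
proof -
  obtain R where "\<And>x. x \<in> closure {x. f x \<noteq> 0} \<Longrightarrow> norm x \<le> R"
    using compact_imp_bounded[OF assms(2)] by (auto simp: bounded_iff)
  then have "\<forall>x. norm x > R \<longrightarrow> f x = 0"
    using closure_subset[of "{x. f x \<noteq> 0}"] by force
  with assms(1) show ?thesis unfolding Cc_def by blast
qed

lemma Cc_bounded:
  assumes "Cc f"
  obtains M where "M \<ge> 0" "\<And>x. norm (f x) \<le> M"
proof -
  from assms obtain R where c: "continuous_on UNIV f" and R: "\<And>x. norm x > R \<Longrightarrow> f x = 0"
    unfolding Cc_def by blast
  have "compact (f ` cball 0 R)"
    by (intro compact_continuous_image continuous_on_subset[OF c]) auto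
  then obtain M where M: "\<And>y. y \<in> f ` cball 0 R \<Longrightarrow> norm y \<le> M"
    using compact_imp_bounded[of "f ` cball 0 R"] unfolding bounded_iff by blast
  have "norm (f x) \<le> max M 0" for x
  proof (cases "norm x \<le> R")
    case True then show ?thesis using M[of "f x"] by auto
  next
    case False then show ?thesis using R[of x] by auto
  qed
  then show ?thesis using that[of "max M 0"] by auto
qed

lemma Cc_borel: "Cc f \<Longrightarrow> f \<in> borel_measurable borel"
  unfolding Cc_def by (auto intro: borel_measurable_continuous_onI)

lemma Cc_integrable:
  assumes "Cc f"
  shows "integrable lborel f"
proof -
  from assms obtain R where c: "continuous_on UNIV f" and R: "\<And>x. norm x > R \<Longrightarrow> f x = 0"
    unfolding Cc_def by blast
  have "integrable lborel (\<lambda>x. indicator (cball 0 R) x *\<^sub>R f x)"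
    by (intro borel_integrable_compact continuous_on_subset[OF c]) auto
  moreover have "(\<lambda>x. indicator (cball 0 R) x *\<^sub>R f x) = f"
    using R by (force simp: indicator_def)
  ultimately show ?thesis by simp
qed

lemma Cc_mult:
  assumes "Cc f" "continuous_on UNIV h"
  shows "Cc (\<lambda>x. h x * f x)"
  using assms unfolding Cc_def by (force intro: continuous_intros)

lemma Cc_add:
  assumes "Cc f" "Cc h"
  shows "Cc (\<lambda>x. f x + h x)"
proof -
  from assms obtain R R' where "\<And>x. norm x > R \<Longrightarrow> f x = 0" "\<And>x. norm x > R' \<Longrightarrow> h x = 0"
    unfolding Cc_def by blast
  then have "\<forall>x. norm x > max R R' \<longrightarrow> f x + h x = 0" by auto
  then show ?thesis using assms unfolding Cc_def by (blast intro: continuous_intros)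
qed

lemma Cc_uminus: "Cc f \<Longrightarrow> Cc (\<lambda>x. - f x)"
  using Cc_mult[of f "\<lambda>_. -1"] by (simp add: continuous_on_const)

lemma Cc_diff: "Cc f \<Longrightarrow> Cc h \<Longrightarrow> Cc (\<lambda>x. f x - h x)"
  using Cc_add[of f "\<lambda>x. - h x"] Cc_uminus[of h] by simp

lemma Cc_sum:
  assumes "finite A" "\<And>b. b \<in> A \<Longrightarrow> Cc (f b)"
  shows "Cc (\<lambda>x. \<Sum>b\<in>A. f b x)"
  using assms
proof (induction A)
  case empty
  then show ?case by (simp add: Cc_def)
next
  case (insert b A)
  then show ?case using Cc_add[of "f b" "\<lambda>x. \<Sum>b\<in>A. f b x"] by simp
qed

lemma Cc_L2:
  assumes "Cc f"
  shows "f \<in> L2"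
proof -
  have "Cc (\<lambda>x. cnj (f x) * f x)"
    using assms by (intro Cc_mult) (auto simp: Cc_def intro: continuous_intros)
  from integrable_norm[OF Cc_integrable[OF this]]
  have "integrable lborel (\<lambda>x. (cmod (f x))\<^sup>2)" by (simp add: norm_mult power2_eq_square)
  then show ?thesis unfolding L2_def using Cc_borel[OF assms] by simp
qed

lemma Cc_translate:
  assumes "Cc f"
  shows "Cc (\<lambda>x. f (x + y))"
proof -
  from assms obtain R where R: "\<And>x. norm x > R \<Longrightarrow> f x = 0"
    unfolding Cc_def by blast
  have "f (x + y) = 0" if "norm x > R + norm y" for x
    using that norm_triangle_ineq[of "x + y" "- y"] by (intro R) auto
  moreover have "continuous_on UNIV (\<lambda>x. f (x + y))"
    by (rule continuous_on_compose2[of UNIV f]) (use assms in \<open>auto simp: Cc_def intro: continuous_intros\<close>)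
  ultimately show ?thesis unfolding Cc_def by blast
qed

text \<open>True for every function: \<open>f\<close> is Borel measurable exactly when its translate
  is, and when it is not, both integrals have the default value 0.\<close>

lemma lborel_integral_translate:
  fixes f :: "'a::euclidean_space \<Rightarrow> 'b::{banach,second_countable_topology}"
  shows "(LINT x|lborel. f (x + y)) = (LINT x|lborel. f x)"
proof -
  have "(LINT x|distr lborel borel ((+) y). f x) = (LINT x|lborel. f (y + x))"
  proof (cases "f \<in> borel_measurable borel")
    case True then show ?thesis by (intro integral_distr) auto
  next
    case False
    have "(\<lambda>x. f (y + x)) \<notin> borel_measurable borel"
    proof
      assume "(\<lambda>x. f (y + x)) \<in> borel_measurable borel"
      then have "(\<lambda>x. f (y + (x - y))) \<in> borel_measurable borel" by measurable
      then show False using False by simp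
    qed
    then have "\<not> integrable lborel f" "\<not> integrable lborel (\<lambda>x. f (y + x))"
      using False by (auto dest: borel_measurable_integrable)
    then show ?thesis by (simp add: not_integrable_integral_eq lborel_distr_plus)
  qed
  then show ?thesis by (simp add: lborel_distr_plus add.commute)
qed

lemma lborel_integrable_translate:
  fixes f :: "'a::euclidean_space \<Rightarrow> 'b::{banach,second_countable_topology}"
  assumes "integrable lborel f"
  shows "integrable lborel (\<lambda>x. f (x + y))"
proof -
  have "integrable (distr lborel borel ((+) y)) f" using assms by (simp add: lborel_distr_plus)
  then have "integrable lborel (\<lambda>x. f (y + x))" by (subst (asm) integrable_distr_eq) (use assms in auto)
  then show ?thesis by (simp add: add.commute)
qed

text \<open>The integral of a difference quotient vanishes by translation invariance.\<close>

lemma integral_directional_derivative_eq_0: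
  fixes V V' :: "'a::euclidean_space \<Rightarrow> complex"
  assumes V: "Cc V" and V': "Cc V'"
    and D: "\<And>x. ((\<lambda>t. V (x + t *\<^sub>R b)) has_vector_derivative V' x) (at 0)"
  shows "(LINT x|lborel. V' x) = 0"
proof -
  obtain M where M: "M \<ge> 0" "\<And>x. norm (V' x) \<le> M" using Cc_bounded[OF V'] by blast
  obtain R where R: "\<And>x. norm x > R \<Longrightarrow> V x = 0" using V unfolding Cc_def by blast
  define h where "h n = inverse (real (Suc n))" for n
  define q where "q n x = (V (x + h n *\<^sub>R b) - V x) /\<^sub>R h n" for n x
  have hpos: "0 < h n" "h n \<le> 1" for n by (auto simp: h_def field_simps)
  \<comment> \<open>The hypothesis speaks of the parameter value 0 only. Moving the base point gives
    the derivative along the whole line, which the mean value inequality below requires.\<close>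
  have D': "((\<lambda>t. V (x + t *\<^sub>R b)) has_vector_derivative V' (x + t *\<^sub>R b)) (at t)" for x t
  proof -
    have eq: "(\<lambda>s. V ((x + t *\<^sub>R b) + (s - t) *\<^sub>R b)) = (\<lambda>t. V (x + t *\<^sub>R b))"
      by (rule ext) (simp add: algebra_simps)
    have 1: "((\<lambda>s. s - t) has_vector_derivative 1) (at t)" by (auto intro!: derivative_eq_intros)
    have 2: "((\<lambda>s. V ((x + t *\<^sub>R b) + s *\<^sub>R b)) has_vector_derivative V' (x + t *\<^sub>R b)) (at (t - t))"
      using D[of "x + t *\<^sub>R b"] by simp
    show ?thesis using vector_diff_chain_at[OF 1 2] by (simp add: o_def eq)
  qed
  \<comment> \<open>Because \<open>h n \<le> 1\<close>, all difference quotients vanish outside one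
    ball. Together with the bound \<open>M\<close> from the mean value inequality this yields a
    dominating function independent of \<open>n\<close>.\<close>
  have V_eq: "V x = 0" "q n x = 0" if "norm x > R + norm b" for x n
  proof -
    have "norm (h n *\<^sub>R b) \<le> norm b" using hpos[of n] by (simp add: mult_left_le_one_le)
    then have "norm (x + h n *\<^sub>R b) > R"
      using that norm_triangle_ineq[of "x + h n *\<^sub>R b" "- (h n *\<^sub>R b)"] by auto
    moreover have "norm x > R" using that norm_ge_zero[of b] by linarith
    ultimately show "V x = 0" "q n x = 0" using R by (auto simp: q_def)
  qed
  have q_bd: "norm (q n x) \<le> M" for n x
  proof -
    have "norm (V (x + h n *\<^sub>R b) - V (x + 0 *\<^sub>R b)) \<le> M * norm (h n - 0)"
    proof (rule differentiable_bound[where S=UNIV and f="\<lambda>t. V (x + t *\<^sub>R b)" and f'="\<lambda>t s. s *\<^sub>R V' (x + t *\<^sub>R b)"])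
      show "((\<lambda>t. V (x + t *\<^sub>R b)) has_derivative (\<lambda>s. s *\<^sub>R V' (x + t *\<^sub>R b))) (at t within UNIV)" for t
        using D'[of x t] by (simp add: has_vector_derivative_def)
      show "onorm (\<lambda>s. s *\<^sub>R V' (x + t *\<^sub>R b)) \<le> M" for t
        by (rule onorm_le) (use M(2)[of "x + t *\<^sub>R b"] in \<open>simp add: mult.commute[of M] mult_left_mono\<close>)
    qed auto
    then show ?thesis using hpos[of n] by (simp add: q_def divide_simps mult.commute)
  qed
  have "(\<lambda>n. LINT x|lborel. q n x) \<longlonglongrightarrow> (LINT x|lborel. V' x)"
  proof (rule integral_dominated_convergence[where w="\<lambda>x. M * indicator (cball 0 (R + norm b)) x"])
    show "V' \<in> borel_measurable lborel" using Cc_borel[OF V'] by simp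
    have "V \<in> borel_measurable borel" using Cc_borel[OF V] .
    then show "q n \<in> borel_measurable lborel" for n unfolding q_def by simp
    have "emeasure lborel (cball (0::'a) (R + norm b)) < \<infinity>"
      by (rule emeasure_bounded_finite) auto
    then show "integrable lborel (\<lambda>x. M * indicator (cball (0::'a) (R + norm b)) x)"
      by (intro integrable_mult_right integrable_real_indicator) auto
    have hlim: "filterlim h (at 0) sequentially"
    proof -
      have "h \<longlonglongrightarrow> 0" unfolding h_def by (rule LIMSEQ_inverse_real_of_nat)
      then show ?thesis using hpos by (auto simp: filterlim_at intro!: always_eventually less_imp_neq[symmetric] )
    qed
    have "(\<lambda>n. q n x) \<longlonglongrightarrow> V' x" for x
    proof -
      have "((\<lambda>t. (V (x + t *\<^sub>R b) - V x) /\<^sub>R t) \<longlongrightarrow> V' x) (at 0)"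
      proof -
        have "((\<lambda>t. norm ((V (x + t *\<^sub>R b) - V (x + 0 *\<^sub>R b) - (t - 0) *\<^sub>R V' x) /\<^sub>R norm (t - 0))) \<longlongrightarrow> 0) (at 0)"
          using D[of x] unfolding has_vector_derivative_def has_derivative_at_within
          by (intro tendsto_norm_zero) simp
        then have "((\<lambda>t. norm ((V (x + t *\<^sub>R b) - V x) /\<^sub>R t - V' x)) \<longlongrightarrow> 0) (at 0)"
        proof (rule Lim_transform_eventually)
          show "\<forall>\<^sub>F t in at 0. norm ((V (x + t *\<^sub>R b) - V (x + 0 *\<^sub>R b) - (t - 0) *\<^sub>R V' x) /\<^sub>R norm (t - 0)) =
             norm ((V (x + t *\<^sub>R b) - V x) /\<^sub>R t - V' x)"
          proof (rule eventually_at_topological[THEN iffD2], intro exI[of _ UNIV], safe)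
            fix t :: real assume "t \<noteq> 0"
            then have "(V (x + t *\<^sub>R b) - V x) /\<^sub>R t - V' x = (V (x + t *\<^sub>R b) - V x - t *\<^sub>R V' x) /\<^sub>R t"
              by (simp add: algebra_simps)
            then show "norm ((V (x + t *\<^sub>R b) - V (x + 0 *\<^sub>R b) - (t - 0) *\<^sub>R V' x) /\<^sub>R norm (t - 0)) =
             norm ((V (x + t *\<^sub>R b) - V x) /\<^sub>R t - V' x)" by simp
          qed auto
        qed
        then show ?thesis by (rule LIM_zero_cancel[OF tendsto_norm_zero_cancel])
      qed
      from filterlim_compose[OF this hlim] show ?thesis by (simp add: q_def)
    qed
    then show "AE x in lborel. (\<lambda>n. q n x) \<longlonglongrightarrow> V' x" by simp
    show "AE x in lborel. norm (q n x) \<le> M * indicator (cball 0 (R + norm b)) x" for n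
    proof (rule AE_I2)
      fix x show "norm (q n x) \<le> M * indicator (cball 0 (R + norm b)) x"
        using q_bd[of n x] V_eq(2)[of x n] by (cases "norm x \<le> R + norm b") (auto simp: indicator_def)
    qed
  qed
  moreover have "(LINT x|lborel. q n x) = 0" for n
  proof -
    have "(LINT x|lborel. q n x) = inverse (h n) *\<^sub>R ((LINT x|lborel. V (x + h n *\<^sub>R b)) - (LINT x|lborel. V x))"
      unfolding q_def using Cc_integrable[OF V] lborel_integrable_translate[OF Cc_integrable[OF V]]
      by simp
    then show ?thesis by (simp add: lborel_integral_translate)
  qed
  ultimately show ?thesis by (simp add: LIMSEQ_const_iff)
qed

text \<open>Off the closed support \<open>f\<close> is 0 on a whole neighbourhood. So
  differentiation does not enlarge the closed support, and partial derivatives of test functions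
  remain test functions.\<close>

lemma partial_zero_outside:
  assumes "x \<notin> closure {x. f x \<noteq> 0}"
  shows "partial b f x = 0"
proof -
  have "((\<lambda>_. 0) has_derivative (\<lambda>_. 0)) (at x)" by simp
  then have "(f has_derivative (\<lambda>_. 0)) (at x)"
  proof (rule has_derivative_transform_within_open[where s="- closure {x. f x \<noteq> 0}"])
    show "x \<in> - closure {x. f x \<noteq> 0}" using assms by simp
    show "0 = f y" if "y \<in> - closure {x. f x \<noteq> 0}" for y
      using that closure_subset[of "{x. f x \<noteq> 0}"] by auto
  qed auto
  then show ?thesis unfolding partial_def using frechet_derivative_at by metis
qed

lemma Ck_imp_continuous: "Ck k f \<Longrightarrow> continuous_on UNIV f"
  by (cases k) (auto intro: differentiable_imp_continuous_on simp: differentiable_on_def)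

lemma test_function_partial:
  assumes "test_function f" "b \<in> Basis"
  shows "test_function (partial b f)"
proof -
  have "{x. partial b f x \<noteq> 0} \<subseteq> closure {x. f x \<noteq> 0}"
    using partial_zero_outside by blast
  then have "closure {x. partial b f x \<noteq> 0} \<subseteq> closure {x. f x \<noteq> 0}"
    by (simp add: closure_minimal)
  moreover have "Ck k (partial b f)" for k
    using assms unfolding test_function_def by (metis Ck.simps(2))
  ultimately show ?thesis
    using assms unfolding test_function_def by (metis closed_closure compact_Int_closed inf.absorb_iff2)
qed

lemma test_function_Cc: "test_function f \<Longrightarrow> Cc f"
  unfolding test_function_def by (intro Cc_compact) (auto intro: Ck_imp_continuous)

lemma test_function_laplacian_Cc: "test_function f \<Longrightarrow> Cc (laplacian f)"
  unfolding laplacian_def by (intro Cc_sum test_function_Cc test_function_partial) auto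

lemma test_function_has_derivative:
  assumes "test_function f"
  shows "(f has_derivative (\<lambda>h. frechet_derivative f (at x) h)) (at x)"
proof -
  have "Ck (Suc 0) f" using assms unfolding test_function_def by blast
  then have "f differentiable (at x)" by simp
  then show ?thesis by (simp add: frechet_derivative_works)
qed

lemma test_function_directional:
  assumes "test_function f"
  shows "((\<lambda>t. f (x + t *\<^sub>R b)) has_vector_derivative partial b f x) (at 0)"
proof -
  have "((\<lambda>t. x + t *\<^sub>R b) has_derivative (\<lambda>t. t *\<^sub>R b)) (at 0)"
    by (auto intro!: derivative_eq_intros)
  moreover have "(f has_derivative (\<lambda>h. frechet_derivative f (at x) h)) (at (x + 0 *\<^sub>R b))"
    using test_function_has_derivative[OF assms] by simp
  ultimately have "((\<lambda>t. f (x + t *\<^sub>R b)) has_derivative (\<lambda>t. frechet_derivative f (at x) (t *\<^sub>R b))) (at 0)"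
    using has_derivative_compose by fastforce
  moreover have "linear (frechet_derivative f (at x))"
    using test_function_has_derivative[OF assms] has_derivative_linear by blast
  ultimately show ?thesis unfolding has_vector_derivative_def partial_def
    by (simp add: linear_scale)
qed

section \<open>Translates of test functions\<close>

lemma frechet_derivative_translate:
  assumes "f differentiable (at (x + y))"
  shows "(\<lambda>x. f (x + y)) differentiable (at x)" "partial b (\<lambda>x. f (x + y)) x = partial b f (x + y)"
proof -
  have f: "(f has_derivative frechet_derivative f (at (x + y))) (at (x + y))"
    using assms by (simp add: frechet_derivative_works)
  have "((\<lambda>x. x + y) has_derivative (\<lambda>h. h)) (at x)" by (auto intro!: derivative_eq_intros)
  from has_derivative_compose[OF this f]
  have d: "((\<lambda>x. f (x + y)) has_derivative frechet_derivative f (at (x + y))) (at x)" by simp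
  then show "(\<lambda>x. f (x + y)) differentiable (at x)" by (auto simp: differentiable_def)
  show "partial b (\<lambda>x. f (x + y)) x = partial b f (x + y)"
    unfolding partial_def using frechet_derivative_at[OF d] by simp
qed

lemma Ck_translate: "Ck k f \<Longrightarrow> Ck k (\<lambda>x. f (x + y))"
proof (induction k arbitrary: f)
  case 0
  then show ?case by (auto intro!: continuous_on_compose2[of UNIV f] continuous_intros)
next
  case (Suc k)
  then have d: "\<And>x. f differentiable (at x)" and p: "\<And>b. b \<in> Basis \<Longrightarrow> Ck k (partial b f)" by auto
  have "partial b (\<lambda>x. f (x + y)) = (\<lambda>x. partial b f (x + y))" for b
    by (rule ext) (rule frechet_derivative_translate(2)[OF d])
  then show ?case using Suc.IH[OF p] frechet_derivative_translate(1)[OF d] by simp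
qed

lemma laplacian_translate:
  assumes "test_function f"
  shows "laplacian (\<lambda>x. f (x + y)) x = laplacian f (x + y)"
proof -
  have d: "g differentiable (at x)" if "test_function g" for g and x :: 'a
    using test_function_has_derivative[OF that] by (auto simp: differentiable_def)
  have "partial b (\<lambda>x. f (x + y)) = (\<lambda>x. partial b f (x + y))" for b
    by (rule ext) (rule frechet_derivative_translate(2)[OF d[OF assms]])
  moreover have "partial b (\<lambda>x. partial b f (x + y)) x = partial b (partial b f) (x + y)" if "b \<in> Basis" for b
    by (rule frechet_derivative_translate(2)[OF d[OF test_function_partial[OF assms that]]])
  ultimately show ?thesis unfolding laplacian_def by simp
qed

lemma test_function_translate:
  assumes "test_function f"
  shows "test_function (\<lambda>x. f (x + y))"
proof -
  obtain R where R: "\<And>x. norm x > R \<Longrightarrow> f (x + y) = 0"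
    using Cc_translate[OF test_function_Cc[OF assms]] unfolding Cc_def by blast
  have "{x. f (x + y) \<noteq> 0} \<subseteq> cball 0 R" using R by force
  then have "bounded {x. f (x + y) \<noteq> 0}" using bounded_cball bounded_subset by blast
  then show ?thesis using assms Ck_translate unfolding test_function_def
    by (auto simp: compact_closure)
qed

section \<open>Radial integrals\<close>

lemma tendsto_exp_mult_power_0:
  fixes \<delta> :: real
  assumes "\<delta> > 0"
  shows "((\<lambda>s. exp (- \<delta> * s) * s ^ n) \<longlongrightarrow> 0) at_top"
proof -
  have "filterlim (\<lambda>s. \<delta> * s) at_top at_top"
    by (rule filterlim_tendsto_pos_mult_at_top[OF tendsto_const assms filterlim_ident])
  from filterlim_compose[OF tendsto_power_div_exp_0[of n] this]
  have "((\<lambda>s. inverse (\<delta> ^ n) * ((\<delta> * s) ^ n / exp (\<delta> * s))) \<longlongrightarrow> inverse (\<delta> ^ n) * 0) at_top"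
    by (intro tendsto_intros)
  then show ?thesis using assms by (simp add: exp_minus power_mult_distrib field_simps)
qed

lemma tendsto_inverse_one_plus_square: "((\<lambda>s::real. inverse (1 + s\<^sup>2)) \<longlongrightarrow> 0) at_top"
proof (rule tendsto_inverse_0_at_top, rule filterlim_at_top_mono[OF filterlim_ident])
  show "\<forall>\<^sub>F s::real in at_top. s \<le> 1 + s\<^sup>2"
    using eventually_ge_at_top[of 1] by eventually_elim (simp add: power2_eq_square mult_le_cancel_left1 add_increasing)
qed

text \<open>Layer-cake form of integration in polar coordinates: \<phi>(r) is the integral of
  \<open>D\<close> over [r, \<infinity>), and after Tonelli the inner integral at level
  \<open>s\<close> is the volume of the ball of radius \<open>s\<close>. Concrete radial integrals
  thereby reduce to finding an antiderivative of D(s) s^dim.\<close>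

lemma nn_integral_radial:
  fixes \<phi> D :: "real \<Rightarrow> real"
  assumes D[measurable]: "D \<in> borel_measurable borel"
    and der: "\<And>s. s > 0 \<Longrightarrow> (\<phi> has_real_derivative - D s) (at s)"
    and nonneg: "\<And>s. s > 0 \<Longrightarrow> D s \<ge> 0"
    and lim: "(\<phi> \<longlongrightarrow> 0) at_top"
  shows "(\<integral>\<^sup>+x. ennreal (\<phi> (norm (x::'a::euclidean_space))) \<partial>lborel) =
    ennreal (unit_ball_vol (real DIM('a))) *
      (\<integral>\<^sup>+s. ennreal (D s * s ^ DIM('a)) * indicator {0<..} s \<partial>lborel)"
proof -
  define k where "k x s = ennreal (D s) * indicator {0<..} s * indicator {p. norm (fst p) \<le> snd p} (x, s)" for x :: 'a and s :: real
  have [measurable]: "{p::'a\<times>real. norm (fst p) \<le> snd p} \<in> sets (borel \<Otimes>\<^sub>M borel)"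
    unfolding borel_prod by (intro borel_closed closed_Collect_le continuous_intros)
  have k_meas: "case_prod k \<in> borel_measurable (lborel \<Otimes>\<^sub>M lborel)"
    unfolding k_def case_prod_beta by measurable
  have layer: "ennreal (\<phi> r) = (\<integral>\<^sup>+s. ennreal (D s) * indicator {r..} s \<partial>lborel)" if "r > 0" for r
  proof -
    have "((\<lambda>s. - \<phi> s) \<longlongrightarrow> - 0) at_top" by (intro tendsto_minus lim)
    moreover have "((\<lambda>s. - \<phi> s) has_real_derivative D s) (at s)" if "r \<le> s" for s
      using der[of s] that \<open>r > 0\<close> DERIV_minus[of \<phi> "- D s"] by auto
    ultimately show ?thesis
      using nn_integral_FTC_atLeast[of D r "\<lambda>s. - \<phi> s" "-0"] nonneg \<open>r > 0\<close> by simp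
  qed
  have "(\<integral>\<^sup>+x. ennreal (\<phi> (norm (x::'a))) \<partial>lborel) = (\<integral>\<^sup>+x. (\<integral>\<^sup>+s. k x s \<partial>lborel) \<partial>lborel)"
  proof (rule nn_integral_cong_AE)
    have "AE x in lborel. x \<noteq> (0::'a)" by (rule AE_lborel_singleton)
    then show "AE x in lborel. ennreal (\<phi> (norm (x::'a))) = (\<integral>\<^sup>+s. k x s \<partial>lborel)"
    proof eventually_elim
      case (elim x)
      then show ?case unfolding layer[OF elim[folded zero_less_norm_iff]]
        using elim zero_less_norm_iff[of x]
        by (intro nn_integral_cong) (auto simp: k_def indicator_def simp del: zero_less_norm_iff)
    qed
  qed
  also have "\<dots> = (\<integral>\<^sup>+s. (\<integral>\<^sup>+x. k x s \<partial>lborel) \<partial>lborel)"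
    using lborel_pair.Fubini'[OF k_meas] by simp
  also have "\<dots> = (\<integral>\<^sup>+s. ennreal (unit_ball_vol (real DIM('a))) * (ennreal (D s * s ^ DIM('a)) * indicator {0<..} s) \<partial>lborel)"
  proof (rule nn_integral_cong)
    fix s :: real
    have "(\<integral>\<^sup>+x. k x s \<partial>lborel) = (\<integral>\<^sup>+x. (ennreal (D s) * indicator {0<..} s) * indicator (cball (0::'a) s) x \<partial>lborel)"
      by (intro nn_integral_cong) (auto simp: k_def indicator_def)
    also have "\<dots> = (ennreal (D s) * indicator {0<..} s) * emeasure lborel (cball (0::'a) s)"
      by (subst nn_integral_cmult) (auto intro!: borel_measurable_indicator)
    also have "\<dots> = ennreal (unit_ball_vol (real DIM('a))) * (ennreal (D s * s ^ DIM('a)) * indicator {0<..} s)"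
    proof (cases "s > 0")
      case True
      then show ?thesis using nonneg[of s]
        by (simp add: emeasure_cball ennreal_mult mult_ac)
    qed simp
    finally show "(\<integral>\<^sup>+x. k x s \<partial>lborel) = ennreal (unit_ball_vol (real DIM('a))) * (ennreal (D s * s ^ DIM('a)) * indicator {0<..} s)" .
  qed
  also have "\<dots> = ennreal (unit_ball_vol (real DIM('a))) *
      (\<integral>\<^sup>+s. ennreal (D s * s ^ DIM('a)) * indicator {0<..} s \<partial>lborel)"
    by (rule nn_integral_cmult) simp
  finally show ?thesis .
qed

lemma nn_integral_Ioi_Ici:
  fixes f :: "real \<Rightarrow> ennreal"
  shows "(\<integral>\<^sup>+s. f s * indicator {0<..} s \<partial>lborel) = (\<integral>\<^sup>+s. f s * indicator {0..} s \<partial>lborel)"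
proof (rule nn_integral_cong_AE)
  have "AE s in lborel. s \<noteq> (0::real)" by (rule AE_lborel_singleton)
  then show "AE s in lborel. f s * indicator {0<..} s = f s * indicator {0..} s"
    by eventually_elim (auto simp: indicator_def)
qed

text \<open>Here D(s) s^(2k) is the derivative of (s^2 / (1 + s^2))^(k + 1), which increases from 0
  to 1, so only the ball volume remains. In \<open>fundamental_solution\<close> this function is the
  limiting density of the approximate identity.\<close>

lemma
  assumes dim: "DIM('a::euclidean_space) = 2 * k"
  shows integrable_inverse_power_japanese:
      "integrable lborel (\<lambda>x::'a. inverse ((1 + (norm x)\<^sup>2) ^ Suc k))"
    and integral_inverse_power_japanese:
      "(LINT x::'a|lborel. inverse ((1 + (norm x)\<^sup>2) ^ Suc k)) = unit_ball_vol (2 * k)"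
proof -
  define D where "D s = real (Suc k) * (2 * s) / (1 + s\<^sup>2) ^ Suc (Suc k)" for s :: real
  have pos: "1 + s\<^sup>2 > 0" for s :: real by (simp add: add_pos_nonneg)
  have ne: "1 + s\<^sup>2 \<noteq> 0" for s :: real using pos[of s] by simp
  have [measurable]: "D \<in> borel_measurable borel" unfolding D_def by measurable
  have "(\<integral>\<^sup>+x. ennreal (inverse ((1 + (norm (x::'a))\<^sup>2) ^ Suc k)) \<partial>lborel) =
      ennreal (unit_ball_vol (real DIM('a))) * (\<integral>\<^sup>+s. ennreal (D s * s ^ DIM('a)) * indicator {0<..} s \<partial>lborel)"
  proof (rule nn_integral_radial)
    fix s :: real assume "s > 0"
    show "((\<lambda>s. inverse ((1 + s\<^sup>2) ^ Suc k)) has_real_derivative - D s) (at s)"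
    proof -
      have "((\<lambda>s. (1 + s\<^sup>2) ^ Suc k) has_real_derivative real (Suc k) * (2 * s * (1 + s\<^sup>2) ^ k)) (at s)"
      proof -
        have "((\<lambda>s. 1 + s\<^sup>2) has_real_derivative 2 * s) (at s)"
          by (auto intro!: derivative_eq_intros)
        from DERIV_power[OF this, of "Suc k"] show ?thesis by (simp add: mult_ac)
      qed
      from DERIV_inverse'[OF this]
      have "((\<lambda>s. inverse ((1 + s\<^sup>2) ^ Suc k)) has_real_derivative
          - (inverse ((1 + s\<^sup>2) ^ Suc k) * (real (Suc k) * (2 * s * (1 + s\<^sup>2) ^ k)) * inverse ((1 + s\<^sup>2) ^ Suc k))) (at s)"
        using ne[of s] by (simp del: power_Suc)
      also have "inverse (w ^ Suc k) * (real (Suc k) * (2 * s * w ^ k)) * inverse (w ^ Suc k)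
          = real (Suc k) * (2 * s) / w ^ Suc (Suc k)" if "w \<noteq> 0" for w
        using that by (simp add: field_simps)
      note this[OF ne]
      finally show ?thesis unfolding D_def .
    qed
    show "0 \<le> D s" using \<open>s > 0\<close> pos[of s] by (simp add: D_def)
  next
    from tendsto_power[OF tendsto_inverse_one_plus_square, of "Suc k"]
    show "((\<lambda>s::real. inverse ((1 + s\<^sup>2) ^ Suc k)) \<longlongrightarrow> 0) at_top" by (simp add: power_inverse)
  qed simp
  also have "(\<integral>\<^sup>+s. ennreal (D s * s ^ DIM('a)) * indicator {0<..} s \<partial>lborel) = ennreal (1 - (0\<^sup>2 / (1 + 0\<^sup>2)) ^ Suc k)"
    unfolding nn_integral_Ioi_Ici
  proof (rule nn_integral_FTC_atLeast)
    fix s :: real assume "s \<ge> 0"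
    show "((\<lambda>s. (s\<^sup>2 / (1 + s\<^sup>2)) ^ Suc k) has_real_derivative D s * s ^ DIM('a)) (at s)"
    proof -
      have "((\<lambda>s. s\<^sup>2 / (1 + s\<^sup>2)) has_real_derivative 2 * s / (1 + s\<^sup>2)\<^sup>2) (at s)"
        using ne[of s] by (auto intro!: derivative_eq_intros) (simp add: field_simps power2_eq_square)
      from DERIV_power[OF this, of "Suc k"]
      have "((\<lambda>s. (s\<^sup>2 / (1 + s\<^sup>2)) ^ Suc k) has_real_derivative
          real (Suc k) * (2 * s / (1 + s\<^sup>2)\<^sup>2 * (s\<^sup>2 / (1 + s\<^sup>2)) ^ k)) (at s)" by (simp add: mult_ac)
      moreover have "real (Suc k) * (2 * s / (1 + s\<^sup>2)\<^sup>2 * (s\<^sup>2 / (1 + s\<^sup>2)) ^ k) = D s * s ^ DIM('a)"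
        unfolding D_def dim using ne[of s]
        by (simp add: power_divide power_mult power2_eq_square power_mult_distrib algebra_simps)
      ultimately show ?thesis by simp
    qed
    show "0 \<le> D s * s ^ DIM('a)" using \<open>s \<ge> 0\<close> pos[of s] by (simp add: D_def)
  next
    have "((\<lambda>s::real. 1 - inverse (1 + s\<^sup>2)) \<longlongrightarrow> 1 - 0) at_top"
      by (intro tendsto_intros tendsto_inverse_one_plus_square)
    moreover have "1 - inverse (1 + s\<^sup>2) = s\<^sup>2 / (1 + s\<^sup>2)" for s :: real
      using ne[of s] by (simp add: field_simps)
    ultimately have "((\<lambda>s::real. s\<^sup>2 / (1 + s\<^sup>2)) \<longlongrightarrow> 1) at_top" by simp
    from tendsto_power[OF this, of "Suc k"]
    show "((\<lambda>s::real. (s\<^sup>2 / (1 + s\<^sup>2)) ^ Suc k) \<longlongrightarrow> 1) at_top" by simp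
  qed simp
  finally have nn: "(\<integral>\<^sup>+x. ennreal (inverse ((1 + (norm (x::'a))\<^sup>2) ^ Suc k)) \<partial>lborel) = ennreal (unit_ball_vol (2 * k))"
    by (simp add: dim)
  have nonneg: "0 \<le> inverse ((1 + (norm x)\<^sup>2) ^ Suc k)" for x :: 'a using pos[of "norm x"] by simp
  show "integrable lborel (\<lambda>x::'a. inverse ((1 + (norm x)\<^sup>2) ^ Suc k))"
    by (rule integrableI_nonneg) (use nn nonneg in simp_all)
  show "(LINT x::'a|lborel. inverse ((1 + (norm x)\<^sup>2) ^ Suc k)) = unit_ball_vol (2 * k)"
    by (rule integral_eq_nn_integral[THEN trans]) (use nn nonneg in \<open>simp_all add: unit_ball_vol_nonneg\<close>)
qed

text \<open>This is the size of the resolvent kernel: a singularity of order two below the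
  dimension, integrable at the origin, and exponential decay at infinity.\<close>

lemma integrable_exp_div_norm_power:
  assumes dim: "DIM('a::euclidean_space) = q + 2" and \<delta>: "\<delta> > 0"
  shows "integrable lborel (\<lambda>x::'a. exp (- \<delta> * norm x) / norm x ^ q)"
proof -
  define D where "D s = exp (- \<delta> * s) * (\<delta> / s ^ q + q / s ^ Suc q)" for s :: real
  have [measurable]: "D \<in> borel_measurable borel" unfolding D_def by measurable
  \<comment> \<open>Chosen so that - exp (- \<delta> s) (s^2 + a s + b) has derivative exp (-
    \<delta> s) (\<delta> s^2 + q s): comparing coefficients requires \<delta> a - 2 = q and
    \<delta> b = a.\<close>
  define a b where "a = (q + 2) / \<delta>" and "b = a / \<delta>"
  have "(\<integral>\<^sup>+x. ennreal (exp (- \<delta> * norm (x::'a)) / norm x ^ q) \<partial>lborel) =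
      ennreal (unit_ball_vol (real DIM('a))) * (\<integral>\<^sup>+s. ennreal (D s * s ^ DIM('a)) * indicator {0<..} s \<partial>lborel)"
  proof (rule nn_integral_radial)
    fix s :: real assume s: "s > 0"
    have "((\<lambda>s. exp (- \<delta> * s) * inverse (s ^ q)) has_real_derivative
        exp (- \<delta> * s) * (- \<delta>) * inverse (s ^ q) + - (inverse (s ^ q) * (real q * s ^ (q - Suc 0)) * inverse (s ^ q)) * exp (- \<delta> * s)) (at s)"
      using s by (auto intro!: derivative_eq_intros)
    also have "exp (- \<delta> * s) * (- \<delta>) * inverse (s ^ q) + - (inverse (s ^ q) * (real q * s ^ (q - Suc 0)) * inverse (s ^ q)) * exp (- \<delta> * s) = - D s"
      using s unfolding D_def by (cases q) (auto simp: field_simps)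
    finally show "((\<lambda>s. exp (- \<delta> * s) / s ^ q) has_real_derivative - D s) (at s)"
      by (simp add: divide_inverse)
    show "0 \<le> D s" using s \<delta> by (simp add: D_def)
  next
    have e: "((\<lambda>s::real. exp (- \<delta> * s)) \<longlongrightarrow> 0) at_top"
      using tendsto_exp_mult_power_0[OF \<delta>, of 0] by simp
    show "((\<lambda>s::real. exp (- \<delta> * s) / s ^ q) \<longlongrightarrow> 0) at_top"
    proof (rule tendsto_sandwich[OF _ _ tendsto_const e])
      show "\<forall>\<^sub>F s in at_top. 0 \<le> exp (- \<delta> * s) / s ^ q"
        using eventually_gt_at_top[of 0] by eventually_elim simp
      show "\<forall>\<^sub>F s in at_top. exp (- \<delta> * s) / s ^ q \<le> exp (- \<delta> * s)"
        using eventually_ge_at_top[of 1]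
      proof eventually_elim
        case (elim s)
        then have "1 \<le> s ^ q" by (rule one_le_power)
        then show ?case using elim by (simp add: divide_le_eq mult_le_cancel_left1)
      qed
    qed
  qed simp
  also have "(\<integral>\<^sup>+s. ennreal (D s * s ^ DIM('a)) * indicator {0<..} s \<partial>lborel) =
      (\<integral>\<^sup>+s. ennreal (exp (- \<delta> * s) * (\<delta> * s\<^sup>2 + q * s)) * indicator {0<..} s \<partial>lborel)"
    by (rule nn_integral_cong) (auto simp: D_def dim indicator_def power_add power2_eq_square field_simps)
  also have "\<dots> = ennreal (0 - (- exp (- \<delta> * 0) * (0\<^sup>2 + a * 0 + b)))"
    unfolding nn_integral_Ioi_Ici
  proof (rule nn_integral_FTC_atLeast)
    fix s :: real assume "s \<ge> 0"
    have "((\<lambda>s. - exp (- \<delta> * s) * (s\<^sup>2 + a * s + b)) has_real_derivative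
      exp (- \<delta> * s) * (\<delta> * s\<^sup>2 + (\<delta> * a - 2) * s + (\<delta> * b - a))) (at s)"
      by (auto intro!: derivative_eq_intros simp: algebra_simps)
    moreover have "\<delta> * a - 2 = q" "\<delta> * b - a = 0" using \<delta> by (auto simp: a_def b_def field_simps)
    ultimately show "((\<lambda>s. - exp (- \<delta> * s) * (s\<^sup>2 + a * s + b)) has_real_derivative
      exp (- \<delta> * s) * (\<delta> * s\<^sup>2 + q * s)) (at s)" by simp
    show "0 \<le> exp (- \<delta> * s) * (\<delta> * s\<^sup>2 + q * s)" using \<open>s \<ge> 0\<close> \<delta> by simp
  next
    have "((\<lambda>s. - (exp (- \<delta> * s) * s ^ 2) - a * (exp (- \<delta> * s) * s ^ 1) - b * (exp (- \<delta> * s) * s ^ 0))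
        \<longlongrightarrow> - 0 - a * 0 - b * 0) at_top"
      by (intro tendsto_intros tendsto_exp_mult_power_0 \<delta>)
    moreover have "- (exp (- \<delta> * s) * s ^ 2) - a * (exp (- \<delta> * s) * s ^ 1) - b * (exp (- \<delta> * s) * s ^ 0) =
        - exp (- \<delta> * s) * (s\<^sup>2 + a * s + b)" for s
      by (simp add: algebra_simps)
    ultimately show "((\<lambda>s. - exp (- \<delta> * s) * (s\<^sup>2 + a * s + b)) \<longlongrightarrow> 0) at_top"
      by simp
  qed simp
  finally show ?thesis
    by (intro integrableI_nonneg) (auto simp: ennreal_mult_less_top)
qed

section \<open>Radial fundamental solutions\<close>

lemma lborel_integral_scaleR:
  fixes f :: "'a::euclidean_space \<Rightarrow> 'b::{banach,second_countable_topology}"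
  assumes [measurable]: "f \<in> borel_measurable borel" and c: "c \<noteq> 0"
  shows "(LINT x|lborel. f x) = \<bar>c\<bar> ^ DIM('a) *\<^sub>R (LINT x|lborel. f (c *\<^sub>R x))"
proof -
  have "(LINT x|lborel. f x) = (LINT x|density (distr lborel borel (\<lambda>x. 0 + c *\<^sub>R x)) (\<lambda>_. \<bar>c\<bar> ^ DIM('a)). f x)"
    using lborel_affine[OF c, of "0::'a"] by simp
  also have "\<dots> = (LINT x|lborel. \<bar>c\<bar> ^ DIM('a) *\<^sub>R f (0 + c *\<^sub>R x))"
    by (subst integral_density) (simp_all add: integral_distr)
  finally show ?thesis by simp
qed

text \<open>
  \<open>U1\<close> stands for \<open>U'(r)/r\<close>, so that the two derivative assumptions encode the radial equation
  \<open>U'' + (2k - 1)/r U' = c U\<close>. With \<open>\<rho> = sqrt (\<bar>x\<bar>\<^sup>2 + e\<^sup>2)\<close> one finds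
  \<open>(c - \<Delta>) U(\<rho>) = e\<^sup>2/\<rho>\<^sup>2 (c U - 2k U1)(\<rho>)\<close>, and rescaling by \<open>e\<close> shows that this tends to a multiple of
  the delta distribution.
\<close>

lemma fundamental_solution:
  fixes U U1 :: "real \<Rightarrow> complex" and c :: complex and \<phi> :: "'a::euclidean_space \<Rightarrow> complex"
  assumes dim: "DIM('a) = 2 * k" "2 * k = q + 2"
    and dU: "\<And>r. r > 0 \<Longrightarrow> (U has_vector_derivative r *\<^sub>R U1 r) (at r)"
    and dU1: "\<And>r. r > 0 \<Longrightarrow> (U1 has_vector_derivative (c * U r - of_nat (2 * k) * U1 r) /\<^sub>R r) (at r)"
    and bdU: "\<And>r. r > 0 \<Longrightarrow> cmod (U r) \<le> C * (exp (- \<delta> * r) / r ^ q)" and \<delta>: "\<delta> > 0"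
    and bdH: "\<And>r. r > 0 \<Longrightarrow> cmod (of_real (r ^ (2 * k)) * (c * U r - of_nat (2 * k) * U1 r)) \<le> B"
    and limH: "((\<lambda>r. of_real (r ^ (2 * k)) * (c * U r - of_nat (2 * k) * U1 r)) \<longlongrightarrow> H0) (at_right 0)"
    and test: "test_function \<phi>"
  shows "(LINT y|lborel. U (norm y) * (c * \<phi> y - laplacian \<phi> y)) = H0 * unit_ball_vol (2 * k) * \<phi> 0"
proof -
  define A where "A r = c * U r - of_nat (2 * k) * U1 r" for r
  define \<rho> where "\<rho> e x = sqrt ((norm x)\<^sup>2 + e\<^sup>2)" for e :: real and x :: 'a
  define L where "L y = c * \<phi> y - laplacian \<phi> y" for y
  have \<rho>_pos: "\<rho> e x > 0" if "e > 0" for e x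
    using that by (simp add: \<rho>_def add_nonneg_pos)
  have \<rho>_sq: "(\<rho> e x)\<^sup>2 = (norm x)\<^sup>2 + e\<^sup>2" for e x by (simp add: \<rho>_def)
  have contU: "continuous_on {0<..} U" and contU1: "continuous_on {0<..} U1"
    using dU dU1 by (force intro: continuous_at_imp_continuous_on has_vector_derivative_continuous)+
  have contA: "continuous_on {0<..} A"
    unfolding A_def by (intro continuous_intros contU contU1)
  have cont\<rho>: "continuous_on UNIV (\<rho> e)" for e unfolding \<rho>_def by (intro continuous_intros)
  have cont: "continuous_on UNIV (\<lambda>x. f (\<rho> e x))" if "continuous_on {0<..} f" "e > 0" for f :: "real \<Rightarrow> complex" and e
    by (rule continuous_on_compose2[OF that(1) cont\<rho>]) (use \<rho>_pos that in auto)
  have CcL: "Cc L"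
    unfolding L_def by (intro Cc_diff Cc_mult test_function_Cc test test_function_laplacian_Cc continuous_intros)
  have Cc\<phi>: "Cc \<phi>" by (rule test_function_Cc[OF test])

  have green: "(LINT x|lborel. U (\<rho> e x) * L x) = (LINT x|lborel. \<phi> x * (of_real (e\<^sup>2 / (\<rho> e x)\<^sup>2) * A (\<rho> e x)))"
    if e: "e > 0" for e
  proof -
    \<comment> \<open>Since the gradient of \<rho> is x / \<rho> and U' = r U1, the gradient of
      U(\<rho>) is U1(\<rho>) x. Thus \<open>V b\<close> is the \<open>b\<close>-component of the
      Green field U(\<rho>) grad \<phi> - \<phi> grad U(\<rho>), and \<open>V' b\<close> its
      derivative along \<open>b\<close>, in which the mixed first-order terms have
      cancelled.\<close>
    define V where "V b x = U (\<rho> e x) * partial b \<phi> x - (of_real (x \<bullet> b) * U1 (\<rho> e x)) * \<phi> x" for b x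
    define V' where "V' b x = U (\<rho> e x) * partial b (partial b \<phi>) x
       - (U1 (\<rho> e x) + of_real ((x \<bullet> b)\<^sup>2 / (\<rho> e x)\<^sup>2) * A (\<rho> e x)) * \<phi> x" for b x
    have ne: "\<rho> e x \<noteq> 0" for x using \<rho>_pos[OF e, of x] by simp
    have CcV': "Cc (V' b)" if "b \<in> Basis" for b
      unfolding V'_def using that e ne
      by (intro Cc_diff Cc_mult Cc\<phi> test_function_Cc test_function_partial test continuous_intros cont contU contU1 contA cont\<rho>) auto
    have "(LINT x|lborel. V' b x) = 0" if b: "b \<in> Basis" for b
    proof (rule integral_directional_derivative_eq_0[of "V b" _ b])
      show "Cc (V b)"
        unfolding V_def using that e
        by (intro Cc_diff Cc_mult Cc\<phi> test_function_Cc test_function_partial test continuous_intros cont contU contU1)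
      show "Cc (V' b)" by (rule CcV'[OF b])
      fix x
      have d\<rho>: "((\<lambda>t. \<rho> e (x + t *\<^sub>R b)) has_real_derivative (x \<bullet> b) / \<rho> e x) (at 0)"
      proof -
        have eq: "\<rho> e (x + t *\<^sub>R b) = sqrt (x \<bullet> x + 2 * t * (x \<bullet> b) + t\<^sup>2 + e\<^sup>2)" for t
          unfolding \<rho>_def power2_norm_eq_inner using b
          by (simp add: inner_add_left inner_add_right inner_commute power2_eq_square algebra_simps)
        have p: "x \<bullet> x + e\<^sup>2 > 0" using e by (simp add: add_nonneg_pos)
        have r: "\<rho> e x = sqrt (x \<bullet> x + e\<^sup>2)" by (simp add: \<rho>_def power2_norm_eq_inner)
        show ?thesis unfolding eq using p unfolding r
          by (auto intro!: derivative_eq_intros simp: field_simps)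
      qed
      have chain: "((\<lambda>t. f (\<rho> e (x + t *\<^sub>R b))) has_vector_derivative ((x \<bullet> b) / \<rho> e x) *\<^sub>R f') (at 0)"
        if "(f has_vector_derivative f') (at (\<rho> e x))" for f :: "real \<Rightarrow> complex" and f'
        using vector_diff_chain_at[of "\<lambda>t. \<rho> e (x + t *\<^sub>R b)" "(x \<bullet> b) / \<rho> e x" 0 f f'] d\<rho> that
        by (simp add: o_def has_real_derivative_iff_has_vector_derivative)
      have d1: "((\<lambda>t. U (\<rho> e (x + t *\<^sub>R b))) has_vector_derivative of_real (x \<bullet> b) * U1 (\<rho> e x)) (at 0)"
        using chain[OF dU[OF \<rho>_pos[OF e]]] ne[of x] by (simp add: scaleR_conv_of_real)
      have d2: "((\<lambda>t. U1 (\<rho> e (x + t *\<^sub>R b))) has_vector_derivative of_real ((x \<bullet> b) / (\<rho> e x)\<^sup>2) * A (\<rho> e x)) (at 0)"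
        using chain[OF dU1[OF \<rho>_pos[OF e]]] ne[of x]
        by (simp add: scaleR_conv_of_real A_def power2_eq_square field_simps)
      have d3: "((\<lambda>t. complex_of_real ((x + t *\<^sub>R b) \<bullet> b)) has_vector_derivative 1) (at 0)"
        using b by (auto intro!: derivative_eq_intros has_vector_derivative_of_real simp: inner_add_left)
      note d4 = test_function_directional[OF test, of x b]
      note d5 = test_function_directional[OF test_function_partial[OF test b], of x b]
      show "((\<lambda>t. V b (x + t *\<^sub>R b)) has_vector_derivative V' b x) (at 0)"
        unfolding V_def V'_def
        by (rule has_vector_derivative_eq_rhs,
            rule has_vector_derivative_diff[OF has_vector_derivative_mult[OF d1 d5]
              has_vector_derivative_mult[OF has_vector_derivative_mult[OF d3 d2] d4]])
           (simp add: algebra_simps power2_eq_square)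
    qed
    then have "0 = (\<Sum>b\<in>Basis. LINT x|lborel. V' b x)" by simp
    also have "\<dots> = (LINT x|lborel. (\<Sum>b\<in>Basis. V' b x))"
      by (subst Bochner_Integration.integral_sum) (auto intro: Cc_integrable CcV')
    also have "\<dots> = (LINT x|lborel. \<phi> x * (of_real (e\<^sup>2 / (\<rho> e x)\<^sup>2) * A (\<rho> e x)) - U (\<rho> e x) * L x)"
    proof (rule Bochner_Integration.integral_cong)
      fix x :: 'a
      \<comment> \<open>\<open>w\<close> is |x|^2 / \<rho>^2. With w = 1 the radial equation would
        leave nothing but - U(\<rho>) L; the deficit e^2 / \<rho>^2 is the whole effect of smoothing
        the radius.\<close>
      define w where "w = (\<Sum>b\<in>Basis. (x \<bullet> b)\<^sup>2) / (\<rho> e x)\<^sup>2"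
      have w: "w = 1 - e\<^sup>2 / (\<rho> e x)\<^sup>2"
      proof -
        have "(\<Sum>b\<in>Basis. (x \<bullet> b)\<^sup>2) = (\<rho> e x)\<^sup>2 - e\<^sup>2"
          unfolding \<rho>_sq power2_norm_eq_inner euclidean_inner[of x x] by (simp add: power2_eq_square)
        then show ?thesis unfolding w_def using ne[of x] by (simp add: diff_divide_distrib)
      qed
      have 1: "(\<Sum>b\<in>Basis. V' b x) = (\<Sum>b\<in>Basis. U (\<rho> e x) * partial b (partial b \<phi>) x)
         - (\<Sum>b\<in>Basis. U1 (\<rho> e x) + of_real ((x \<bullet> b)\<^sup>2 / (\<rho> e x)\<^sup>2) * A (\<rho> e x)) * \<phi> x"
        by (simp only: V'_def sum_subtractf sum_distrib_right)
      have 2: "(\<Sum>b\<in>Basis. U (\<rho> e x) * partial b (partial b \<phi>) x) = U (\<rho> e x) * laplacian \<phi> x"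
        by (simp only: laplacian_def sum_distrib_left)
      have 3: "(\<Sum>b\<in>(Basis::'a set). U1 (\<rho> e x) + of_real ((x \<bullet> b)\<^sup>2 / (\<rho> e x)\<^sup>2) * A (\<rho> e x))
         = of_nat (2 * k) * U1 (\<rho> e x) + of_real w * A (\<rho> e x)"
        by (simp only: sum.distrib sum_constant dim(1) w_def sum_divide_distrib of_real_sum sum_distrib_right)
      have 4: "of_nat (2 * k) * U1 (\<rho> e x) = c * U (\<rho> e x) - A (\<rho> e x)"
        by (simp add: A_def)
      show "(\<Sum>b\<in>Basis. V' b x) = \<phi> x * (of_real (e\<^sup>2 / (\<rho> e x)\<^sup>2) * A (\<rho> e x)) - U (\<rho> e x) * L x"
        unfolding 1 2 3 4 w by (simp add: L_def algebra_simps)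
    qed simp
    also have "\<dots> = (LINT x|lborel. \<phi> x * (of_real (e\<^sup>2 / (\<rho> e x)\<^sup>2) * A (\<rho> e x))) - (LINT x|lborel. U (\<rho> e x) * L x)"
    proof (rule Bochner_Integration.integral_diff)
      have "Cc (\<lambda>x. (of_real (e\<^sup>2 / (\<rho> e x)\<^sup>2) * A (\<rho> e x)) * \<phi> x)"
        using e ne by (intro Cc_mult Cc\<phi> continuous_intros cont contA cont\<rho>) auto
      from Cc_integrable[OF this]
      show "integrable lborel (\<lambda>x. \<phi> x * (of_real (e\<^sup>2 / (\<rho> e x)\<^sup>2) * A (\<rho> e x)))" by (simp add: mult_ac)
      show "integrable lborel (\<lambda>x. U (\<rho> e x) * L x)"
        using e by (intro Cc_integrable Cc_mult CcL cont contU)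
    qed
    finally show ?thesis by simp
  qed

  define \<sigma> where "\<sigma> = \<rho> 1"
  have \<sigma>: "\<sigma> x > 0" "\<sigma> x \<ge> 1" for x using \<rho>_pos[of 1 x] by (auto simp: \<sigma>_def \<rho>_def)
  \<comment> \<open>Under x -> e x the radius \<rho> becomes e \<sigma>. The Jacobian e^(2k) times
    the deficit 1 / \<sigma>^2 equals \<sigma>^(-2k-2) (e \<sigma>)^(2k), so that r^(2k) A(r)
    appears at r = e \<sigma>, the combination controlled by \<open>bdH\<close> and
    \<open>limH\<close>. The remaining weight is integrable and independent of
    \<open>e\<close>.\<close>
  have scaled: "(LINT x|lborel. \<phi> x * (of_real (e\<^sup>2 / (\<rho> e x)\<^sup>2) * A (\<rho> e x)))
     = (LINT x|lborel. \<phi> (e *\<^sub>R x) * (of_real (inverse (\<sigma> x ^ (2 * Suc k))) * (of_real ((e * \<sigma> x) ^ (2 * k)) * A (e * \<sigma> x))))"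
    (is "_ = (LINT x|lborel. ?G e x)") if e: "e > 0" for e
  proof -
    have ne: "\<rho> e x \<noteq> 0" for x using \<rho>_pos[OF e, of x] by simp
    have "Cc (\<lambda>x. (of_real (e\<^sup>2 / (\<rho> e x)\<^sup>2) * A (\<rho> e x)) * \<phi> x)"
      using e ne by (intro Cc_mult Cc\<phi> continuous_intros cont contA cont\<rho>) auto
    from Cc_borel[OF this]
    have "(\<lambda>x. \<phi> x * (of_real (e\<^sup>2 / (\<rho> e x)\<^sup>2) * A (\<rho> e x))) \<in> borel_measurable borel" by (simp add: mult_ac)
    from lborel_integral_scaleR[OF this, of e]
    have "(LINT x|lborel. \<phi> x * (of_real (e\<^sup>2 / (\<rho> e x)\<^sup>2) * A (\<rho> e x))) =
      (LINT x|lborel. of_real (e ^ (2 * k)) * (\<phi> (e *\<^sub>R x) * (of_real (e\<^sup>2 / (\<rho> e (e *\<^sub>R x))\<^sup>2) * A (\<rho> e (e *\<^sub>R x)))))"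
      using e by (simp only: integral_mult_right_zero dim(1) scaleR_conv_of_real abs_of_pos less_imp_neq[symmetric] not_False_eq_True)
    also have "\<dots> = (LINT x|lborel. ?G e x)"
    proof (rule Bochner_Integration.integral_cong)
      fix x
      have "\<rho> e (e *\<^sub>R x) = sqrt (e\<^sup>2 * ((norm x)\<^sup>2 + 1\<^sup>2))"
        by (simp add: \<rho>_def power_mult_distrib algebra_simps)
      also have "\<dots> = e * \<sigma> x" using e by (simp add: real_sqrt_mult \<sigma>_def \<rho>_def)
      finally have r: "\<rho> e (e *\<^sub>R x) = e * \<sigma> x" .
      have "e ^ (2 * k) * (e\<^sup>2 / (e * \<sigma> x)\<^sup>2) = inverse (\<sigma> x ^ (2 * Suc k)) * (e * \<sigma> x) ^ (2 * k)"
        using e \<sigma>(1)[of x] by (simp add: power_mult_distrib power2_eq_square field_simps)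
      then have "complex_of_real (e ^ (2 * k)) * of_real (e\<^sup>2 / (e * \<sigma> x)\<^sup>2) =
        of_real (inverse (\<sigma> x ^ (2 * Suc k))) * of_real ((e * \<sigma> x) ^ (2 * k))"
        unfolding of_real_mult[symmetric] by (rule arg_cong)
      then show "of_real (e ^ (2 * k)) * (\<phi> (e *\<^sub>R x) * (of_real (e\<^sup>2 / (\<rho> e (e *\<^sub>R x))\<^sup>2) * A (\<rho> e (e *\<^sub>R x)))) = ?G e x"
        unfolding r by (metis mult.assoc mult.left_commute)
    qed simp
    finally show ?thesis .
  qed

  have \<sigma>_pow: "inverse (\<sigma> x ^ (2 * Suc k)) = inverse ((1 + (norm x)\<^sup>2) ^ Suc k)" for x
    unfolding power_mult by (simp add: \<sigma>_def \<rho>_sq add.commute del: power_Suc)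
  define e where "e n = inverse (real (Suc n))" for n
  have e_pos: "e n > 0" for n by (simp add: e_def)
  have e_lim: "e \<longlonglongrightarrow> 0" unfolding e_def by (rule LIMSEQ_inverse_real_of_nat)
  obtain M where M: "M \<ge> 0" "\<And>x. norm (\<phi> x) \<le> M" using Cc_bounded[OF Cc\<phi>] by blast
  obtain NL where NL: "NL \<ge> 0" "\<And>x. norm (L x) \<le> NL" using Cc_bounded[OF CcL] by blast

  have "(\<lambda>n. LINT x|lborel. ?G (e n) x) \<longlonglongrightarrow> (LINT x|lborel. \<phi> 0 * (of_real (inverse (\<sigma> x ^ (2 * Suc k))) * H0))"
  proof (rule integral_dominated_convergence[where w="\<lambda>x. M * (inverse ((1 + (norm x)\<^sup>2) ^ Suc k) * B)"])
    have [measurable]: "\<sigma> \<in> borel_measurable borel"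
      unfolding \<sigma>_def by (intro borel_measurable_continuous_onI cont\<rho>)
    show "(\<lambda>x. \<phi> 0 * (of_real (inverse (\<sigma> x ^ (2 * Suc k))) * H0)) \<in> borel_measurable lborel" by measurable
    show "?G (e n) \<in> borel_measurable lborel" for n
    proof -
      have "continuous_on UNIV (\<lambda>x. A (e n * \<sigma> x))"
        unfolding \<sigma>_def by (rule continuous_on_compose2[OF contA])
          (use \<rho>_pos[of 1] e_pos in \<open>auto intro!: continuous_intros cont\<rho>\<close>)
      then have [measurable]: "(\<lambda>x. A (e n * \<sigma> x)) \<in> borel_measurable borel"
        by (rule borel_measurable_continuous_onI)
      have [measurable]: "\<phi> \<in> borel_measurable borel" by (rule Cc_borel[OF Cc\<phi>])
      show ?thesis by measurable
    qed
    show "integrable lborel (\<lambda>x::'a. M * (inverse ((1 + (norm x)\<^sup>2) ^ Suc k) * B))"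
      by (intro integrable_mult_right integrable_mult_left integrable_inverse_power_japanese dim)
    show "AE x in lborel. (\<lambda>n. ?G (e n) x) \<longlonglongrightarrow> \<phi> 0 * (of_real (inverse (\<sigma> x ^ (2 * Suc k))) * H0)"
    proof (rule AE_I2)
      fix x :: 'a
      have "isCont \<phi> 0" using Cc\<phi> by (simp add: Cc_def continuous_on_eq_continuous_at)
      moreover have "(\<lambda>n. e n *\<^sub>R x) \<longlonglongrightarrow> 0 *\<^sub>R x" by (intro tendsto_intros e_lim)
      ultimately have 1: "(\<lambda>n. \<phi> (e n *\<^sub>R x)) \<longlonglongrightarrow> \<phi> 0"
        using isCont_tendsto_compose[of "0::'a" \<phi> "\<lambda>n. e n *\<^sub>R x" sequentially] by simp
      have "(\<lambda>n. e n * \<sigma> x) \<longlonglongrightarrow> 0 * \<sigma> x" by (intro tendsto_intros e_lim)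
      then have "filterlim (\<lambda>n. e n * \<sigma> x) (at_right 0) sequentially"
        using e_pos \<sigma>(1)[of x] by (auto simp: filterlim_at intro!: always_eventually less_imp_neq[symmetric])
      from filterlim_compose[OF limH this]
      have 2: "(\<lambda>n. of_real ((e n * \<sigma> x) ^ (2 * k)) * A (e n * \<sigma> x)) \<longlonglongrightarrow> H0"
        by (simp add: A_def)
      show "(\<lambda>n. ?G (e n) x) \<longlonglongrightarrow> \<phi> 0 * (of_real (inverse (\<sigma> x ^ (2 * Suc k))) * H0)"
        by (intro tendsto_mult tendsto_const 1 2)
    qed
    show "AE x in lborel. norm (?G (e n) x) \<le> M * (inverse ((1 + (norm x)\<^sup>2) ^ Suc k) * B)" for n
    proof (rule AE_I2)
      fix x :: 'a
      have "norm (of_real ((e n * \<sigma> x) ^ (2 * k)) * A (e n * \<sigma> x)) \<le> B"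
        unfolding A_def using e_pos[of n] \<sigma>(1)[of x] by (intro bdH) simp
      moreover have "norm (complex_of_real (inverse (\<sigma> x ^ (2 * Suc k)))) = inverse ((1 + (norm x)\<^sup>2) ^ Suc k)"
        unfolding \<sigma>_pow[symmetric] norm_of_real using \<sigma>(1)[of x] by (simp del: power_Suc)
      ultimately show "norm (?G (e n) x) \<le> M * (inverse ((1 + (norm x)\<^sup>2) ^ Suc k) * B)"
        unfolding norm_mult[of "\<phi> (e n *\<^sub>R x)"] norm_mult[of "complex_of_real (inverse (\<sigma> x ^ (2 * Suc k)))"]
        by (intro mult_mono M) (auto intro: mult_nonneg_nonneg)
    qed
  qed
  also have "(LINT x::'a|lborel. \<phi> 0 * (of_real (inverse (\<sigma> x ^ (2 * Suc k))) * H0)) = H0 * unit_ball_vol (2 * k) * \<phi> 0"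
  proof -
    have "(LINT x::'a|lborel. \<phi> 0 * (of_real (inverse (\<sigma> x ^ (2 * Suc k))) * H0)) =
      \<phi> 0 * (of_real (LINT x::'a|lborel. inverse ((1 + (norm x)\<^sup>2) ^ Suc k)) * H0)"
      unfolding \<sigma>_pow by (simp only: integral_mult_right_zero integral_mult_left_zero integral_complex_of_real)
    then show ?thesis by (simp add: integral_inverse_power_japanese[OF dim(1)] mult_ac del: power_Suc)
  qed
  finally have lim1: "(\<lambda>n. LINT x|lborel. U (\<rho> (e n) x) * L x) \<longlonglongrightarrow> H0 * unit_ball_vol (2 * k) * \<phi> 0"
    using green[OF e_pos] scaled[OF e_pos] by simp

  have "(\<lambda>n. LINT x|lborel. U (\<rho> (e n) x) * L x) \<longlonglongrightarrow> (LINT x|lborel. U (norm x) * L x)"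
  proof (rule integral_dominated_convergence[where w="\<lambda>x. NL * C * (exp (- \<delta> * norm x) / norm x ^ q)"])
    show "integrable lborel (\<lambda>x::'a. NL * C * (exp (- \<delta> * norm x) / norm x ^ q))"
      by (intro integrable_mult_right integrable_exp_div_norm_power) (use dim \<delta> in auto)
    have [measurable]: "L \<in> borel_measurable borel" by (rule Cc_borel[OF CcL])
    show "(\<lambda>x. U (\<rho> (e n) x) * L x) \<in> borel_measurable lborel" for n
      using borel_measurable_continuous_onI[OF cont[OF contU e_pos[of n]]] by simp
    have "(\<lambda>x. U (norm (x::'a))) \<in> borel_measurable borel"
    proof (rule borel_measurable_continuous_countable_exceptions[of "{0}"])
      show "continuous_on (- {0}) (\<lambda>x. U (norm (x::'a)))"
        by (rule continuous_on_compose2[OF contU]) (auto intro!: continuous_intros)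
    qed simp
    then show "(\<lambda>x. U (norm x) * L x) \<in> borel_measurable lborel" by simp
    have ne: "AE x in lborel. x \<noteq> (0::'a)" by (rule AE_lborel_singleton)
    then show "AE x in lborel. (\<lambda>n. U (\<rho> (e n) x) * L x) \<longlonglongrightarrow> U (norm x) * L x"
    proof eventually_elim
      case (elim x)
      have "(\<lambda>n. \<rho> (e n) x) \<longlonglongrightarrow> sqrt ((norm x)\<^sup>2 + 0\<^sup>2)"
        unfolding \<rho>_def by (intro tendsto_intros e_lim)
      moreover have "isCont U (norm x)"
        using dU[of "norm x"] elim by (auto intro: has_vector_derivative_continuous)
      ultimately have "(\<lambda>n. U (\<rho> (e n) x)) \<longlonglongrightarrow> U (norm x)"
        using isCont_tendsto_compose by fastforce
      then show ?case by (intro tendsto_intros)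
    qed
    show "AE x in lborel. norm (U (\<rho> (e n) x) * L x) \<le> NL * C * (exp (- \<delta> * norm x) / norm x ^ q)" for n
      using ne
    proof eventually_elim
      case (elim x)
      \<comment> \<open>The majorant exp (- \<delta> r) / r^q decreases in \<open>r\<close>.
        Smoothing only enlarges the radius, so the majorant at |x| itself dominates for all
        \<open>n\<close>.\<close>
      have le: "norm x \<le> \<rho> (e n) x" unfolding \<rho>_def by (rule real_le_rsqrt) simp
      have C: "C \<ge> 0"
      proof -
        have "0 \<le> C * (exp (- \<delta> * 1) / 1 ^ q)" using bdU[of 1] norm_ge_zero order_trans zero_less_one by blast
        then show ?thesis by (simp add: zero_le_mult_iff)
      qed
      have "norm (U (\<rho> (e n) x)) \<le> C * (exp (- \<delta> * \<rho> (e n) x) / \<rho> (e n) x ^ q)"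
        by (rule bdU[OF \<rho>_pos[OF e_pos]])
      also have "\<dots> \<le> C * (exp (- \<delta> * norm x) / norm x ^ q)"
        using elim le \<delta> C by (intro mult_left_mono frac_le power_mono) auto
      finally have "norm (U (\<rho> (e n) x)) * norm (L x) \<le> C * (exp (- \<delta> * norm x) / norm x ^ q) * NL"
        using C by (intro mult_mono NL) auto
      then show ?case by (simp add: norm_mult mult_ac)
    qed
  qed
  from LIMSEQ_unique[OF this lim1] show ?thesis by (simp add: L_def)
qed

section \<open>Bump functions\<close>

text \<open>The derivatives of \<open>exp (- 1/s)\<close>, continued by \<open>0\<close>, are combinations of these functions.\<close>

definition flat :: "nat \<Rightarrow> real \<Rightarrow> real" where
  "flat k s = (if s > 0 then exp (- inverse s) * inverse s ^ k else 0)"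

lemma flat_nonneg: "flat k s \<ge> 0"
  by (simp add: flat_def)

lemma tendsto_flat_at_right_0: "(flat k \<longlongrightarrow> 0) (at_right 0)"
proof -
  have "((\<lambda>y::real. y ^ k / exp y) \<longlongrightarrow> 0) at_top" by (rule tendsto_power_div_exp_0)
  from filterlim_compose[OF this filterlim_inverse_at_top_right]
  have "((\<lambda>s::real. inverse s ^ k / exp (inverse s)) \<longlongrightarrow> 0) (at_right 0)" .
  then show ?thesis
  proof (rule Lim_transform_eventually)
    show "\<forall>\<^sub>F s in at_right 0. inverse s ^ k / exp (inverse s) = flat k s"
      by (auto simp: eventually_at_filter flat_def exp_minus field_simps)
  qed
qed

lemma flat_has_derivative:
  "(flat k has_real_derivative flat (k + 2) s - real k * flat (Suc k) s) (at s)"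
proof -
  consider "s > 0" | "s < 0" | "s = 0" by linarith
  then show ?thesis
  proof cases
    case 1
    have "((\<lambda>s. exp (- inverse s) * inverse s ^ k) has_real_derivative
       flat (k + 2) s - real k * flat (Suc k) s) (at s)"
    proof -
      define y where "y = inverse s"
      have i: "(inverse has_real_derivative - (y * y)) (at s)"
        using 1 unfolding y_def by (auto intro!: derivative_eq_intros)
      have "((\<lambda>s. exp (- inverse s)) has_real_derivative exp (- y) * (y * y)) (at s)"
        using DERIV_fun_exp[OF DERIV_minus[OF i]] by (simp add: y_def)
      from DERIV_mult[OF this DERIV_power[OF i, of k]]
      have "((\<lambda>s. exp (- inverse s) * inverse s ^ k) has_real_derivative
         exp (- y) * (y * y) * y ^ k + real k * (- (y * y) * y ^ (k - Suc 0)) * exp (- y)) (at s)"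
        by (simp add: y_def)
      also have "exp (- y) * (y * y) * y ^ k + real k * (- (y * y) * y ^ (k - Suc 0)) * exp (- y)
          = flat (k + 2) s - real k * flat (Suc k) s"
        using 1 by (cases k) (simp_all add: flat_def algebra_simps flip: y_def)
      finally show ?thesis .
    qed
    then show ?thesis
      by (rule has_field_derivative_transform_within_open[where S="{0<..}"])
         (use 1 in \<open>auto simp: flat_def\<close>)
  next
    case 2
    have "((\<lambda>_. 0) has_real_derivative 0) (at s)" by simp
    then have "(flat k has_real_derivative 0) (at s)"
      by (rule has_field_derivative_transform_within_open[where S="{..<0}"])
         (use 2 in \<open>auto simp: flat_def\<close>)
    then show ?thesis using 2 by (simp add: flat_def)
  next
    case 3
    \<comment> \<open>For h > 0 division by \<open>h\<close> raises the index by one, so the right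
      difference quotient at 0 is again a flat function; the left one is constantly 0.\<close>
    have "((\<lambda>h. flat k h / h) \<longlongrightarrow> 0) (at_right 0)"
    proof (rule Lim_transform_eventually[OF tendsto_flat_at_right_0[of "Suc k"]])
      show "\<forall>\<^sub>F h in at_right 0. flat (Suc k) h = flat k h / h"
        by (auto simp: eventually_at_filter flat_def divide_inverse)
    qed
    moreover have "((\<lambda>h. flat k h / h) \<longlongrightarrow> 0) (at_left 0)"
      by (rule Lim_transform_eventually[OF tendsto_const])
         (auto simp: eventually_at_filter flat_def)
    ultimately have "((\<lambda>h. flat k h / h) \<longlongrightarrow> 0) (at 0)"
      by (simp add: filterlim_split_at)
    then show ?thesis unfolding 3 DERIV_def by (simp add: flat_def)
  qed
qed

text \<open>A class of functions closed under partial derivatives, hence consisting of smooth functions.\<close>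

inductive smooth_generated :: "('a::euclidean_space \<Rightarrow> real) \<Rightarrow> ('a \<Rightarrow> complex) \<Rightarrow> bool" for q where
  const: "smooth_generated q (\<lambda>_. c)"
| inner: "smooth_generated q (\<lambda>x. complex_of_real ((x - a) \<bullet> b))"
| flat: "smooth_generated q (\<lambda>x. complex_of_real (flat k (q x)))"
| add: "smooth_generated q f \<Longrightarrow> smooth_generated q g \<Longrightarrow> smooth_generated q (\<lambda>x. f x + g x)"
| mult: "smooth_generated q f \<Longrightarrow> smooth_generated q g \<Longrightarrow> smooth_generated q (\<lambda>x. f x * g x)"

text \<open>Only \<open>flat k\<close> of the quadratic brings in new factors: its chain rule yields
  \<open>flat (k + 2)\<close>, \<open>flat (Suc k)\<close> and the inner derivative -2 (x - a)
  \<bullet> h. The last one is why \<open>inner\<close> is among the generators.\<close>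

lemma smooth_generated_has_derivative:
  assumes "smooth_generated (\<lambda>x. r - (norm (x - a))\<^sup>2) f"
  shows "\<exists>f'. (\<forall>x. (f has_derivative f' x) (at x)) \<and>
    (\<forall>b. smooth_generated (\<lambda>x. r - (norm (x - a))\<^sup>2) (\<lambda>x. f' x b))"
  using assms
proof induction
  case (const c)
  have "(\<forall>x. ((\<lambda>_. c) has_derivative (\<lambda>_. 0)) (at x))" by simp
  then show ?case using smooth_generated.const
    by (intro exI[of _ "\<lambda>x b. 0"]) auto
next
  case (inner c b)
  have "(\<forall>x. ((\<lambda>x. complex_of_real ((x - c) \<bullet> b)) has_derivative (\<lambda>h. complex_of_real (h \<bullet> b))) (at x))"
    by (auto intro!: derivative_eq_intros)
  then show ?case using smooth_generated.const
    by (intro exI[of _ "\<lambda>x h. complex_of_real (h \<bullet> b)"]) auto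
next
  case (flat k)
  let ?q = "\<lambda>x. r - (norm (x - a))\<^sup>2"
  define D where "D x = complex_of_real (flat (k + 2) (?q x)) +
     (- of_nat k) * complex_of_real (flat (Suc k) (?q x))" for x
  have "((\<lambda>x. complex_of_real (flat k (?q x))) has_derivative
     (\<lambda>h. D x * ((-2) * complex_of_real ((x - a) \<bullet> h)))) (at x)" for x
  proof -
    have "(?q has_derivative (\<lambda>h. - (2 * ((x - a) \<bullet> h)))) (at x)"
      unfolding power2_norm_eq_inner
      by (auto intro!: derivative_eq_intros simp: inner_commute)
    from DERIV_compose_FDERIV[OF flat_has_derivative this]
    have "((\<lambda>x. flat k (?q x)) has_derivative
      (\<lambda>h. - (2 * ((x - a) \<bullet> h)) * (flat (k + 2) (?q x) - real k * flat (Suc k) (?q x)))) (at x)" .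
    from has_derivative_of_real[OF this]
    show ?thesis by (rule has_derivative_eq_rhs) (simp add: D_def fun_eq_iff algebra_simps)
  qed
  moreover have "smooth_generated ?q (\<lambda>x. D x * ((-2) * complex_of_real ((x - a) \<bullet> h)))" for h
    unfolding D_def by (intro smooth_generated.intros)
  ultimately show ?case by (intro exI[of _ "\<lambda>x h. D x * ((-2) * complex_of_real ((x - a) \<bullet> h))"]) blast
next
  case (add f g)
  then obtain f' g' where
    "\<And>x. (f has_derivative f' x) (at x)" "\<And>b. smooth_generated (\<lambda>x. r - (norm (x - a))\<^sup>2) (\<lambda>x. f' x b)"
    "\<And>x. (g has_derivative g' x) (at x)" "\<And>b. smooth_generated (\<lambda>x. r - (norm (x - a))\<^sup>2) (\<lambda>x. g' x b)"
    by blast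
  then show ?case
    by (intro exI[of _ "\<lambda>x b. f' x b + g' x b"]) (auto intro: has_derivative_add smooth_generated.add)
next
  case (mult f g)
  then obtain f' g' where
    "\<And>x. (f has_derivative f' x) (at x)" "\<And>b. smooth_generated (\<lambda>x. r - (norm (x - a))\<^sup>2) (\<lambda>x. f' x b)"
    "\<And>x. (g has_derivative g' x) (at x)" "\<And>b. smooth_generated (\<lambda>x. r - (norm (x - a))\<^sup>2) (\<lambda>x. g' x b)"
    by blast
  with mult.hyps show ?case
    by (intro exI[of _ "\<lambda>x b. f x * g' x b + f' x b * g x"] conjI allI has_derivative_mult
          smooth_generated.add smooth_generated.mult) auto
qed

lemma smooth_generated_Ck:
  assumes "smooth_generated (\<lambda>x. r - (norm (x - a))\<^sup>2) f"
  shows "Ck k f"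
  using assms
proof (induction k arbitrary: f)
  case 0
  then obtain f' where "\<And>x. (f has_derivative f' x) (at x)"
    using smooth_generated_has_derivative by blast
  then show ?case by (auto intro: has_derivative_continuous_on)
next
  case (Suc k)
  then obtain f' where f': "\<And>x. (f has_derivative f' x) (at x)"
     "\<And>b. smooth_generated (\<lambda>x. r - (norm (x - a))\<^sup>2) (\<lambda>x. f' x b)"
    using smooth_generated_has_derivative by blast
  then have "partial b f = (\<lambda>x. f' x b)" for b
    unfolding partial_def using frechet_derivative_at by metis
  then show ?case using f' Suc.IH by (auto simp: differentiable_def)
qed

text \<open>Built from the squared norm, which is a polynomial and hence smooth at the centre
  \<open>a\<close> as well.\<close>

definition bump :: "'a::euclidean_space \<Rightarrow> real \<Rightarrow> 'a \<Rightarrow> real" where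
  "bump a d x = flat 0 (d\<^sup>2 - (norm (x - a))\<^sup>2)"

lemma bump_nonneg: "bump a d x \<ge> 0"
  by (simp add: bump_def flat_nonneg)

lemma bump_pos: "dist x a < d \<Longrightarrow> bump a d x > 0"
  by (simp add: bump_def flat_def dist_norm abs_square_less_1 power_strict_mono)

lemma bump_eq_0: "d \<ge> 0 \<Longrightarrow> dist x a \<ge> d \<Longrightarrow> bump a d x = 0"
  by (simp add: bump_def flat_def dist_norm power_mono not_less)

lemma test_function_bump:
  assumes "d > 0"
  shows "test_function (\<lambda>x. complex_of_real (bump a d x))"
proof -
  have "Ck k (\<lambda>x. complex_of_real (bump a d x))" for k
    unfolding bump_def by (intro smooth_generated_Ck[of "d\<^sup>2" a] smooth_generated.flat)
  moreover have "{x. complex_of_real (bump a d x) \<noteq> 0} \<subseteq> cball a d"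
    using bump_eq_0[of d _ a] assms by (force simp: dist_commute)
  then have "compact (closure {x. complex_of_real (bump a d x) \<noteq> 0})"
    by (metis bounded_cball bounded_subset compact_closure)
  ultimately show ?thesis unfolding test_function_def by blast
qed

section \<open>Uniqueness of the resolvent kernel\<close>

text \<open>The crude estimate |a b| \<le> |a|^2 + |b|^2 serves in place of Cauchy-Schwarz: all that
  matters later is that the bound does not change when \<open>b\<close> is translated.\<close>

lemma L2_mult:
  assumes "a \<in> L2" "b \<in> L2"
  shows "integrable lborel (\<lambda>x. a x * b x)"
    and "(LINT x|lborel. norm (a x * b x)) \<le> (LINT x|lborel. (norm (a x))\<^sup>2) + (LINT x|lborel. (norm (b x))\<^sup>2)"
proof -
  have [measurable]: "a \<in> borel_measurable borel" "b \<in> borel_measurable borel"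
    and i: "integrable lborel (\<lambda>x. (norm (a x))\<^sup>2)" "integrable lborel (\<lambda>x. (norm (b x))\<^sup>2)"
    using assms by (auto simp: L2_def)
  have le: "norm (a x * b x) \<le> (norm (a x))\<^sup>2 + (norm (b x))\<^sup>2" for x
    using sum_squares_bound[of "norm (a x)" "norm (b x)"]
      mult_nonneg_nonneg[OF norm_ge_zero[of "a x"] norm_ge_zero[of "b x"]] unfolding norm_mult by linarith
  show *: "integrable lborel (\<lambda>x. a x * b x)"
    by (rule Bochner_Integration.integrable_bound[OF Bochner_Integration.integrable_add[OF i]]) (use le in auto)
  have "(LINT x|lborel. norm (a x * b x)) \<le> (LINT x|lborel. (norm (a x))\<^sup>2 + (norm (b x))\<^sup>2)"
    by (intro integral_mono integrable_norm[OF *] Bochner_Integration.integrable_add i le)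
  then show "(LINT x|lborel. norm (a x * b x)) \<le> (LINT x|lborel. (norm (a x))\<^sup>2) + (LINT x|lborel. (norm (b x))\<^sup>2)"
    by (simp add: i)
qed

lemma L2_translate: "b \<in> L2 \<Longrightarrow> (\<lambda>x. b (x + y)) \<in> L2"
  using lborel_integrable_translate[of "\<lambda>x. (norm (b x))\<^sup>2" y] by (auto simp: L2_def)

text \<open>Fubini for E(y) a(x) b(x + s y). The integral of |a(x) b(x + s y)| over \<open>x\<close>
  is bounded by \<open>N\<close> for every \<open>y\<close>, because translations preserve the
  \<open>L2\<close> norm, and integrability of \<open>E\<close> does the rest. The values
  \<open>s = 1\<close> and \<open>s = -1\<close> cover correlation and convolution.\<close>

lemma
  fixes E :: "'a::euclidean_space \<Rightarrow> complex"
  assumes E: "integrable lborel E" and a: "a \<in> L2" and b: "b \<in> L2"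
  shows correlation_swap: "(LINT y|lborel. E y * (LINT x|lborel. a x * b (x + s *\<^sub>R y))) =
      (LINT x|lborel. a x * (LINT y|lborel. E y * b (x + s *\<^sub>R y)))"
    and integrable_mult_correlation: "integrable lborel (\<lambda>x. a x * (LINT y|lborel. E y * b (x + s *\<^sub>R y)))"
proof -
  have [measurable]: "E \<in> borel_measurable borel" "a \<in> borel_measurable borel" "b \<in> borel_measurable borel"
    using E a b by (auto simp: L2_def)
  define k where "k y x = E y * (a x * b (x + s *\<^sub>R y))" for y x
  define N where "N = (LINT x|lborel. (norm (a x))\<^sup>2) + (LINT x|lborel. (norm (b x))\<^sup>2)"
  have inner: "integrable lborel (\<lambda>x. a x * b (x + s *\<^sub>R y))"
    "(LINT x|lborel. norm (a x * b (x + s *\<^sub>R y))) \<le> N" for y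
  proof -
    show "integrable lborel (\<lambda>x. a x * b (x + s *\<^sub>R y))"
      by (rule L2_mult(1)[OF a L2_translate[OF b]])
    show "(LINT x|lborel. norm (a x * b (x + s *\<^sub>R y))) \<le> N"
      using L2_mult(2)[OF a L2_translate[OF b, of "s *\<^sub>R y"]]
        lborel_integral_translate[of "\<lambda>x. (norm (b x))\<^sup>2" "s *\<^sub>R y"] by (simp add: N_def)
  qed
  have [measurable]: "case_prod k \<in> borel_measurable (lborel \<Otimes>\<^sub>M lborel)"
    unfolding k_def by measurable
  have k: "integrable (lborel \<Otimes>\<^sub>M lborel) (case_prod k)"
  proof (rule lborel_pair.Fubini_integrable)
    show "integrable lborel (\<lambda>y. LINT x|lborel. norm (case_prod k (y, x)))"
    proof (rule Bochner_Integration.integrable_bound)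
      show "integrable lborel (\<lambda>y. norm (E y) * N)" using E by auto
      show "AE y in lborel. norm (LINT x|lborel. norm (case_prod k (y, x))) \<le> norm (norm (E y) * N)"
      proof (rule AE_I2)
        fix y
        have "(LINT x|lborel. norm (case_prod k (y, x))) = norm (E y) * (LINT x|lborel. norm (a x * b (x + s *\<^sub>R y)))"
          by (simp add: k_def norm_mult)
        moreover have "0 \<le> (LINT x|lborel. norm (a x * b (x + s *\<^sub>R y)))" by simp
        ultimately show "norm (LINT x|lborel. norm (case_prod k (y, x))) \<le> norm (norm (E y) * N)"
          using inner(2)[of y] by (simp add: mult_left_mono abs_mult)
      qed
    qed measurable
    show "AE y in lborel. integrable lborel (\<lambda>x. case_prod k (y, x))"
      using inner(1) by (auto simp: k_def)
  qed measurable
  have swap: "(LINT y|lborel. k y x) = a x * (LINT y|lborel. E y * b (x + s *\<^sub>R y))" for x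
    unfolding integral_mult_right_zero[symmetric] k_def by (simp add: mult_ac)
  have "(LINT y|lborel. E y * (LINT x|lborel. a x * b (x + s *\<^sub>R y))) = (LINT y|lborel. LINT x|lborel. k y x)"
    by (simp add: k_def)
  also have "\<dots> = (LINT x|lborel. LINT y|lborel. k y x)"
    using lborel_pair.Fubini_integral[OF k] by simp
  finally show "(LINT y|lborel. E y * (LINT x|lborel. a x * b (x + s *\<^sub>R y))) =
      (LINT x|lborel. a x * (LINT y|lborel. E y * b (x + s *\<^sub>R y)))" by (simp add: swap)
  have "integrable lborel (\<lambda>x. LINT y|lborel. k y x)"
    using lborel_pair.integrable_snd[OF k] .
  then show "integrable lborel (\<lambda>x. a x * (LINT y|lborel. E y * b (x + s *\<^sub>R y)))"
    by (simp add: swap)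
qed

lemma resolvent_weak_eq_convolution:
  fixes E :: "'a::euclidean_space \<Rightarrow> complex"
  assumes E: "integrable lborel E"
    and fund: "\<And>\<phi>. test_function \<phi> \<Longrightarrow> (LINT y|lborel. E y * (- \<mu>\<^sup>2 * \<phi> y - laplacian \<phi> y)) = \<phi> 0"
    and f: "f \<in> L2" and res: "is_resolvent \<mu> f u" and \<psi>: "test_function \<psi>"
  shows "(LINT x|lborel. \<psi> x * u x) = (LINT x|lborel. \<psi> x * (LINT y|lborel. E y * f (x - y)))"
proof -
  define L where "L x = - \<mu>\<^sup>2 * \<psi> x - laplacian \<psi> x" for x
  have L: "L \<in> L2" unfolding L_def
    by (intro Cc_L2 Cc_diff Cc_mult test_function_Cc test_function_laplacian_Cc \<psi> continuous_intros)
  have \<psi>2: "\<psi> \<in> L2" by (intro Cc_L2 test_function_Cc \<psi>)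
  from res obtain g where u: "u \<in> L2" and g: "g \<in> L2"
    and weak: "\<And>\<phi>. test_function \<phi> \<Longrightarrow> (LINT x|lborel. u x * (- laplacian \<phi> x)) = (LINT x|lborel. g x * \<phi> x)"
    and ae: "AE x in lborel. g x - \<mu>\<^sup>2 * u x = f x"
    unfolding is_resolvent_def neg_laplace_graph_def by blast
  \<comment> \<open>Testing with the translate of \<psi> by \<open>y\<close> and translating the
    variable back moves the shift to \<open>f\<close> with the opposite sign. This is why a
    convolution, and not a correlation, with \<open>E\<close> comes out at the end.\<close>
  have shifted: "(LINT x|lborel. u x * L (x + y)) = (LINT x|lborel. \<psi> x * f (x - y))" for y
  proof -
    let ?\<psi> = "\<lambda>x. \<psi> (x + y)"
    have t: "test_function ?\<psi>" by (rule test_function_translate[OF \<psi>])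
    note T2 = Cc_L2[OF test_function_Cc[OF t]]
    have iu: "integrable lborel (\<lambda>x. u x * ?\<psi> x)" and ig: "integrable lborel (\<lambda>x. g x * ?\<psi> x)"
      by (rule L2_mult(1)[OF _ T2]; fact)+
    have iL: "integrable lborel (\<lambda>x. u x * (- laplacian ?\<psi> x))"
      by (intro L2_mult(1)[OF u] Cc_L2 Cc_uminus test_function_laplacian_Cc t)
    have "(LINT x|lborel. u x * L (x + y)) = (LINT x|lborel. u x * (- laplacian ?\<psi> x) - \<mu>\<^sup>2 * (u x * ?\<psi> x))"
      by (intro Bochner_Integration.integral_cong) (simp_all add: L_def laplacian_translate[OF \<psi>] algebra_simps)
    also have "\<dots> = (LINT x|lborel. u x * (- laplacian ?\<psi> x)) - (LINT x|lborel. \<mu>\<^sup>2 * (u x * ?\<psi> x))"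
      by (intro Bochner_Integration.integral_diff iL integrable_mult_right iu)
    also have "(LINT x|lborel. u x * (- laplacian ?\<psi> x)) = (LINT x|lborel. g x * ?\<psi> x)"
      by (rule weak[OF t])
    also have "(LINT x|lborel. g x * ?\<psi> x) - (LINT x|lborel. \<mu>\<^sup>2 * (u x * ?\<psi> x)) =
        (LINT x|lborel. g x * ?\<psi> x - \<mu>\<^sup>2 * (u x * ?\<psi> x))"
      by (intro Bochner_Integration.integral_diff[symmetric] integrable_mult_right ig iu)
    also have "\<dots> = (LINT x|lborel. \<psi> (x + y) * f ((x + y) - y))"
    proof (rule integral_cong_AE)
      show "AE x in lborel. g x * ?\<psi> x - \<mu>\<^sup>2 * (u x * ?\<psi> x) = \<psi> (x + y) * f ((x + y) - y)"
        using ae by eventually_elim (simp add: algebra_simps flip: distrib_right)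
      have [measurable]: "f \<in> borel_measurable borel" "\<psi> \<in> borel_measurable borel"
         "u \<in> borel_measurable borel" "g \<in> borel_measurable borel"
        using f \<psi>2 u g by (auto simp: L2_def)
      show "(\<lambda>x. g x * ?\<psi> x - \<mu>\<^sup>2 * (u x * ?\<psi> x)) \<in> borel_measurable lborel"
        "(\<lambda>x. \<psi> (x + y) * f ((x + y) - y)) \<in> borel_measurable lborel" by simp_all
    qed
    also have "\<dots> = (LINT x|lborel. \<psi> x * f (x - y))"
      by (rule lborel_integral_translate)
    finally show ?thesis .
  qed
  \<comment> \<open>The defining property of the fundamental solution, applied to the test function
    \<psi> translated by \<open>x\<close> and read off at 0.\<close>
  have "\<psi> x = (LINT y|lborel. E y * L (x + y))" for x
  proof -
    have "(LINT y|lborel. E y * L (x + y)) = (LINT y|lborel. E y * (- \<mu>\<^sup>2 * \<psi> (y + x) - laplacian (\<lambda>y. \<psi> (y + x)) y))"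
      by (simp add: L_def laplacian_translate[OF \<psi>] add.commute)
    also have "\<dots> = \<psi> (0 + x)" by (rule fund[OF test_function_translate[OF \<psi>]])
    finally show ?thesis by simp
  qed
  then have "(LINT x|lborel. \<psi> x * u x) = (LINT x|lborel. u x * (LINT y|lborel. E y * L (x + 1 *\<^sub>R y)))"
    by (simp add: mult.commute)
  also have "\<dots> = (LINT y|lborel. E y * (LINT x|lborel. u x * L (x + 1 *\<^sub>R y)))"
    by (rule correlation_swap[OF E u L, symmetric])
  also have "\<dots> = (LINT y|lborel. E y * (LINT x|lborel. \<psi> x * f (x + (-1) *\<^sub>R y)))"
    by (simp add: shifted)
  also have "\<dots> = (LINT x|lborel. \<psi> x * (LINT y|lborel. E y * f (x + (-1) *\<^sub>R y)))"
    by (rule correlation_swap[OF E \<psi>2 f])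
  finally show ?thesis by simp
qed

lemma borel_measurable_continuous_off_0:
  fixes K :: "'a::euclidean_space \<Rightarrow> complex"
  assumes "continuous_on (- {0}) K"
  shows "K \<in> borel_measurable borel"
  by (rule borel_measurable_continuous_countable_exceptions[of "{0}"]) (use assms in auto)

lemma resolvent_kernel_unique:
  fixes E K :: "'a::euclidean_space \<Rightarrow> complex"
  assumes E: "integrable lborel E" "continuous_on (- {0}) E"
    and fund: "\<And>\<phi>. test_function \<phi> \<Longrightarrow> (LINT y|lborel. E y * (- \<mu>\<^sup>2 * \<phi> y - laplacian \<phi> y)) = \<phi> 0"
    and K: "continuous_on (- {0}) K" "is_convolution_kernel (is_resolvent \<mu>) K"
    and z: "z \<noteq> 0"
  shows "K z = E z"
proof (rule ccontr)
  assume "K z \<noteq> E z"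
  define D where "D x = K x - E x" for x
  have "D z \<noteq> 0" using \<open>K z \<noteq> E z\<close> by (simp add: D_def)
  have contD: "continuous_on (- {0}) D" unfolding D_def by (intro continuous_intros E K)
  then have "isCont D z" using z by (simp add: continuous_on_eq_continuous_at open_Compl)
  then obtain \<eta> where \<eta>: "\<eta> > 0" "\<And>x. dist x z < \<eta> \<Longrightarrow> dist (D x) (D z) < norm (D z) / 2"
    unfolding continuous_at_eps_delta using \<open>D z \<noteq> 0\<close> by (metis half_gt_zero zero_less_norm_iff)
  \<comment> \<open>A ball of radius \<open>d\<close> about any point within \<open>d\<close> of
    \<open>z\<close> lies in the ball of radius \<open>2 * d\<close> about \<open>z\<close>. That
    ball must avoid the singularity 0 and lie where \<open>D\<close> differs from \<open>D z\<close>
    by less than half of |D z|.\<close>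
  define d where "d = min \<eta> (norm z) / 4"
  have d: "d > 0" "2 * d < \<eta>" "2 * d < norm z" using \<eta>(1) z by (auto simp: d_def min_def)
  define f where "f = (\<lambda>x::'a. indicator (ball 0 d) x :: complex)"
  define u where "u x = (LINT y|lborel. K (x - y) * f y)" for x
  define v where "v x = (LINT y|lborel. E y * f (x - y))" for x
  define \<psi> where "\<psi> x = bump z d x" for x
  define vol where "vol = measure lborel (ball (0::'a) d)"
  have f_meas[measurable]: "f \<in> borel_measurable borel"
    unfolding f_def by (intro borel_measurable_indicator) auto
  have K_meas[measurable]: "K \<in> borel_measurable borel" and E_meas[measurable]: "E \<in> borel_measurable borel"
    by (intro borel_measurable_continuous_off_0 K E)+
  have fin: "emeasure lborel (ball (x::'a) d) < \<infinity>" for x by (rule emeasure_bounded_finite) auto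
  have f2: "f \<in> L2"
  proof -
    have "(norm (f x))\<^sup>2 = indicator (ball 0 d) x" for x by (simp add: f_def indicator_def)
    then show ?thesis using fin by (simp add: L2_def)
  qed
  have res: "is_resolvent \<mu> f u"
    using K(2) f2 unfolding is_convolution_kernel_def u_def by blast
  then have u2: "u \<in> L2" unfolding is_resolvent_def neg_laplace_graph_def by blast
  have test: "test_function (\<lambda>x. complex_of_real (\<psi> x))" unfolding \<psi>_def by (rule test_function_bump[OF d(1)])
  have \<psi>2: "(\<lambda>x. complex_of_real (\<psi> x)) \<in> L2" by (rule Cc_L2[OF test_function_Cc[OF test]])
  have eq: "(LINT x|lborel. complex_of_real (\<psi> x) * u x) = (LINT x|lborel. complex_of_real (\<psi> x) * v x)"
    unfolding v_def by (rule resolvent_weak_eq_convolution[OF E(1) fund f2 res test])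
  have int_u: "integrable lborel (\<lambda>x. complex_of_real (\<psi> x) * u x)"
    by (rule L2_mult(1)[OF \<psi>2 u2])
  have int_v: "integrable lborel (\<lambda>x. complex_of_real (\<psi> x) * v x)"
    unfolding v_def using integrable_mult_correlation[OF E(1) \<psi>2 f2, of "-1"] by simp
  have int_\<psi>: "integrable lborel \<psi>"
    using integrable_Re[OF Cc_integrable[OF test_function_Cc[OF test]]] by simp

  \<comment> \<open>For the indicator \<open>f\<close> of a small ball, u x - v x is the integral of
    \<open>D\<close> over the ball of radius \<open>d\<close> about \<open>x\<close>. Hence it
    differs from \<open>D z * vol\<close> by at most half of its size.\<close>
  have near: "norm (u x - v x - D z * vol) \<le> norm (D z) / 2 * vol" if x: "dist x z < d" for x
  proof -
    have f_ball: "f (x - y) = indicator (ball x d) y" for y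
      by (simp add: f_def indicator_def dist_norm norm_minus_commute)
    have close: "dist y z < 2 * d" if "y \<in> ball x d" for y
      using that x dist_triangle[of y z x] by (simp add: dist_commute)
    have "ball x d \<subseteq> cball z (2 * d)" using close by (force simp: dist_commute)
    moreover have "0 \<notin> cball z (2 * d)" using d(3) by (simp add: dist_norm)
    ultimately have set_int: "integrable lborel (\<lambda>y. F y * f (x - y))"
      if "continuous_on (- {0}) F" for F :: "'a \<Rightarrow> complex"
    proof -
      have "continuous_on (cball z (2 * d)) F"
        by (rule continuous_on_subset[OF that]) (use \<open>0 \<notin> cball z (2 * d)\<close> in auto)
      then have "integrable lborel (\<lambda>y. indicator (cball z (2 * d)) y *\<^sub>R F y)"
        by (intro borel_integrable_compact) auto
      then show ?thesis
      proof (rule Bochner_Integration.integrable_bound)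
        have "F \<in> borel_measurable borel" by (rule borel_measurable_continuous_off_0[OF that])
        then show "(\<lambda>y. F y * f (x - y)) \<in> borel_measurable lborel" by simp
        show "AE y in lborel. norm (F y * f (x - y)) \<le> norm (indicator (cball z (2 * d)) y *\<^sub>R F y)"
          using \<open>ball x d \<subseteq> cball z (2 * d)\<close> unfolding f_ball by (intro AE_I2) (auto simp: indicator_def)
      qed
    qed
    \<comment> \<open>A reflection (scaling by -1) followed by a translation by - x moves the
      difference x - y from \<open>K\<close> to \<open>f\<close>.\<close>
    have "u x = (LINT y|lborel. K (x - (-1) *\<^sub>R y) * f ((-1) *\<^sub>R y))"
      unfolding u_def by (subst lborel_integral_scaleR[where c="-1"]) simp_all
    also have "\<dots> = (LINT y|lborel. K (x - (-1) *\<^sub>R (y + - x)) * f ((-1) *\<^sub>R (y + - x)))"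
      by (rule lborel_integral_translate[symmetric])
    finally have "u x = (LINT y|lborel. K y * f (x - y))" by simp
    then have uv: "u x - v x = (LINT y|lborel. D y * f (x - y))"
      unfolding v_def D_def using set_int[OF K(1)] set_int[OF E(2)]
      by (simp add: left_diff_distrib)
    have f_real: "f (x - y) = complex_of_real (indicator (ball x d) y)" for y
      by (simp add: f_ball indicator_def)
    then have ind: "(LINT y|lborel. f (x - y)) = vol"
    proof -
      from f_real have "(LINT y|lborel. f (x - y)) = of_real (measure lborel (ball x d))"
        using fin[of x] by simp
      then show ?thesis using d(1) by (simp add: vol_def content_ball)
    qed
    have fi: "integrable lborel (\<lambda>y. f (x - y))"
      unfolding f_real using fin[of x] by (intro integrable_of_real integrable_real_indicator) auto
    have "u x - v x - D z * vol = (LINT y|lborel. (D y - D z) * f (x - y))"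
      using set_int[OF contD] fi unfolding uv ind[symmetric]
      by (simp add: left_diff_distrib)
    also have "norm \<dots> \<le> (LINT y|lborel. norm (D z) / 2 * norm (f (x - y)))"
    proof (rule Bochner_Integration.integral_norm_bound_integral)
      show "integrable lborel (\<lambda>y. (D y - D z) * f (x - y))"
        using set_int[OF contD] fi by (simp add: left_diff_distrib)
      show "integrable lborel (\<lambda>y. norm (D z) / 2 * norm (f (x - y)))" using fi by auto
      fix y
      show "norm ((D y - D z) * f (x - y)) \<le> norm (D z) / 2 * norm (f (x - y))"
        using \<eta>(2)[of y] close[of y] d(2)
        by (auto simp: f_ball norm_mult indicator_def dist_norm less_imp_le)
    qed
    also have "\<dots> = norm (D z) / 2 * vol"
    proof -
      have "norm (f (x - y)) = Re (f (x - y))" for y by (simp add: f_ball indicator_def)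
      then have "(LINT y|lborel. norm (f (x - y))) = vol"
        using integral_Re[OF fi] ind by simp
      then show ?thesis by simp
    qed
    finally show ?thesis .
  qed

  have vol_pos: "vol > 0" unfolding vol_def using d(1) by (simp add: content_ball)
  have \<psi>_pos: "(LINT x|lborel. \<psi> x) > 0"
  proof -
    have "(LINT x|lborel. \<psi> x) \<noteq> 0"
    proof
      assume "(LINT x|lborel. \<psi> x) = 0"
      then have "AE x in lborel. \<psi> x = 0"
        using integral_nonneg_eq_0_iff_AE[OF int_\<psi>] bump_nonneg[of z d] unfolding \<psi>_def by simp
      then have "AE x in lborel. x \<notin> ball z d"
        by eventually_elim (use bump_pos[of _ z d] in \<open>force simp: \<psi>_def dist_commute\<close>)
      then have "emeasure lborel (ball z d) = 0"
        by (subst (asm) AE_iff_measurable[OF _ refl]) (auto simp: ball_def)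
      then show False using d(1) unit_ball_vol_pos[of "real DIM('a)"] by (simp add: emeasure_ball)
    qed
    moreover have "(LINT x|lborel. \<psi> x) \<ge> 0" by (simp add: \<psi>_def bump_nonneg)
    ultimately show ?thesis by simp
  qed
  \<comment> \<open>The integral of \<open>w\<close> has modulus |D z| vol times the integral of
    \<psi>, since by \<open>eq\<close> the first two terms cancel under the integral. By
    \<open>near\<close> it is also at most half of that, which is absurd.\<close>
  define w where "w x = complex_of_real (\<psi> x) * u x - complex_of_real (\<psi> x) * v x - complex_of_real (\<psi> x) * (D z * vol)" for x
  have int_w: "integrable lborel w"
    unfolding w_def using int_u int_v int_\<psi> by (intro Bochner_Integration.integrable_diff integrable_mult_left) auto
  have "(LINT x|lborel. w x) = - (of_real (LINT x|lborel. \<psi> x) * (D z * vol))"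
    unfolding w_def using int_u int_v int_\<psi> eq by simp
  then have "norm (D z) * vol * (LINT x|lborel. \<psi> x) = norm (LINT x|lborel. w x)"
    using vol_pos \<psi>_pos by (simp add: norm_mult)
  also have "\<dots> \<le> (LINT x|lborel. \<psi> x * (norm (D z) / 2 * vol))"
  proof (rule Bochner_Integration.integral_norm_bound_integral[OF int_w])
    show "integrable lborel (\<lambda>x. \<psi> x * (norm (D z) / 2 * vol))" using int_\<psi> by (rule integrable_mult_left)
    fix x
    show "norm (w x) \<le> \<psi> x * (norm (D z) / 2 * vol)"
    proof (cases "dist x z < d")
      case True
      have "w x = complex_of_real (\<psi> x) * (u x - v x - D z * vol)" by (simp add: w_def algebra_simps)
      then have "norm (w x) = \<psi> x * norm (u x - v x - D z * vol)"
        using bump_nonneg[of z d x] by (simp add: norm_mult \<psi>_def)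
      then show ?thesis using mult_left_mono[OF near[OF True] bump_nonneg[of z d x]] by (simp add: \<psi>_def)
    next
      case False
      then have "\<psi> x = 0" unfolding \<psi>_def using d(1) by (intro bump_eq_0) auto
      then show ?thesis by (simp add: w_def)
    qed
  qed
  also have "\<dots> = norm (D z) * vol * (LINT x|lborel. \<psi> x) / 2" by simp
  finally show False using \<open>D z \<noteq> 0\<close> vol_pos \<psi>_pos by (simp add: mult_le_0_iff)
qed

section \<open>Integrals over the half-line depending on a parameter\<close>

text \<open>The measure is restricted instead of the integrand being cut off by an indicator.
  Results for a general measure then apply directly, with pointwise hypotheses for positive
  arguments only.\<close>

abbreviation half_line :: "real measure" where
  "half_line \<equiv> restrict_space lborel {0<..}"

lemma integrable_half_line:
  fixes f :: "real \<Rightarrow> 'b::{banach,second_countable_topology}"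
  shows "integrable half_line f \<longleftrightarrow> set_integrable lborel {0<..} f"
  unfolding set_integrable_def by (subst integrable_restrict_space) auto

lemma integral_half_line:
  fixes f :: "real \<Rightarrow> 'b::{banach,second_countable_topology}"
  shows "(LINT t|half_line. f t) = (LINT t:{0<..}|lborel. f t)"
  unfolding set_lebesgue_integral_def by (subst integral_restrict_space) auto

lemma integral_half_line_FTC:
  fixes f F :: "real \<Rightarrow> 'b::euclidean_space"
  assumes der: "\<And>t. t > 0 \<Longrightarrow> (F has_vector_derivative f t) (at t)"
    and cont: "continuous_on {0<..} f"
    and int: "integrable half_line f"
    and "(F \<longlongrightarrow> A) (at_right 0)" "(F \<longlongrightarrow> B) at_top"
  shows "(LINT t|half_line. f t) = B - A"
proof -
  have "(LBINT t=0..\<infinity>. f t) = B - A"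
  proof (rule interval_integral_FTC_integrable)
    show "isCont f t" if "0 < ereal t" for t
      using cont that by (simp add: continuous_on_eq_continuous_at)
    show "set_integrable lborel (einterval 0 \<infinity>) f"
      using int by (simp add: integrable_half_line zero_ereal_def)
  qed (use assms in \<open>auto simp: zero_ereal_def ereal_tendsto_simps\<close>)
  then show ?thesis by (simp add: integral_half_line interval_lebesgue_integral_0_infty)
qed

text \<open>Euler's integral after the substitution t -> \<delta> t. Working with nonnegative
  integrals yields integrability and value at once.\<close>

lemma
  fixes q \<delta> :: real
  assumes q: "q > 0" and \<delta>: "\<delta> > 0"
  shows integrable_powr_exp: "integrable half_line (\<lambda>t. t powr (q - 1) * exp (- \<delta> * t))"
    and integral_powr_exp: "(LINT t|half_line. t powr (q - 1) * exp (- \<delta> * t)) = Gamma q * \<delta> powr - q"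
proof -
  have "ennreal (Gamma q) = (\<integral>\<^sup>+t. ennreal (indicator {0..} t * t powr (q - 1) / exp t) \<partial>lborel)"
    by (rule Gamma_conv_nn_integral_real[OF q])
  also have "\<dots> = ennreal \<bar>\<delta>\<bar> * (\<integral>\<^sup>+t. ennreal (indicator {0..} (0 + \<delta> * t) * (0 + \<delta> * t) powr (q - 1) / exp (0 + \<delta> * t)) \<partial>lborel)"
    using \<delta> by (intro nn_integral_real_affine) auto
  also have "(\<integral>\<^sup>+t. ennreal (indicator {0..} (0 + \<delta> * t) * (0 + \<delta> * t) powr (q - 1) / exp (0 + \<delta> * t)) \<partial>lborel)
    = (\<integral>\<^sup>+t. ennreal (\<delta> powr (q - 1)) * (ennreal (t powr (q - 1) * exp (- \<delta> * t)) * indicator {0<..} t) \<partial>lborel)"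
  proof (rule nn_integral_cong_AE)
    have "AE t in lborel. t \<noteq> (0::real)" by (rule AE_lborel_singleton)
    then show "AE t in lborel. ennreal (indicator {0..} (0 + \<delta> * t) * (0 + \<delta> * t) powr (q - 1) / exp (0 + \<delta> * t))
      = ennreal (\<delta> powr (q - 1)) * (ennreal (t powr (q - 1) * exp (- \<delta> * t)) * indicator {0<..} t)"
    proof eventually_elim
      case (elim t)
      show ?case
      proof (cases "t > 0")
        case True
        then show ?thesis using \<delta>
          by (simp add: powr_mult exp_minus field_simps flip: ennreal_mult)
      next
        case False
        then show ?thesis using elim \<delta> by (simp add: zero_le_mult_iff)
      qed
    qed
  qed
  also have "ennreal \<bar>\<delta>\<bar> * \<dots> = ennreal (\<delta> powr q) * (\<integral>\<^sup>+t. ennreal (t powr (q - 1) * exp (- \<delta> * t)) * indicator {0<..} t \<partial>lborel)"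
  proof -
    have "\<delta> * \<delta> powr (q - 1) = \<delta> powr q" using \<delta> by (simp add: powr_diff)
    then show ?thesis using \<delta>
      by (subst nn_integral_cmult) (auto simp: mult.assoc[symmetric] simp flip: ennreal_mult)
  qed
  finally have g: "ennreal (Gamma q) = ennreal (\<delta> powr q) * (\<integral>\<^sup>+t. ennreal (t powr (q - 1) * exp (- \<delta> * t)) * indicator {0<..} t \<partial>lborel)"
    (is "_ = _ * ?I") .
  have "ennreal (\<delta> powr - q) * ennreal (Gamma q) = (ennreal (\<delta> powr - q) * ennreal (\<delta> powr q)) * ?I"
    unfolding g by (simp add: mult.assoc)
  also have "ennreal (\<delta> powr - q) * ennreal (\<delta> powr q) = 1"
    using \<delta> by (simp flip: ennreal_mult powr_add)
  finally have nn: "(\<integral>\<^sup>+t. ennreal (t powr (q - 1) * exp (- \<delta> * t)) \<partial>half_line) = ennreal (Gamma q * \<delta> powr - q)"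
    using Gamma_real_pos[OF q] by (simp add: nn_integral_restrict_space mult.commute flip: ennreal_mult)
  have meas: "(\<lambda>t. t powr (q - 1) * exp (- \<delta> * t)) \<in> borel_measurable half_line"
    by (intro measurable_restrict_space1) simp
  show "integrable half_line (\<lambda>t. t powr (q - 1) * exp (- \<delta> * t))"
    by (rule integrableI_nonneg) (use nn meas in auto)
  show "(LINT t|half_line. t powr (q - 1) * exp (- \<delta> * t)) = Gamma q * \<delta> powr - q"
    using Gamma_real_pos[OF q] \<delta>
    by (subst integral_eq_nn_integral) (use nn meas in auto)
qed

text \<open>Differentiation under the integral in a complex parameter. On the convex ball the mean
  value inequality bounds all difference quotients by \<open>D\<close>, and dominated convergence
  applies along every null sequence. Measurability of the derivative in \<open>t\<close> is a
  result: it is a pointwise limit of measurable quotients.\<close>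

lemma
  fixes f f' :: "complex \<Rightarrow> 'b \<Rightarrow> complex"
  assumes d: "d > 0"
    and der: "\<And>z t. z \<in> ball z0 d \<Longrightarrow> t \<in> space M \<Longrightarrow> ((\<lambda>z. f z t) has_field_derivative f' z t) (at z)"
    and int: "\<And>z. z \<in> ball z0 d \<Longrightarrow> integrable M (f z)"
    and bound: "\<And>z t. z \<in> ball z0 d \<Longrightarrow> t \<in> space M \<Longrightarrow> norm (f' z t) \<le> D t"
    and D: "integrable M D"
  shows has_field_derivative_integral: "((\<lambda>z. LINT t|M. f z t) has_field_derivative (LINT t|M. f' z0 t)) (at z0)"
    and integrable_deriv_param: "integrable M (f' z0)"
proof -
  define q where "q h t = (f (z0 + h) t - f z0 t) / h" for h t
  have lim_q: "((\<lambda>h. q h t) \<longlongrightarrow> f' z0 t) (at 0)" if "t \<in> space M" for t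
    using der[of z0 t] that d unfolding q_def DERIV_def by simp
  have q_bound: "norm (q h t) \<le> D t" if "norm h < d" "t \<in> space M" for h t
  proof -
    have "norm (f (z0 + h) t - f z0 t) \<le> D t * norm ((z0 + h) - z0)"
      by (rule field_differentiable_bound[of "ball z0 d" "\<lambda>z. f z t" "\<lambda>z. f' z t"])
         (use that d der bound in \<open>auto intro: has_field_derivative_at_within simp: dist_norm\<close>)
    moreover have "D t \<ge> 0" using bound[of z0 t] that d norm_ge_zero order_trans by (metis centre_in_ball)
    ultimately show ?thesis by (cases "h = 0") (auto simp: q_def norm_divide divide_simps)
  qed
  have f_meas: "f z0 \<in> borel_measurable M" using int[of z0] d by auto
  have main: "f' z0 \<in> borel_measurable M \<and> (\<lambda>n. LINT t|M. q (s n) t) \<longlonglongrightarrow> (LINT t|M. f' z0 t)"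
    if s: "filterlim s (at 0) sequentially" and sd: "\<And>n. norm (s n) < d" for s
  proof
    have q_meas: "q (s n) \<in> borel_measurable M" for n
      unfolding q_def using int[of "z0 + s n"] sd[of n] f_meas by (auto simp: dist_norm)
    have lim: "(\<lambda>n. q (s n) t) \<longlonglongrightarrow> f' z0 t" if "t \<in> space M" for t
      by (rule filterlim_compose[OF lim_q[OF that] s])
    show meas: "f' z0 \<in> borel_measurable M"
      by (rule borel_measurable_LIMSEQ_metric[OF q_meas lim])
    show "(\<lambda>n. LINT t|M. q (s n) t) \<longlonglongrightarrow> (LINT t|M. f' z0 t)"
      by (rule integral_dominated_convergence[OF meas q_meas D]) (use lim q_bound sd in auto)
  qed
  \<comment> \<open>An explicit null sequence to obtain measurability. The offset 2 keeps even the
    first term strictly inside the ball of radius \<open>d\<close>.\<close>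
  define e where "e n = complex_of_real (d / real (n + 2))" for n
  have e_lim: "filterlim e (at 0) sequentially"
  proof -
    have "(\<lambda>n. d / real (n + 2)) \<longlonglongrightarrow> 0"
      by (rule LIMSEQ_ignore_initial_segment[OF lim_const_over_n])
    from tendsto_of_real[OF this] have "e \<longlonglongrightarrow> 0" unfolding e_def by (simp only: of_real_0)
    moreover have "e n \<noteq> 0" for n unfolding e_def of_real_eq_0_iff using d by simp
    ultimately show ?thesis by (auto simp: filterlim_at)
  qed
  have "norm (e n) < d" for n
  proof -
    have "norm (e n) = d / real (n + 2)" unfolding e_def norm_of_real using d by simp
    also have "\<dots> < d / 1" using d by (intro divide_strict_left_mono) auto
    finally show ?thesis by simp
  qed
  from main[OF e_lim this] have meas: "f' z0 \<in> borel_measurable M" by blast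
  show "integrable M (f' z0)"
    by (rule Bochner_Integration.integrable_bound[OF D meas])
       (use bound[of z0] d in \<open>auto intro!: AE_I2 order_trans[OF _ abs_ge_self]\<close>)
  have "((\<lambda>h. LINT t|M. q h t) \<longlongrightarrow> (LINT t|M. f' z0 t)) (at 0 within ball 0 d)"
    unfolding tendsto_at_iff_sequentially o_def
  proof (intro allI impI)
    fix s assume "\<forall>i. s i \<in> ball 0 d - {0::complex}" "s \<longlonglongrightarrow> 0"
    then show "(\<lambda>n. LINT t|M. q (s n) t) \<longlonglongrightarrow> (LINT t|M. f' z0 t)"
      using main[of s] by (auto simp: filterlim_at)
  qed
  then have lim: "((\<lambda>h. LINT t|M. q h t) \<longlongrightarrow> (LINT t|M. f' z0 t)) (at 0)"
    using d by (simp add: at_within_open[of 0 "ball 0 d"])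
  show "((\<lambda>z. LINT t|M. f z t) has_field_derivative (LINT t|M. f' z0 t)) (at z0)"
    unfolding DERIV_def
  proof (rule Lim_transform_within_open[OF lim, where s="ball 0 d"])
    fix h :: complex assume h: "h \<in> ball 0 d" "h \<noteq> 0"
    have "integrable M (f (z0 + h))" "integrable M (f z0)"
      using h d by (auto intro!: int simp: dist_norm)
    then show "(LINT t|M. q h t) = ((LINT t|M. f (z0 + h) t) - (LINT t|M. f z0 t)) / h"
      unfolding q_def by simp
  qed (use d in auto)
qed

section \<open>The Whittaker integral\<close>

lemma borel_measurable_half_line_continuous:
  fixes f :: "real \<Rightarrow> 'b::topological_space"
  assumes "continuous_on {0<..} f"
  shows "f \<in> borel_measurable half_line"
proof -
  have "f \<in> borel_measurable (restrict_space borel {0<..})"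
    by (rule borel_measurable_continuous_on_restrict[OF assms])
  also have "borel_measurable (restrict_space borel {0<..}) = borel_measurable half_line"
    by (intro measurable_cong_sets sets_restrict_space_cong) auto
  finally show ?thesis .
qed

lemma integrable_half_line_bound:
  fixes f :: "real \<Rightarrow> complex"
  assumes "continuous_on {0<..} f" "integrable half_line D" "\<And>t. t > 0 \<Longrightarrow> norm (f t) \<le> D t"
  shows "integrable half_line f"
  by (rule Bochner_Integration.integrable_bound[OF assms(2) borel_measurable_half_line_continuous[OF assms(1)]])
     (use assms(3) in \<open>auto intro!: AE_I2 order_trans[OF _ abs_ge_self] simp: space_restrict_space\<close>)

text \<open>The exponents are left in the form q - 1 so as to match
  \<open>integrable_powr_exp\<close> and \<open>integral_powr_exp\<close>.\<close>

lemma sqrt_powr: "a > 0 \<Longrightarrow> sqrt a = a powr (3/2 - 1)" "a > 0 \<Longrightarrow> inverse (sqrt a) = a powr (1/2 - 1)"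
  by (auto simp: powr_half_sqrt powr_minus)

lemma norm_exp_div_sqrt:
  assumes "a > 0"
  shows "norm (exp (- w * of_real a) / of_real (sqrt a)) = a powr (1/2 - 1) * exp (- Re w * a)"
  using assms unfolding norm_divide norm_exp_eq_Re norm_of_real sqrt_powr(2)[OF assms, symmetric]
  by (simp add: divide_inverse)

text \<open>On the right half-plane this is sqrt pi times the principal value of w^(-1/2). In this
  form it is also what the a-integral of the superposition produces, the weight 1 / sqrt a being
  that of \<open>T_op\<close>.\<close>

definition laplace_inv_sqrt :: "complex \<Rightarrow> complex" where
  "laplace_inv_sqrt w = (LINT a|half_line. exp (- w * of_real a) / of_real (sqrt a))"

lemma integrable_laplace_inv_sqrt:
  assumes "Re w > 0"
  shows "integrable half_line (\<lambda>a. exp (- w * of_real a) / of_real (sqrt a))"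
proof (rule integrable_half_line_bound[OF _ integrable_powr_exp[of "1/2" "Re w"]])
  show "continuous_on {0<..} (\<lambda>a. exp (- w * of_real a) / of_real (sqrt a))"
    by (intro continuous_intros) auto
  show "norm (exp (- w * of_real a) / of_real (sqrt a)) \<le> a powr (1 / 2 - 1) * exp (- Re w * a)" if "a > 0" for a
    using norm_exp_div_sqrt[OF that] by simp
qed (use assms in auto)

lemma integral_exp_div_sqrt:
  assumes "\<delta> > 0"
  shows "(LINT a|half_line. a powr (1 / 2 - 1) * exp (- \<delta> * a)) = sqrt pi / sqrt \<delta>"
proof -
  have "(LINT a|half_line. a powr (1 / 2 - 1) * exp (- \<delta> * a)) = Gamma (1/2) * \<delta> powr - (1/2)"
    by (rule integral_powr_exp) (use assms in auto)
  also have "\<dots> = sqrt pi / sqrt \<delta>"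
    unfolding Gamma_one_half_real powr_minus powr_half_sqrt[OF less_imp_le[OF assms]]
    by (rule divide_inverse[symmetric])
  finally show ?thesis .
qed

lemma norm_laplace_inv_sqrt_le:
  assumes "Re w > 0"
  shows "norm (laplace_inv_sqrt w) \<le> sqrt pi / sqrt (Re w)"
proof -
  have "norm (laplace_inv_sqrt w) \<le> (LINT a|half_line. a powr (1 / 2 - 1) * exp (- Re w * a))"
    unfolding laplace_inv_sqrt_def
  proof (rule Bochner_Integration.integral_norm_bound_integral)
    fix a assume "a \<in> space half_line"
    then have a: "a > 0" by (simp add: space_restrict_space)
    show "norm (exp (- w * of_real a) / of_real (sqrt a)) \<le> a powr (1 / 2 - 1) * exp (- Re w * a)"
      using norm_exp_div_sqrt[OF a] by simp
  next
    show "integrable half_line (\<lambda>a. exp (- w * of_real a) / of_real (sqrt a))"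
      by (rule integrable_laplace_inv_sqrt[OF assms])
    show "integrable half_line (\<lambda>a. a powr (1 / 2 - 1) * exp (- Re w * a))"
      by (rule integrable_powr_exp) (use assms in auto)
  qed
  also have "\<dots> = sqrt pi / sqrt (Re w)"
    by (rule integral_exp_div_sqrt[OF assms])
  finally show ?thesis .
qed

lemma laplace_inv_sqrt_of_real:
  assumes "t > 0"
  shows "laplace_inv_sqrt (of_real t) = of_real (sqrt pi / sqrt t)"
proof -
  have "laplace_inv_sqrt (of_real t) = (LINT a|half_line. complex_of_real (a powr (1 / 2 - 1) * exp (- t * a)))"
    unfolding laplace_inv_sqrt_def
  proof (rule Bochner_Integration.integral_cong)
    fix a assume "a \<in> space half_line"
    then have a: "a > 0" by (simp add: space_restrict_space)
    show "exp (- complex_of_real t * of_real a) / of_real (sqrt a) = of_real (a powr (1 / 2 - 1) * exp (- t * a))"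
      unfolding sqrt_powr(2)[OF a, symmetric] by (simp add: divide_inverse mult.commute flip: exp_of_real)
  qed simp
  also have "\<dots> = of_real (LINT a|half_line. a powr (1 / 2 - 1) * exp (- t * a))"
    by (rule integral_complex_of_real)
  also have "(LINT a|half_line. a powr (1 / 2 - 1) * exp (- t * a)) = sqrt pi / sqrt t"
    by (rule integral_exp_div_sqrt[OF assms])
  finally show ?thesis .
qed

lemma tendsto_half_line_0:
  fixes F :: "real \<Rightarrow> complex"
  assumes "\<delta> > 0" "\<And>t. t \<ge> 1 \<Longrightarrow> norm (F t) \<le> C * (exp (- \<delta> * t) * t ^ n)"
  shows "(F \<longlongrightarrow> 0) at_top"
proof (rule Lim_null_comparison)
  show "\<forall>\<^sub>F t in at_top. norm (F t) \<le> C * (exp (- \<delta> * t) * t ^ n)"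
    using eventually_ge_at_top[of 1] by eventually_elim (rule assms(2))
  have "((\<lambda>t. C * (exp (- \<delta> * t) * t ^ n)) \<longlongrightarrow> C * 0) at_top"
    by (intro tendsto_intros tendsto_exp_mult_power_0 assms)
  then show "((\<lambda>t. C * (exp (- \<delta> * t) * t ^ n)) \<longlongrightarrow> 0) at_top" by simp
qed

text \<open>Differentiation under the integral gives - sqrt a e^(-wa) as the new integrand.
  Integrating the derivative of e^(-wa) sqrt a, which vanishes at both ends, gives w S' + S/2 =
  0.\<close>

lemma laplace_inv_sqrt_deriv:
  assumes w: "Re w > 0"
  shows "(laplace_inv_sqrt has_field_derivative - laplace_inv_sqrt w / (2 * w)) (at w)"
proof -
  define f' where "f' z a = - (of_real (sqrt a) * exp (- z * of_real a))" for z :: complex and a :: real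
  have Re_z: "Re z > Re w / 2" if "z \<in> ball w (Re w / 2)" for z
    using that abs_Re_le_cmod[of "w - z"] by (simp add: dist_norm)
  have D: "integrable half_line (\<lambda>a. a powr (3/2 - 1) * exp (- (Re w / 2) * a))"
    using w by (intro integrable_powr_exp) auto
  have bound: "norm (f' z a) \<le> a powr (3/2 - 1) * exp (- (Re w / 2) * a)"
    if "z \<in> ball w (Re w / 2)" "a > 0" for z a
  proof -
    have "exp (- Re z * a) \<le> exp (- (Re w / 2) * a)" using Re_z[OF that(1)] that(2) by simp
    then show ?thesis
      unfolding f'_def sqrt_powr(1)[OF that(2), symmetric] using that(2)
      by (simp add: norm_mult mult_left_mono)
  qed
  have der: "((\<lambda>z. exp (- z * of_real a) / of_real (sqrt a)) has_field_derivative f' z a) (at z)" if "a > 0" for z :: complex and a :: real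
  proof -
    have "((\<lambda>z. exp (- z * of_real a) / of_real (sqrt a)) has_field_derivative (- of_real a * exp (- z * of_real a)) / of_real (sqrt a)) (at z)"
      using that by (auto intro!: derivative_eq_intros)
    moreover have "complex_of_real a / of_real (sqrt a) = of_real (sqrt a)"
      using that by (simp add: real_div_sqrt flip: of_real_divide)
    ultimately show ?thesis unfolding f'_def
      by (metis (no_types, lifting) minus_mult_left times_divide_eq_left minus_divide_left)
  qed
  have int: "integrable half_line (\<lambda>a. exp (- z * of_real a) / of_real (sqrt a))" if "z \<in> ball w (Re w / 2)" for z
    using Re_z[OF that] w by (intro integrable_laplace_inv_sqrt) auto
  have d: "Re w / 2 > 0" using w by simp
  have deriv: "(laplace_inv_sqrt has_field_derivative (LINT a|half_line. f' w a)) (at w)"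
    unfolding laplace_inv_sqrt_def[abs_def]
    by (rule has_field_derivative_integral[OF d _ int _ D]) (use der bound in \<open>auto simp: space_restrict_space\<close>)
  have int': "integrable half_line (f' w)"
    by (rule integrable_deriv_param[OF d _ int _ D]) (use der bound in \<open>auto simp: space_restrict_space\<close>)
  have "(LINT a|half_line. w * f' w a + (exp (- w * of_real a) / of_real (sqrt a)) / 2) = 0 - 0"
  proof (rule integral_half_line_FTC[where F = "\<lambda>a. exp (- w * of_real a) * of_real (sqrt a)"])
    fix a :: real assume a: "a > 0"
    show "((\<lambda>a. exp (- w * of_real a) * of_real (sqrt a)) has_vector_derivative
         w * f' w a + (exp (- w * of_real a) / of_real (sqrt a)) / 2) (at a)"
    proof -
      have "((\<lambda>z. exp (- w * z)) has_field_derivative - w * exp (- w * of_real a)) (at (of_real a))"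
        by (auto intro!: derivative_eq_intros)
      from has_vector_derivative_real_field[OF this]
      have 1: "((\<lambda>a. exp (- w * of_real a)) has_vector_derivative - w * exp (- w * of_real a)) (at a)" .
      have "(sqrt has_real_derivative inverse (sqrt a) / 2) (at a)" by (rule DERIV_real_sqrt[OF a])
      then have 2: "((\<lambda>a. complex_of_real (sqrt a)) has_vector_derivative of_real (inverse (sqrt a) / 2)) (at a)"
        by (rule has_vector_derivative_of_real)
      show ?thesis
      proof (rule has_vector_derivative_eq_rhs[OF has_vector_derivative_mult[OF 1 2]])
        have "exp (- w * of_real a) * of_real (inverse (sqrt a) / 2) = exp (- w * of_real a) / of_real (sqrt a) / 2"
          using a by (simp add: field_simps)
        then show "exp (- w * of_real a) * of_real (inverse (sqrt a) / 2) + - w * exp (- w * of_real a) * of_real (sqrt a)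
          = w * f' w a + exp (- w * of_real a) / of_real (sqrt a) / 2"
          by (simp only: f'_def) (simp only: mult_minus_left mult_minus_right add.commute mult.assoc mult.left_commute mult.commute)
      qed
    qed
  next
    show "continuous_on {0<..} (\<lambda>a. w * f' w a + exp (- w * of_real a) / of_real (sqrt a) / 2)"
      unfolding f'_def by (intro continuous_intros) auto
    show "integrable half_line (\<lambda>a. w * f' w a + exp (- w * of_real a) / of_real (sqrt a) / 2)"
      by (intro Bochner_Integration.integrable_add integrable_mult_right integrable_divide int' integrable_laplace_inv_sqrt w)
    have "((\<lambda>a. exp (- w * of_real a) * of_real (sqrt a)) \<longlongrightarrow> exp (- w * of_real 0) * of_real (sqrt 0)) (at_right 0)"
      by (intro tendsto_intros)
    then show "((\<lambda>a. exp (- w * of_real a) * of_real (sqrt a)) \<longlongrightarrow> 0) (at_right 0)" by simp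
    show "((\<lambda>a. exp (- w * of_real a) * of_real (sqrt a)) \<longlongrightarrow> 0) at_top"
    proof (rule tendsto_half_line_0[OF w, of _ 1 1])
      fix t :: real assume "t \<ge> 1"
      then have "sqrt t \<le> t" by (intro real_le_lsqrt) (auto simp: power2_eq_square mult_le_cancel_left1)
      then show "norm (exp (- w * of_real t) * of_real (sqrt t)) \<le> 1 * (exp (- Re w * t) * t ^ 1)"
        using \<open>t \<ge> 1\<close> by (simp add: norm_mult)
    qed
  qed
  then have "w * (LINT a|half_line. f' w a) + laplace_inv_sqrt w / 2 = 0"
    using Bochner_Integration.integral_add[OF integrable_mult_right[OF int', of w]
        integrable_divide[OF integrable_laplace_inv_sqrt[OF w], of 2]]
    unfolding laplace_inv_sqrt_def by (simp only: integral_mult_right_zero integral_divide_zero diff_self)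
  moreover have "w \<noteq> 0" using w by auto
  ultimately have "(LINT a|half_line. f' w a) = - laplace_inv_sqrt w / (2 * w)"
    by (simp add: field_simps eq_neg_iff_add_eq_0)
  with deriv show ?thesis by simp
qed

text \<open>On the right half-plane this is sqrt pi times w^(\<nu> - 1/2 - n). It is written as a
  quotient because \<open>n\<close> may exceed \<nu>; each differentiation raises \<open>n\<close>
  by one and brings out the exponent as a factor.\<close>

definition kern_power :: "nat \<Rightarrow> nat \<Rightarrow> complex \<Rightarrow> complex" where
  "kern_power \<nu> n w = w ^ \<nu> * laplace_inv_sqrt w / w ^ n"

lemma DERIV_power_divide:
  fixes s :: complex
  assumes "s \<noteq> 0"
  shows "((\<lambda>s. s ^ k) has_field_derivative of_nat k * s ^ k / s) (at s)"
  by (rule DERIV_cong[OF DERIV_power[OF DERIV_ident]]) (use assms in \<open>cases k; simp\<close>)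

lemma kern_power_deriv:
  assumes w: "Re w > 0"
  shows "(kern_power \<nu> n has_field_derivative of_real (real \<nu> - 1/2 - real n) * kern_power \<nu> (Suc n) w) (at w)"
proof -
  have "w \<noteq> 0" using w by auto
  show ?thesis unfolding kern_power_def[abs_def]
    by (rule DERIV_cong[OF DERIV_divide[OF DERIV_mult[OF DERIV_power_divide[OF \<open>w \<noteq> 0\<close>] laplace_inv_sqrt_deriv[OF w]]
       DERIV_power_divide[OF \<open>w \<noteq> 0\<close>]]])
       (use \<open>w \<noteq> 0\<close> in \<open>auto simp: field_simps\<close>)
qed

lemma continuous_on_kern_power: "continuous_on {w. Re w > 0} (kern_power \<nu> n)"
  using kern_power_deriv by (intro continuous_at_imp_continuous_on) (auto intro: DERIV_isCont)

lemma norm_kern_power_le: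
  assumes w: "Re w > 0" and \<delta>: "0 < \<delta>" "\<delta> \<le> Re w"
  shows "norm (kern_power \<nu> n w) \<le> (sqrt pi / sqrt \<delta>) / \<delta> ^ n * norm w ^ \<nu>"
proof -
  have "norm (laplace_inv_sqrt w) \<le> sqrt pi / sqrt (Re w)" by (rule norm_laplace_inv_sqrt_le[OF w])
  also have "\<dots> \<le> sqrt pi / sqrt \<delta>" using \<delta> by (intro divide_left_mono) auto
  finally have S: "norm (laplace_inv_sqrt w) \<le> sqrt pi / sqrt \<delta>" .
  have "\<delta> ^ n \<le> norm w ^ n" using \<delta> complex_Re_le_cmod[of w] by (intro power_mono) auto
  then have "norm (kern_power \<nu> n w) \<le> norm w ^ \<nu> * (sqrt pi / sqrt \<delta>) / \<delta> ^ n"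
    unfolding kern_power_def norm_divide norm_mult norm_power using \<delta> S
    by (intro frac_le mult_left_mono) auto
  then show ?thesis by (simp add: mult_ac)
qed

section \<open>Integrals of Whittaker type: convergence, derivative, differential equation\<close>

lemma integrable_powr_exp_shift:
  assumes "q > 0" "M \<ge> 0"
  shows "integrable half_line (\<lambda>t. t powr (q - 1) * exp (- t) * (t + M) ^ n)"
  using assms(1)
proof (induction n arbitrary: q)
  case 0
  then show ?case using integrable_powr_exp[of q 1] by simp
next
  case (Suc n)
  \<comment> \<open>One factor t + M is split off. Its part \<open>t\<close> raises the power of
    \<open>t\<close> by one, which is why the induction keeps \<open>q\<close> arbitrary.\<close>
  have "integrable half_line (\<lambda>t. t powr ((q + 1) - 1) * exp (- t) * (t + M) ^ n + M * (t powr (q - 1) * exp (- t) * (t + M) ^ n))"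
    using Suc.IH[of "q + 1"] Suc.IH[of q] Suc.prems by (intro Bochner_Integration.integrable_add integrable_mult_right) auto
  then show ?case
  proof (rule Bochner_Integration.integrable_cong[THEN iffD1, rotated 2])
    fix t assume "t \<in> space half_line"
    then have "t > 0" by (simp add: space_restrict_space)
    then have "t powr q = t powr (q - 1) * t" by (simp add: powr_diff)
    then show "t powr ((q + 1) - 1) * exp (- t) * (t + M) ^ n + M * (t powr (q - 1) * exp (- t) * (t + M) ^ n)
       = t powr (q - 1) * exp (- t) * (t + M) ^ Suc n" by (simp add: algebra_simps)
  qed simp
qed

text \<open>For n = 0 and z = - i \<lambda> |x| this is the integrand of the Whittaker formula up to
  a constant: (m - 3)/2 = \<nu> - 1/2 and t/2 - i \<lambda> |x| = (t + 2z)/2. Up to constant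
  factors, \<open>n\<close> counts derivatives in \<open>z\<close>.\<close>

definition whittaker_integrand :: "nat \<Rightarrow> nat \<Rightarrow> complex \<Rightarrow> real \<Rightarrow> complex" where
  "whittaker_integrand \<nu> n z t = of_real (t powr (real \<nu> - 1/2) * exp (- t)) * kern_power \<nu> n (of_real t + 2 * z)"

definition whittaker :: "nat \<Rightarrow> nat \<Rightarrow> complex \<Rightarrow> complex" where
  "whittaker \<nu> n z = (LINT t|half_line. whittaker_integrand \<nu> n z t)"

lemma whittaker_integrand_continuous:
  assumes "Re z > 0"
  shows "continuous_on {0<..} (whittaker_integrand \<nu> n z)"
proof -
  have "continuous_on {0<..} (\<lambda>t. kern_power \<nu> n (of_real t + 2 * z))"
    by (rule continuous_on_compose2[OF continuous_on_kern_power])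
       (use assms in \<open>auto intro!: continuous_intros\<close>)
  then show ?thesis unfolding whittaker_integrand_def[abs_def]
    by (intro continuous_intros) auto
qed

lemma norm_whittaker_integrand_le:
  assumes \<delta>: "\<delta> > 0" "\<delta> \<le> 2 * Re z" and R: "2 * norm z \<le> R" and t: "t > 0"
  shows "norm (whittaker_integrand \<nu> n z t) \<le>
    (sqrt pi / sqrt \<delta>) / \<delta> ^ n * (t powr (real \<nu> + 1/2 - 1) * exp (- t) * (t + R) ^ \<nu>)"
proof -
  let ?w = "of_real t + 2 * z"
  have "norm (kern_power \<nu> n ?w) \<le> (sqrt pi / sqrt \<delta>) / \<delta> ^ n * norm ?w ^ \<nu>"
    by (rule norm_kern_power_le) (use \<delta> t in auto)
  also have "\<dots> \<le> (sqrt pi / sqrt \<delta>) / \<delta> ^ n * (t + R) ^ \<nu>"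
  proof (intro mult_left_mono power_mono)
    have "norm ?w \<le> norm (complex_of_real t) + norm (2 * z)" by (rule norm_triangle_ineq)
    also have "\<dots> \<le> t + R" using R t by (simp add: norm_mult)
    finally show "norm ?w \<le> t + R" .
  qed (use \<delta> in auto)
  finally have "t powr (real \<nu> - 1/2) * exp (- t) * norm (kern_power \<nu> n ?w) \<le>
     t powr (real \<nu> - 1/2) * exp (- t) * ((sqrt pi / sqrt \<delta>) / \<delta> ^ n * (t + R) ^ \<nu>)"
    by (intro mult_left_mono) auto
  then show ?thesis by (simp add: whittaker_integrand_def norm_mult mult_ac)
qed

lemma integrable_whittaker:
  assumes "Re z > 0"
  shows "integrable half_line (whittaker_integrand \<nu> n z)"
proof (rule integrable_half_line_bound)
  show "continuous_on {0<..} (whittaker_integrand \<nu> n z)" by (rule whittaker_integrand_continuous[OF assms])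
  show "norm (whittaker_integrand \<nu> n z t) \<le>
    (sqrt pi / sqrt (2 * Re z)) / (2 * Re z) ^ n * (t powr (real \<nu> + 1/2 - 1) * exp (- t) * (t + 2 * norm z) ^ \<nu>)"
    if "t > 0" for t
    using norm_whittaker_integrand_le[of "2 * Re z" z "2 * norm z" t \<nu> n] assms that by simp
  show "integrable half_line (\<lambda>t. (sqrt pi / sqrt (2 * Re z)) / (2 * Re z) ^ n * (t powr (real \<nu> + 1/2 - 1) * exp (- t) * (t + 2 * norm z) ^ \<nu>))"
    by (intro integrable_mult_right integrable_powr_exp_shift) auto
qed

lemma whittaker_deriv:
  assumes z: "Re z > 0"
  shows "(whittaker \<nu> n has_field_derivative of_real (2 * (real \<nu> - 1/2 - real n)) * whittaker \<nu> (Suc n) z) (at z)"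
proof -
  define c where "c = complex_of_real (2 * (real \<nu> - 1/2 - real n))"
  define d where "d = Re z / 2"
  have d: "d > 0" using z by (simp add: d_def)
  have Re_y: "Re y > d" if "y \<in> ball z d" for y
    using that abs_Re_le_cmod[of "z - y"] by (simp add: dist_norm d_def)
  have norm_y: "norm y \<le> norm z + d" if "y \<in> ball z d" for y
    using that norm_triangle_ineq2[of y z] by (simp add: dist_norm norm_minus_commute)
  \<comment> \<open>On the ball of radius \<open>d = Re z / 2\<close> one has Re y > d and |y| \<le>
    |z| + d, the two quantities on which \<open>norm_whittaker_integrand_le\<close> depends.\<close>
  define D where "D t = norm c * ((sqrt pi / sqrt (2 * d)) / (2 * d) ^ Suc n *
     (t powr (real \<nu> + 1/2 - 1) * exp (- t) * (t + 2 * (norm z + d)) ^ \<nu>))" for t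
  have "((\<lambda>z. LINT t|half_line. whittaker_integrand \<nu> n z t) has_field_derivative
     (LINT t|half_line. c * whittaker_integrand \<nu> (Suc n) z t)) (at z)"
  proof (rule has_field_derivative_integral[OF d])
    fix y and t :: real assume y: "y \<in> ball z d" and "t \<in> space half_line"
    then have t: "t > 0" by (simp add: space_restrict_space)
    have w: "Re (of_real t + 2 * y) > 0" using Re_y[OF y] d t by simp
    have "((\<lambda>y. of_real t + 2 * y) has_field_derivative 2) (at y)" by (auto intro!: derivative_eq_intros)
    from DERIV_chain2[OF kern_power_deriv[OF w] this]
    have k: "((\<lambda>y. kern_power \<nu> n (of_real t + 2 * y)) has_field_derivative
       of_real (real \<nu> - 1/2 - real n) * kern_power \<nu> (Suc n) (of_real t + 2 * y) * 2) (at y)" .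
    show "((\<lambda>y. whittaker_integrand \<nu> n y t) has_field_derivative c * whittaker_integrand \<nu> (Suc n) y t) (at y)"
      unfolding whittaker_integrand_def
      by (rule DERIV_cong[OF DERIV_cmult[OF k]]) (simp add: c_def)
    have "norm (whittaker_integrand \<nu> (Suc n) y t) \<le> (sqrt pi / sqrt (2 * d)) / (2 * d) ^ Suc n *
     (t powr (real \<nu> + 1/2 - 1) * exp (- t) * (t + 2 * (norm z + d)) ^ \<nu>)"
      by (rule norm_whittaker_integrand_le) (use d Re_y[OF y] norm_y[OF y] t in auto)
    then show "norm (c * whittaker_integrand \<nu> (Suc n) y t) \<le> D t"
      unfolding D_def norm_mult[of c] by (rule mult_left_mono) simp
  next
    show "integrable half_line (whittaker_integrand \<nu> n y)" if "y \<in> ball z d" for y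
      using Re_y[OF that] d by (intro integrable_whittaker) simp
    show "integrable half_line D"
      unfolding D_def using d by (intro integrable_mult_right integrable_powr_exp_shift) auto
  qed
  then show ?thesis unfolding whittaker_def[abs_def] c_def by simp
qed

text \<open>The left-hand side is minus the integral of the derivative of
  \<open>t\<^sup>p\<^sup>+\<^sup>1 e\<^sup>-\<^sup>t kern_power \<nu> 1 (t + 2z)\<close>.\<close>

lemma whittaker_ode:
  assumes z: "Re z > 0" and p: "p = real \<nu> - 1/2"
  shows "whittaker \<nu> 0 z - 2 * (of_real p + z) * whittaker \<nu> 1 z + 2 * of_real (p - 1) * z * whittaker \<nu> 2 z = 0"
proof -
  let ?I = "\<lambda>n t. whittaker_integrand \<nu> n z t"
  have "(LINT t|half_line. - ?I 0 t + 2 * (of_real p + z) * ?I 1 t - 2 * of_real (p - 1) * z * ?I 2 t) = 0 - 0"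
  proof (rule integral_half_line_FTC[where F = "\<lambda>t. of_real (t powr (p + 1) * exp (- t)) * kern_power \<nu> 1 (of_real t + 2 * z)"])
    fix t :: real assume t: "t > 0"
    define w where "w = of_real t + 2 * z"
    have w: "Re w > 0" using t z by (simp add: w_def)
    then have "w \<noteq> 0" by auto
    have "((\<lambda>y. kern_power \<nu> 1 (y + 2 * z)) has_field_derivative of_real (real \<nu> - 1/2 - 1) * kern_power \<nu> 2 w) (at (of_real t))"
    proof -
      have "((\<lambda>y. y + 2 * z) has_field_derivative 1) (at (of_real t))" by (auto intro!: derivative_eq_intros)
      moreover have "(kern_power \<nu> 1 has_field_derivative of_real (real \<nu> - 1/2 - 1) * kern_power \<nu> 2 w) (at (of_real t + 2 * z))"
        using kern_power_deriv[OF w, of \<nu> 1] by (simp add: w_def numeral_2_eq_2)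
      ultimately show ?thesis using DERIV_chain2 by fastforce
    qed
    from has_vector_derivative_real_field[OF this]
    have k: "((\<lambda>t. kern_power \<nu> 1 (of_real t + 2 * z)) has_vector_derivative of_real (p - 1) * kern_power \<nu> 2 w) (at t)"
      by (simp add: p)
    have "((\<lambda>t. t powr (p + 1) * exp (- t)) has_real_derivative (p + 1) * t powr p * exp (- t) - t powr (p + 1) * exp (- t)) (at t)"
      using t by (auto intro!: derivative_eq_intros)
    also have "t powr (p + 1) = t powr p * t" using t by (simp add: powr_add)
    finally have "((\<lambda>t. t powr (p + 1) * exp (- t)) has_real_derivative (p + 1 - t) * (t powr p * exp (- t))) (at t)"
      by (simp add: algebra_simps)
    note e = has_vector_derivative_of_real[OF this, where 'a = complex]
    \<comment> \<open>Replacing \<open>t\<close> by w - 2z and expressing the kernels through the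
      one of index 2 turns the required identity into a polynomial one.\<close>
    have tp: "complex_of_real (t powr (p + 1) * exp (- t)) = of_real (t powr p * exp (- t)) * (w - 2 * z)"
      using t by (simp add: powr_add w_def)
    have ct: "complex_of_real ((p + 1 - t) * (t powr p * exp (- t))) = (of_real p + 1 - (w - 2 * z)) * of_real (t powr p * exp (- t))"
      by (simp add: w_def)
    have k1: "kern_power \<nu> 0 w = w * kern_power \<nu> 1 w" "kern_power \<nu> 1 w = w * kern_power \<nu> 2 w"
      using \<open>w \<noteq> 0\<close> by (auto simp: kern_power_def power2_eq_square)
    show "((\<lambda>t. of_real (t powr (p + 1) * exp (- t)) * kern_power \<nu> 1 (of_real t + 2 * z)) has_vector_derivative
      - ?I 0 t + 2 * (of_real p + z) * ?I 1 t - 2 * of_real (p - 1) * z * ?I 2 t) (at t)"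
    proof (rule has_vector_derivative_eq_rhs[OF has_vector_derivative_mult[OF e k]])
      define E where "E = complex_of_real (t powr p * exp (- t))"
      define X where "X = kern_power \<nu> 2 w"
      have "complex_of_real (t powr (p + 1) * exp (- t)) * (of_real (p - 1) * kern_power \<nu> 2 w) +
        of_real ((p + 1 - t) * (t powr p * exp (- t))) * kern_power \<nu> 1 (of_real t + 2 * z)
        = E * (w - 2 * z) * ((of_real p - 1) * X) + (of_real p + 1 - (w - 2 * z)) * E * (w * X)"
        unfolding tp ct w_def[symmetric] k1(2) E_def X_def by simp
      also have "\<dots> = - (E * (w * (w * X))) + 2 * (of_real p + z) * (E * (w * X)) - 2 * (of_real p - 1) * z * (E * X)"
        by (simp add: algebra_simps)
      also have "\<dots> = - ?I 0 t + 2 * (of_real p + z) * ?I 1 t - 2 * of_real (p - 1) * z * ?I 2 t"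
        unfolding whittaker_integrand_def p[symmetric] w_def[symmetric] k1 E_def X_def by simp
      finally show "complex_of_real (t powr (p + 1) * exp (- t)) * (of_real (p - 1) * kern_power \<nu> 2 w) +
        of_real ((p + 1 - t) * (t powr p * exp (- t))) * kern_power \<nu> 1 (of_real t + 2 * z)
        = - ?I 0 t + 2 * (of_real p + z) * ?I 1 t - 2 * of_real (p - 1) * z * ?I 2 t" .
    qed
  next
    show "continuous_on {0<..} (\<lambda>t. - ?I 0 t + 2 * (of_real p + z) * ?I 1 t - 2 * of_real (p - 1) * z * ?I 2 t)"
      by (intro continuous_intros whittaker_integrand_continuous z)
    show "integrable half_line (\<lambda>t. - ?I 0 t + 2 * (of_real p + z) * ?I 1 t - 2 * of_real (p - 1) * z * ?I 2 t)"
      using integrable_whittaker[OF z] by (intro Bochner_Integration.integrable_add Bochner_Integration.integrable_diff integrable_mult_right Bochner_Integration.integrable_minus) auto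
    have p1: "p + 1 > 0" by (simp add: p)
    have "((\<lambda>t. t powr (p + 1)) \<longlongrightarrow> 0) (at_right 0)"
      using tendsto_powr2[of "\<lambda>t. t" 0 "at_right 0" "\<lambda>_. p + 1" "p + 1"] p1
      by (auto simp: eventually_at_filter)
    then have "((\<lambda>t. of_real (t powr (p + 1) * exp (- t)) * kern_power \<nu> 1 (of_real t + 2 * z)) \<longlongrightarrow>
       of_real (0 * exp (- 0)) * kern_power \<nu> 1 (of_real 0 + 2 * z)) (at_right 0)"
      using kern_power_deriv[of "of_real 0 + 2 * z" \<nu> 1, THEN DERIV_isCont] z
      by (intro tendsto_intros isCont_tendsto_compose[of _ "kern_power \<nu> 1"]) auto
    then show "((\<lambda>t. of_real (t powr (p + 1) * exp (- t)) * kern_power \<nu> 1 (of_real t + 2 * z)) \<longlongrightarrow> 0) (at_right 0)"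
      by simp
    show "((\<lambda>t. of_real (t powr (p + 1) * exp (- t)) * kern_power \<nu> 1 (of_real t + 2 * z)) \<longlongrightarrow> 0) at_top"
    proof (rule tendsto_half_line_0[of 1 _ "(sqrt pi / sqrt (2 * Re z)) / (2 * Re z) ^ 1 * (1 + 2 * norm z) ^ \<nu>" "Suc \<nu> + \<nu>"])
      fix t :: real assume t: "t \<ge> 1"
      have "norm (kern_power \<nu> 1 (of_real t + 2 * z)) \<le> (sqrt pi / sqrt (2 * Re z)) / (2 * Re z) ^ 1 * norm (of_real t + 2 * z) ^ \<nu>"
        by (rule norm_kern_power_le) (use z t in auto)
      also have "\<dots> \<le> (sqrt pi / sqrt (2 * Re z)) / (2 * Re z) ^ 1 * ((1 + 2 * norm z) * t) ^ \<nu>"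
      proof (intro mult_left_mono power_mono)
        have "norm (of_real t + 2 * z) \<le> norm (complex_of_real t) + norm (2 * z)" by (rule norm_triangle_ineq)
        also have "\<dots> \<le> t + 2 * norm z * t" using t by (simp add: norm_mult mult_le_cancel_left1)
        finally show "norm (of_real t + 2 * z) \<le> (1 + 2 * norm z) * t" by (simp add: algebra_simps)
      qed (use z in auto)
      finally have k: "norm (kern_power \<nu> 1 (of_real t + 2 * z)) \<le> (sqrt pi / sqrt (2 * Re z)) / (2 * Re z) ^ 1 * ((1 + 2 * norm z) * t) ^ \<nu>" .
      have "t powr (p + 1) \<le> t powr (real (Suc \<nu>))" using t by (intro powr_mono) (auto simp: p)
      then have "t powr (p + 1) \<le> t ^ Suc \<nu>" using t by (simp add: powr_realpow del: power_Suc of_nat_Suc)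
      then have "t powr (p + 1) * exp (- t) * norm (kern_power \<nu> 1 (of_real t + 2 * z)) \<le>
        t ^ Suc \<nu> * exp (- t) * ((sqrt pi / sqrt (2 * Re z)) / (2 * Re z) ^ 1 * ((1 + 2 * norm z) * t) ^ \<nu>)"
        using t by (intro mult_mono k) auto
      then show "norm (of_real (t powr (p + 1) * exp (- t)) * kern_power \<nu> 1 (of_real t + 2 * z)) \<le>
        (sqrt pi / sqrt (2 * Re z)) / (2 * Re z) ^ 1 * (1 + 2 * norm z) ^ \<nu> * (exp (- 1 * t) * t ^ (Suc \<nu> + \<nu>))"
        by (simp add: norm_mult power_mult_distrib power_add mult_ac)
    qed simp
  qed
  then have "- whittaker \<nu> 0 z + 2 * (of_real p + z) * whittaker \<nu> 1 z - 2 * of_real (p - 1) * z * whittaker \<nu> 2 z = 0"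
    unfolding whittaker_def using integrable_whittaker[OF z] by simp
  then show ?thesis by (simp add: algebra_simps)
qed

section \<open>The radial profile\<close>

lemma whittaker_chain:
  assumes "Re (\<kappa> * s) > 0"
  shows "((\<lambda>s. whittaker \<nu> n (\<kappa> * s)) has_field_derivative
    \<kappa> * ((2 * of_nat \<nu> - 1 - 2 * of_nat n) * whittaker \<nu> (Suc n) (\<kappa> * s))) (at s)"
proof -
  have "((\<lambda>s. \<kappa> * s) has_field_derivative \<kappa>) (at s)" by (auto intro!: derivative_eq_intros)
  from DERIV_chain2[OF whittaker_deriv[OF assms] this]
  show ?thesis by (rule DERIV_cong) (simp add: algebra_simps)
qed

text \<open>With \<kappa> fixed, this is a constant multiple of r^(-\<nu>) K_\<nu>(\<kappa> r),
  where K_\<nu> is the modified Bessel function of the second kind.\<close>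

definition profile :: "nat \<Rightarrow> complex \<Rightarrow> real \<Rightarrow> complex" where
  "profile \<nu> \<kappa> r = exp (- (\<kappa> * of_real r)) * whittaker \<nu> 0 (\<kappa> * of_real r) / of_real r ^ (2 * \<nu>)"

text \<open>\<open>profile1 \<nu> \<kappa> r\<close> is the derivative of \<open>profile \<nu> \<kappa>\<close> at \<open>r\<close>, divided by \<open>r\<close>.\<close>

definition profile_slope :: "nat \<Rightarrow> complex \<Rightarrow> complex \<Rightarrow> complex" where
  "profile_slope \<nu> \<kappa> s = (2 * of_nat \<nu> - 1) * (\<kappa> * s) * whittaker \<nu> 1 (\<kappa> * s)
     - (2 * of_nat \<nu> + \<kappa> * s) * whittaker \<nu> 0 (\<kappa> * s)"

definition profile1 :: "nat \<Rightarrow> complex \<Rightarrow> real \<Rightarrow> complex" where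
  "profile1 \<nu> \<kappa> r = exp (- (\<kappa> * of_real r)) * profile_slope \<nu> \<kappa> (of_real r) / of_real r ^ (2 * \<nu> + 2)"

lemma DERIV_exp_minus_mult: "((\<lambda>s. exp (- (\<kappa> * s))) has_field_derivative - \<kappa> * exp (- (\<kappa> * s))) (at (s::complex))"
  by (auto intro!: derivative_eq_intros)

text \<open>The quotient rule is applied in a complex variable \<open>s\<close>, in which
  \<open>whittaker\<close> is holomorphic; the result is then restricted to real
  \<open>r\<close>.\<close>

lemma profile_deriv:
  assumes r: "r > 0" and \<kappa>: "Re \<kappa> > 0"
  shows "(profile \<nu> \<kappa> has_vector_derivative r *\<^sub>R profile1 \<nu> \<kappa> r) (at r)"
proof -
  define s where "s = complex_of_real r"
  have s: "s \<noteq> 0" "Re (\<kappa> * s) > 0" using r \<kappa> by (auto simp: s_def)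
  define W0 W1 e where "W0 = whittaker \<nu> 0 (\<kappa> * s)" and "W1 = whittaker \<nu> 1 (\<kappa> * s)" and "e = exp (- (\<kappa> * s))"
  note W = whittaker_chain[OF s(2), of \<nu> 0]
  have "((\<lambda>s. exp (- (\<kappa> * s)) * whittaker \<nu> 0 (\<kappa> * s) / s ^ (2 * \<nu>)) has_field_derivative s * (e * profile_slope \<nu> \<kappa> s / s ^ (2 * \<nu> + 2))) (at s)"
  proof (rule DERIV_cong[OF DERIV_divide[OF DERIV_mult[OF DERIV_exp_minus_mult W] DERIV_power_divide[OF s(1)]]])
    show "((- \<kappa> * exp (- (\<kappa> * s)) * whittaker \<nu> 0 (\<kappa> * s) +
           \<kappa> * ((2 * of_nat \<nu> - 1 - 2 * of_nat 0) * whittaker \<nu> (Suc 0) (\<kappa> * s)) * exp (- (\<kappa> * s))) * s ^ (2 * \<nu>) -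
          exp (- (\<kappa> * s)) * whittaker \<nu> 0 (\<kappa> * s) * (of_nat (2 * \<nu>) * s ^ (2 * \<nu>) / s)) / (s ^ (2 * \<nu>) * s ^ (2 * \<nu>))
       = s * (e * profile_slope \<nu> \<kappa> s / s ^ (2 * \<nu> + 2))"
      unfolding profile_slope_def e_def[symmetric] One_nat_def[symmetric] W0_def[symmetric] W1_def[symmetric]
      using s(1) by (simp add: power_add power2_eq_square divide_simps) (simp add: algebra_simps)
  qed (use s in auto)
  from has_vector_derivative_real_field[OF this[unfolded s_def]]
  show ?thesis
    by (simp add: profile_def[abs_def] profile1_def e_def s_def scaleR_conv_of_real)
qed

text \<open>The Helmholtz equation enters here. The difference of the two sides is \<kappa> (2\<nu>
  - 1) times the left-hand side of \<open>whittaker_ode\<close>. In \<open>profile1_deriv\<close>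
  the summand \<kappa> h cancels against the derivative of the exponential, and \<kappa>^2 s W0
  becomes the term \<kappa>^2 U.\<close>

lemma profile_slope_deriv:
  assumes "Re (\<kappa> * s) > 0"
  shows "(profile_slope \<nu> \<kappa> has_field_derivative \<kappa> * profile_slope \<nu> \<kappa> s + \<kappa>\<^sup>2 * s * whittaker \<nu> 0 (\<kappa> * s)) (at s)"
proof -
  define W0 W1 W2 where "W0 = whittaker \<nu> 0 (\<kappa> * s)" and "W1 = whittaker \<nu> 1 (\<kappa> * s)" and "W2 = whittaker \<nu> 2 (\<kappa> * s)"
  define q where "q = 2 * complex_of_nat \<nu> - 1"
  \<comment> \<open>As W0' is a multiple of W1 and W1' of W2, this is Kummer's equation for W0 in
    the variable 2 \<kappa> s.\<close>
  have ode: "W0 - (q + 2 * (\<kappa> * s)) * W1 + (q - 2) * (\<kappa> * s) * W2 = 0"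
    using whittaker_ode[OF assms refl, of \<nu>] unfolding W0_def W1_def W2_def q_def by (simp add: algebra_simps)
  have W: "((\<lambda>s. whittaker \<nu> 0 (\<kappa> * s)) has_field_derivative \<kappa> * (q * W1)) (at s)"
    "((\<lambda>s. whittaker \<nu> 1 (\<kappa> * s)) has_field_derivative \<kappa> * ((q - 2) * W2)) (at s)"
    using whittaker_chain[OF assms, of \<nu> 0] whittaker_chain[OF assms, of \<nu> 1]
    by (simp_all add: q_def W1_def W2_def numeral_2_eq_2)
  have l: "((\<lambda>s. \<kappa> * s) has_field_derivative \<kappa>) (at s)" by (auto intro!: derivative_eq_intros)
  have l1: "((\<lambda>s. q * (\<kappa> * s)) has_field_derivative q * \<kappa>) (at s)"
    "((\<lambda>s. 2 * of_nat \<nu> + \<kappa> * s) has_field_derivative \<kappa>) (at s)"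
    by (auto intro!: derivative_eq_intros)
  show ?thesis unfolding profile_slope_def[abs_def] q_def[symmetric]
  proof (rule DERIV_cong[OF DERIV_diff[OF DERIV_mult[OF l1(1) W(2)] DERIV_mult[OF l1(2) W(1)]]])
    have "q * \<kappa> * W1 + \<kappa> * ((q - 2) * W2) * (q * (\<kappa> * s)) - (\<kappa> * W0 + \<kappa> * (q * W1) * (2 * of_nat \<nu> + \<kappa> * s))
       - (\<kappa> * (q * (\<kappa> * s) * W1 - (2 * of_nat \<nu> + \<kappa> * s) * W0) + \<kappa>\<^sup>2 * s * W0)
       = \<kappa> * q * (W0 - (q + 2 * (\<kappa> * s)) * W1 + (q - 2) * (\<kappa> * s) * W2)"
      unfolding q_def by (simp add: algebra_simps power2_eq_square)
    also have "\<dots> = 0" unfolding ode by simp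
    finally show "q * \<kappa> * whittaker \<nu> 1 (\<kappa> * s) + \<kappa> * ((q - 2) * W2) * (q * (\<kappa> * s)) -
      (\<kappa> * whittaker \<nu> 0 (\<kappa> * s) + \<kappa> * (q * W1) * (2 * of_nat \<nu> + \<kappa> * s))
      = \<kappa> * (q * (\<kappa> * s) * whittaker \<nu> 1 (\<kappa> * s) - (2 * of_nat \<nu> + \<kappa> * s) * whittaker \<nu> 0 (\<kappa> * s)) +
         \<kappa>\<^sup>2 * s * whittaker \<nu> 0 (\<kappa> * s)"
      unfolding W0_def[symmetric] W1_def[symmetric] by simp
  qed
qed

lemma profile1_deriv:
  assumes r: "r > 0" and \<kappa>: "Re \<kappa> > 0"
  shows "(profile1 \<nu> \<kappa> has_vector_derivative
    (\<kappa>\<^sup>2 * profile \<nu> \<kappa> r - of_nat (2 * Suc \<nu>) * profile1 \<nu> \<kappa> r) /\<^sub>R r) (at r)"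
proof -
  define s where "s = complex_of_real r"
  have s: "s \<noteq> 0" "Re (\<kappa> * s) > 0" using r \<kappa> by (auto simp: s_def)
  define W0 h e where "W0 = whittaker \<nu> 0 (\<kappa> * s)" and "h = profile_slope \<nu> \<kappa> s" and "e = exp (- (\<kappa> * s))"
  have "((\<lambda>s. exp (- (\<kappa> * s)) * profile_slope \<nu> \<kappa> s / s ^ (2 * \<nu> + 2)) has_field_derivative
     (\<kappa>\<^sup>2 * (e * W0 / s ^ (2 * \<nu>)) - of_nat (2 * Suc \<nu>) * (e * h / s ^ (2 * \<nu> + 2))) / s) (at s)"
  proof (rule DERIV_cong[OF DERIV_divide[OF DERIV_mult[OF DERIV_exp_minus_mult profile_slope_deriv[OF s(2)]] DERIV_power_divide[OF s(1)]]])
    show "((- \<kappa> * exp (- (\<kappa> * s)) * profile_slope \<nu> \<kappa> s +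
        (\<kappa> * profile_slope \<nu> \<kappa> s + \<kappa>\<^sup>2 * s * whittaker \<nu> 0 (\<kappa> * s)) * exp (- (\<kappa> * s))) * s ^ (2 * \<nu> + 2) -
        exp (- (\<kappa> * s)) * profile_slope \<nu> \<kappa> s * (of_nat (2 * \<nu> + 2) * s ^ (2 * \<nu> + 2) / s)) / (s ^ (2 * \<nu> + 2) * s ^ (2 * \<nu> + 2))
       = (\<kappa>\<^sup>2 * (e * W0 / s ^ (2 * \<nu>)) - of_nat (2 * Suc \<nu>) * (e * h / s ^ (2 * \<nu> + 2))) / s"
      unfolding e_def[symmetric] W0_def[symmetric] h_def[symmetric]
      using s(1) by (simp add: power_add power2_eq_square divide_simps) (simp add: algebra_simps)
  qed (use s in auto)
  from has_vector_derivative_real_field[OF this[unfolded s_def]]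
  show ?thesis
    by (simp add: profile_def profile1_def[abs_def] e_def s_def h_def W0_def scaleR_conv_of_real divide_inverse mult.commute)
qed

text \<open>Unlike the earlier bound, this one does not degenerate as Re z tends to 0: Re w \<ge> t
  bounds S(w) by sqrt (pi / t), and n \<le> \<nu> leaves no negative power of \<open>w\<close>. The
  price is half a power of \<open>t\<close>; the resulting t^(\<nu> - 1) is still integrable at 0
  once \<nu> \<ge> 1.\<close>

lemma norm_whittaker_integrand_le2:
  assumes z: "Re z > 0" and t: "t > 0" and n: "n \<le> \<nu>"
  shows "norm (whittaker_integrand \<nu> n z t) \<le>
    sqrt pi * (1 + 2 * norm z) ^ \<nu> * (t powr (real \<nu> - 1) * exp (- t) * (t + 1) ^ \<nu>)"
proof -
  define w where "w = of_real t + 2 * z"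
  have w: "Re w \<ge> t" "Re w > 0" "w \<noteq> 0" using z t by (auto simp: w_def complex_eq_iff)
  have "norm (laplace_inv_sqrt w) \<le> sqrt pi / sqrt (Re w)" by (rule norm_laplace_inv_sqrt_le[OF w(2)])
  also have "\<dots> \<le> sqrt pi / sqrt t" using w t by (intro divide_left_mono) auto
  finally have S: "norm (laplace_inv_sqrt w) \<le> sqrt pi / sqrt t" .
  have "norm w \<le> norm (complex_of_real t) + norm (2 * z)" unfolding w_def by (rule norm_triangle_ineq)
  also have "\<dots> \<le> (1 + 2 * norm z) * (t + 1)" using t by (simp add: norm_mult algebra_simps)
  finally have "norm w ^ (\<nu> - n) \<le> ((1 + 2 * norm z) * (t + 1)) ^ (\<nu> - n)" by (intro power_mono) auto
  also have "\<dots> \<le> ((1 + 2 * norm z) * (t + 1)) ^ \<nu>"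
  proof (rule power_increasing)
    have "1 * 1 \<le> (1 + 2 * norm z) * (t + 1)" using t by (intro mult_mono) auto
    then show "1 \<le> (1 + 2 * norm z) * (t + 1)" by simp
  qed simp
  finally have P: "norm w ^ (\<nu> - n) \<le> ((1 + 2 * norm z) * (t + 1)) ^ \<nu>" .
  have "kern_power \<nu> n w = w ^ (\<nu> - n) * laplace_inv_sqrt w"
    using w(3) n by (simp add: kern_power_def power_diff)
  then have "norm (kern_power \<nu> n w) = norm w ^ (\<nu> - n) * norm (laplace_inv_sqrt w)"
    by (simp add: norm_mult norm_power)
  also have "\<dots> \<le> ((1 + 2 * norm z) * (t + 1)) ^ \<nu> * (sqrt pi / sqrt t)"
    using t by (intro mult_mono P S) auto
  finally have K: "norm (kern_power \<nu> n w) \<le> ((1 + 2 * norm z) * (t + 1)) ^ \<nu> * (sqrt pi / sqrt t)" .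
  have tp: "t powr (real \<nu> - 1/2) = t powr (real \<nu> - 1) * sqrt t"
    using t by (simp add: powr_half_sqrt[symmetric] powr_add[symmetric])
  have "norm (whittaker_integrand \<nu> n z t) = t powr (real \<nu> - 1/2) * exp (- t) * norm (kern_power \<nu> n w)"
    by (simp add: whittaker_integrand_def norm_mult w_def)
  also have "\<dots> \<le> t powr (real \<nu> - 1/2) * exp (- t) * (((1 + 2 * norm z) * (t + 1)) ^ \<nu> * (sqrt pi / sqrt t))"
    by (intro mult_left_mono K) auto
  also have "\<dots> = sqrt pi * (1 + 2 * norm z) ^ \<nu> * (t powr (real \<nu> - 1) * exp (- t) * (t + 1) ^ \<nu>)"
    unfolding tp using t by (simp add: power_mult_distrib)
  finally show ?thesis .
qed

text \<open>One constant for the whole right half-plane, including the vicinity of 0. The indices 0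
  and 1 are those occurring in the profile and its slope.\<close>

lemma norm_whittaker_le:
  assumes "\<nu> \<ge> 1"
  obtains C where "C \<ge> 0"
    "\<And>n z. n \<le> 1 \<Longrightarrow> Re z > 0 \<Longrightarrow> norm (whittaker \<nu> n z) \<le> C * (1 + 2 * norm z) ^ \<nu>"
proof
  define I where "I = (LINT t|half_line. t powr (real \<nu> - 1) * exp (- t) * (t + 1) ^ \<nu>)"
  show "sqrt pi * I \<ge> 0"
    unfolding I_def by (intro mult_nonneg_nonneg Bochner_Integration.integral_nonneg) (auto simp: space_restrict_space)
  fix n z assume n: "n \<le> (1::nat)" and z: "Re z > 0"
  have i: "integrable half_line (\<lambda>t. t powr (real \<nu> - 1) * exp (- t) * (t + 1) ^ \<nu>)"
    using assms by (intro integrable_powr_exp_shift) auto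
  have "norm (whittaker \<nu> n z) \<le> (LINT t|half_line. sqrt pi * (1 + 2 * norm z) ^ \<nu> * (t powr (real \<nu> - 1) * exp (- t) * (t + 1) ^ \<nu>))"
    unfolding whittaker_def
    by (rule Bochner_Integration.integral_norm_bound_integral)
       (use i n z assms in \<open>auto intro!: integrable_whittaker integrable_mult_right norm_whittaker_integrand_le2 simp: space_restrict_space\<close>)
  also have "\<dots> = sqrt pi * (1 + 2 * norm z) ^ \<nu> * I"
    unfolding I_def by (rule integral_mult_right_zero)
  finally show "norm (whittaker \<nu> n z) \<le> sqrt pi * I * (1 + 2 * norm z) ^ \<nu>" by (simp add: mult_ac)
qed

text \<open>At z = 0 the integrand becomes t^(\<nu> - 1/2) e^(-t) t^\<nu> sqrt (pi / t) = sqrt pi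
  t^(2\<nu> - 1) e^(-t), an Euler integral.\<close>

lemma whittaker_tendsto_0:
  assumes \<nu>: "\<nu> \<ge> 1" and \<kappa>: "Re \<kappa> > 0"
  shows "((\<lambda>r. whittaker \<nu> 0 (\<kappa> * of_real r)) \<longlongrightarrow> of_real (sqrt pi * Gamma (2 * real \<nu>))) (at_right 0)"
  unfolding tendsto_at_iff_sequentially o_def
proof (intro allI impI)
  fix X :: "nat \<Rightarrow> real" assume X: "\<forall>i. X i \<in> {0<..} - {0}" "X \<longlonglongrightarrow> 0"
  have X_pos: "X i > 0" for i using X(1) by auto
  obtain B where B: "B > 0" "\<And>i. \<bar>X i\<bar> \<le> B"
    using convergent_imp_Bseq[OF convergentI[OF X(2)]] by (auto simp: Bseq_def)
  have Re_pos: "Re (\<kappa> * of_real (X i)) > 0" for i using X_pos \<kappa> by simp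
  have "(\<lambda>i. whittaker \<nu> 0 (\<kappa> * of_real (X i))) \<longlonglongrightarrow>
     (LINT t|half_line. complex_of_real (sqrt pi * (t powr (2 * real \<nu> - 1) * exp (- 1 * t))))"
    unfolding whittaker_def
  proof (rule integral_dominated_convergence)
    show "(\<lambda>t. complex_of_real (sqrt pi * (t powr (2 * real \<nu> - 1) * exp (- 1 * t)))) \<in> borel_measurable half_line"
      by (intro measurable_restrict_space1) simp
    show "whittaker_integrand \<nu> 0 (\<kappa> * of_real (X i)) \<in> borel_measurable half_line" for i
      by (intro borel_measurable_half_line_continuous whittaker_integrand_continuous Re_pos)
    show "integrable half_line (\<lambda>t. sqrt pi * (1 + 2 * (norm \<kappa> * B)) ^ \<nu> * (t powr (real \<nu> - 1) * exp (- t) * (t + 1) ^ \<nu>))"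
      using \<nu> by (intro integrable_mult_right integrable_powr_exp_shift) auto
    show "AE t in half_line. norm (whittaker_integrand \<nu> 0 (\<kappa> * of_real (X i)) t) \<le>
       sqrt pi * (1 + 2 * (norm \<kappa> * B)) ^ \<nu> * (t powr (real \<nu> - 1) * exp (- t) * (t + 1) ^ \<nu>)" for i
    proof (rule AE_I2)
      fix t assume "t \<in> space half_line"
      then have t: "t > 0" by (simp add: space_restrict_space)
      have "norm (whittaker_integrand \<nu> 0 (\<kappa> * of_real (X i)) t) \<le>
        sqrt pi * (1 + 2 * norm (\<kappa> * of_real (X i))) ^ \<nu> * (t powr (real \<nu> - 1) * exp (- t) * (t + 1) ^ \<nu>)"
        by (rule norm_whittaker_integrand_le2[OF Re_pos t]) simp
      also have "\<dots> \<le> sqrt pi * (1 + 2 * (norm \<kappa> * B)) ^ \<nu> * (t powr (real \<nu> - 1) * exp (- t) * (t + 1) ^ \<nu>)"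
        using t B(2)[of i] by (intro mult_right_mono mult_left_mono power_mono) (auto simp: norm_mult intro!: mult_left_mono)
      finally show "norm (whittaker_integrand \<nu> 0 (\<kappa> * of_real (X i)) t) \<le>
       sqrt pi * (1 + 2 * (norm \<kappa> * B)) ^ \<nu> * (t powr (real \<nu> - 1) * exp (- t) * (t + 1) ^ \<nu>)" .
    qed
    show "AE t in half_line. (\<lambda>i. whittaker_integrand \<nu> 0 (\<kappa> * of_real (X i)) t) \<longlonglongrightarrow>
       complex_of_real (sqrt pi * (t powr (2 * real \<nu> - 1) * exp (- 1 * t)))"
    proof (rule AE_I2)
      fix t assume "t \<in> space half_line"
      then have t: "t > 0" by (simp add: space_restrict_space)
      have "(\<lambda>i. of_real t + 2 * (\<kappa> * of_real (X i))) \<longlonglongrightarrow> of_real t + 2 * (\<kappa> * of_real 0)"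
        by (intro tendsto_intros X)
      moreover have "isCont (kern_power \<nu> 0) (of_real t)"
        using kern_power_deriv[of "of_real t" \<nu> 0] t by (auto intro: DERIV_isCont)
      ultimately have "(\<lambda>i. kern_power \<nu> 0 (of_real t + 2 * (\<kappa> * of_real (X i)))) \<longlonglongrightarrow> kern_power \<nu> 0 (of_real t)"
        using isCont_tendsto_compose by fastforce
      then have "(\<lambda>i. whittaker_integrand \<nu> 0 (\<kappa> * of_real (X i)) t) \<longlonglongrightarrow>
        of_real (t powr (real \<nu> - 1/2) * exp (- t)) * kern_power \<nu> 0 (of_real t)"
        unfolding whittaker_integrand_def by (intro tendsto_intros)
      moreover have "of_real (t powr (real \<nu> - 1/2) * exp (- t)) * kern_power \<nu> 0 (of_real t) =
        complex_of_real (sqrt pi * (t powr (2 * real \<nu> - 1) * exp (- 1 * t)))"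
      proof -
        have "t powr (2 * real \<nu> - 1) = t powr (real \<nu> - 1/2) * (t powr real \<nu> / t powr (1/2))"
          using t by (simp flip: powr_add powr_diff)
        also have "\<dots> = t powr (real \<nu> - 1/2) * (t ^ \<nu> / sqrt t)"
          using t by (simp only: powr_half_sqrt[OF less_imp_le] powr_realpow)
        finally show ?thesis
          unfolding kern_power_def laplace_inv_sqrt_of_real[OF t] by simp
      qed
      ultimately show "(\<lambda>i. whittaker_integrand \<nu> 0 (\<kappa> * of_real (X i)) t) \<longlonglongrightarrow>
       complex_of_real (sqrt pi * (t powr (2 * real \<nu> - 1) * exp (- 1 * t)))" by (simp only:)
    qed
  qed
  also have "(LINT t|half_line. complex_of_real (sqrt pi * (t powr (2 * real \<nu> - 1) * exp (- 1 * t)))) =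
     of_real (sqrt pi * (LINT t|half_line. t powr (2 * real \<nu> - 1) * exp (- 1 * t)))"
    by (simp only: integral_complex_of_real integral_mult_right_zero)
  also have "(LINT t|half_line. t powr (2 * real \<nu> - 1) * exp (- 1 * t)) = Gamma (2 * real \<nu>)"
    using \<nu> by (subst integral_powr_exp) auto
  finally show "(\<lambda>i. whittaker \<nu> 0 (\<kappa> * of_real (X i))) \<longlonglongrightarrow> of_real (sqrt pi * Gamma (2 * real \<nu>))" .
qed

lemma power_mult_exp_bounded:
  fixes A \<delta> :: real
  assumes A: "A \<ge> 0" and \<delta>: "\<delta> > 0"
  obtains K where "K \<ge> 0" "\<And>r. r \<ge> 0 \<Longrightarrow> (1 + A * r) ^ n * exp (- \<delta> * r) \<le> K"
proof
  \<comment> \<open>With this \<open>c\<close> one has 1 + A r \<le> c (1 + \<delta> r / (n + 1))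
    \<le> c exp (\<delta> r / (n + 1)), and the n-th power costs at most exp (\<delta> r). Dividing
    by n + 1 also covers n = 0.\<close>
  define c where "c = max 1 (A * real (n + 1) / \<delta>)"
  show "c ^ n \<ge> 0" by (simp add: c_def)
  fix r :: real assume r: "r \<ge> 0"
  have "A \<le> c * (\<delta> / real (n + 1))"
  proof -
    have "A * real (n + 1) / \<delta> \<le> c" by (simp add: c_def)
    then show ?thesis using \<delta> by (simp add: field_simps)
  qed
  then have "A * r \<le> c * (\<delta> / real (n + 1)) * r" using r by (rule mult_right_mono)
  then have "1 + A * r \<le> c * (1 + \<delta> / real (n + 1) * r)"
    unfolding distrib_left by (intro add_mono) (auto simp: c_def mult_ac)
  also have "\<dots> \<le> c * exp (\<delta> / real (n + 1) * r)"
    by (intro mult_left_mono exp_ge_add_one_self) (simp add: c_def)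
  finally have "(1 + A * r) ^ n \<le> (c * exp (\<delta> / real (n + 1) * r)) ^ n"
    using A r by (intro power_mono) auto
  also have "\<dots> = c ^ n * exp (real n * (\<delta> / real (n + 1) * r))"
    by (simp only: power_mult_distrib exp_of_nat_mult)
  also have "\<dots> \<le> c ^ n * exp (\<delta> * r)"
  proof (intro mult_left_mono)
    have "real n / real (n + 1) * (\<delta> * r) \<le> 1 * (\<delta> * r)"
      using \<delta> r by (intro mult_right_mono) auto
    then show "exp (real n * (\<delta> / real (n + 1) * r)) \<le> exp (\<delta> * r)" by simp
  qed (simp add: c_def)
  finally show "(1 + A * r) ^ n * exp (- \<delta> * r) \<le> c ^ n"
    by (simp add: exp_minus field_simps)
qed

text \<open>The three analytic hypotheses of \<open>fundamental_solution\<close>, with decay rate Re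
  \<kappa> / 2. The limit is the constant that has to be normalized.\<close>

lemma profile_bounds:
  assumes \<nu>: "\<nu> \<ge> 1" and \<kappa>: "Re \<kappa> > 0"
  obtains C B where
    "\<And>r. r > 0 \<Longrightarrow> norm (profile \<nu> \<kappa> r) \<le> C * (exp (- (Re \<kappa> / 2) * r) / r ^ (2 * \<nu>))"
    "\<And>r. r > 0 \<Longrightarrow> norm (of_real (r ^ (2 * Suc \<nu>)) * (\<kappa>\<^sup>2 * profile \<nu> \<kappa> r - of_nat (2 * Suc \<nu>) * profile1 \<nu> \<kappa> r)) \<le> B"
    "((\<lambda>r. of_real (r ^ (2 * Suc \<nu>)) * (\<kappa>\<^sup>2 * profile \<nu> \<kappa> r - of_nat (2 * Suc \<nu>) * profile1 \<nu> \<kappa> r))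
      \<longlongrightarrow> of_nat (2 * Suc \<nu>) * (2 * of_nat \<nu>) * of_real (sqrt pi * Gamma (2 * real \<nu>))) (at_right 0)"
proof -
  obtain Cw where Cw: "Cw \<ge> 0"
    "\<And>n z. n \<le> 1 \<Longrightarrow> Re z > 0 \<Longrightarrow> norm (whittaker \<nu> n z) \<le> Cw * (1 + 2 * norm z) ^ \<nu>"
    using norm_whittaker_le[OF \<nu>] by blast
  obtain K where K: "K \<ge> 0" "\<And>r. r \<ge> 0 \<Longrightarrow> (1 + 2 * norm \<kappa> * r) ^ \<nu> * exp (- (Re \<kappa> / 2) * r) \<le> K"
    using power_mult_exp_bounded[of "2 * norm \<kappa>" "Re \<kappa> / 2" \<nu>] \<kappa> by auto
  obtain K2 where K2: "K2 \<ge> 0" "\<And>r. r \<ge> 0 \<Longrightarrow> (1 + 2 * norm \<kappa> * r) ^ (\<nu> + 2) * exp (- Re \<kappa> * r) \<le> K2"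
    using power_mult_exp_bounded[of "2 * norm \<kappa>" "Re \<kappa>" "\<nu> + 2"] \<kappa> by auto
  define m where "m = 2 * Suc \<nu>"
  define W where "W n r = whittaker \<nu> n (\<kappa> * of_real r)" for n r
  have W_bound: "norm (W n r) \<le> Cw * (1 + 2 * norm \<kappa> * r) ^ \<nu>" if "r > 0" "n \<le> 1" for n r
    using Cw(2)[of n "\<kappa> * of_real r"] that \<kappa> by (simp add: W_def norm_mult mult.assoc)
  \<comment> \<open>What remains of r^m (\<kappa>^2 U - m U1) once the exponential is split off: all
    negative powers of \<open>r\<close> have cancelled, and as r tends to 0 only the term 2 \<nu> m
    W 0 r survives.\<close>
  define T where "T r = (\<kappa> * of_real r)\<^sup>2 * W 0 r + of_nat m * ((2 * of_nat \<nu> + \<kappa> * of_real r) * W 0 r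
     - (2 * of_nat \<nu> - 1) * (\<kappa> * of_real r) * W 1 r)" for r
  have H_eq: "of_real (r ^ (2 * Suc \<nu>)) * (\<kappa>\<^sup>2 * profile \<nu> \<kappa> r - of_nat (2 * Suc \<nu>) * profile1 \<nu> \<kappa> r) =
     exp (- (\<kappa> * of_real r)) * T r" if r: "r > 0" for r
  proof -
    define s where "s = complex_of_real r"
    have s: "s \<noteq> 0" using r by (simp add: s_def)
    have "s ^ (2 * Suc \<nu>) * (\<kappa>\<^sup>2 * (exp (- (\<kappa> * s)) * W 0 r / s ^ (2 * \<nu>)) -
        of_nat m * (exp (- (\<kappa> * s)) * profile_slope \<nu> \<kappa> s / s ^ (2 * \<nu> + 2)))
      = exp (- (\<kappa> * s)) * ((\<kappa> * s)\<^sup>2 * W 0 r - of_nat m * profile_slope \<nu> \<kappa> s)"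
      using s by (simp add: power_add power_mult_distrib power2_eq_square field_simps)
    also have "(\<kappa> * s)\<^sup>2 * W 0 r - of_nat m * profile_slope \<nu> \<kappa> s = T r"
      by (simp add: profile_slope_def T_def W_def s_def algebra_simps)
    finally show ?thesis unfolding profile_def profile1_def W_def s_def m_def of_real_power .
  qed

  show ?thesis
  proof (rule that)
    fix r :: real assume r: "r > 0"
    have "norm (profile \<nu> \<kappa> r) = exp (- Re \<kappa> * r) * norm (W 0 r) / r ^ (2 * \<nu>)"
      using r by (simp add: profile_def W_def norm_divide norm_mult norm_power)
    also have "\<dots> \<le> exp (- Re \<kappa> * r) * (Cw * (1 + 2 * norm \<kappa> * r) ^ \<nu>) / r ^ (2 * \<nu>)"
      using r by (intro divide_right_mono mult_left_mono W_bound) auto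
    \<comment> \<open>Half of the exponential decay is spent on the polynomial growth of
      \<open>W 0\<close>.\<close>
    also have "\<dots> = Cw * exp (- (Re \<kappa> / 2) * r) * ((1 + 2 * norm \<kappa> * r) ^ \<nu> * exp (- (Re \<kappa> / 2) * r)) / r ^ (2 * \<nu>)"
    proof -
      have "exp (- Re \<kappa> * r) = exp (- (Re \<kappa> / 2) * r) * exp (- (Re \<kappa> / 2) * r)"
        by (simp flip: exp_add)
      then show ?thesis by (simp only: mult_ac)
    qed
    also have "\<dots> \<le> Cw * exp (- (Re \<kappa> / 2) * r) * K / r ^ (2 * \<nu>)"
      using r Cw K(2)[of r] by (intro divide_right_mono mult_left_mono) auto
    finally show "norm (profile \<nu> \<kappa> r) \<le> (Cw * K) * (exp (- (Re \<kappa> / 2) * r) / r ^ (2 * \<nu>))"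
      by (simp add: mult_ac)

    define y where "y = 1 + 2 * norm \<kappa> * r"
    have y: "y \<ge> 1" "norm \<kappa> * r \<le> y" using r by (auto simp: y_def)
    have y2: "y \<le> y\<^sup>2" using y(1) by (simp add: power2_eq_square)
    have nz: "norm (\<kappa> * of_real r) = norm \<kappa> * r" using r by (simp add: norm_mult)
    have W01: "norm (W 0 r) \<le> Cw * y ^ \<nu>" "norm (W 1 r) \<le> Cw * y ^ \<nu>"
      using W_bound[OF r] by (auto simp: y_def)
    have Cy: "Cw * y ^ \<nu> \<ge> 0" using Cw y by simp
    have t1: "norm ((\<kappa> * of_real r)\<^sup>2 * W 0 r) \<le> y\<^sup>2 * (Cw * y ^ \<nu>)"
      unfolding norm_mult norm_power nz[unfolded norm_mult] using r y
      by (intro mult_mono power_mono W01 zero_le_power) auto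
    have t2: "norm ((2 * of_nat \<nu> + \<kappa> * of_real r) * W 0 r) \<le> ((2 * real \<nu> + 1) * y\<^sup>2) * (Cw * y ^ \<nu>)"
    proof -
      have "norm (2 * of_nat \<nu> + \<kappa> * of_real r) \<le> norm (2 * of_nat \<nu> :: complex) + norm (\<kappa> * of_real r)"
        by (rule norm_triangle_ineq)
      also have "\<dots> \<le> 2 * real \<nu> * y\<^sup>2 + y\<^sup>2"
        unfolding nz using y y2 by (intro add_mono) (auto simp: norm_mult mult_le_cancel_left1)
      finally have "norm (2 * of_nat \<nu> + \<kappa> * of_real r) \<le> (2 * real \<nu> + 1) * y\<^sup>2" by (simp add: algebra_simps)
      then show ?thesis unfolding norm_mult[of "2 * of_nat \<nu> + \<kappa> * of_real r"] using y
        by (intro mult_mono W01) auto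
    qed
    have t3: "norm ((2 * of_nat \<nu> - 1) * (\<kappa> * of_real r) * W 1 r) \<le> ((2 * real \<nu> + 1) * y\<^sup>2) * (Cw * y ^ \<nu>)"
    proof -
      have "norm (2 * of_nat \<nu> - 1 :: complex) \<le> norm (2 * of_nat \<nu> :: complex) + norm (1 :: complex)"
        by (rule norm_triangle_ineq4)
      then have "norm (2 * of_nat \<nu> - 1 :: complex) \<le> 2 * real \<nu> + 1" by (simp add: norm_mult)
      then have "norm (2 * of_nat \<nu> - 1 :: complex) * norm (\<kappa> * of_real r) \<le> (2 * real \<nu> + 1) * y\<^sup>2"
        unfolding nz using r y y2 by (intro mult_mono) auto
      then have "norm ((2 * of_nat \<nu> - 1) * (\<kappa> * of_real r)) \<le> (2 * real \<nu> + 1) * y\<^sup>2"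
        by (simp only: norm_mult)
      then show ?thesis unfolding norm_mult[of "(2 * of_nat \<nu> - 1) * (\<kappa> * of_real r)"] using y
        by (intro mult_mono W01) auto
    qed
    have "norm (T r) \<le> norm ((\<kappa> * of_real r)\<^sup>2 * W 0 r) + real m * (norm ((2 * of_nat \<nu> + \<kappa> * of_real r) * W 0 r)
       + norm ((2 * of_nat \<nu> - 1) * (\<kappa> * of_real r) * W 1 r))"
      unfolding T_def
    proof (intro order_trans[OF norm_triangle_ineq] add_mono order_refl)
      have "norm (of_nat m * ((2 * of_nat \<nu> + \<kappa> * of_real r) * W 0 r - (2 * of_nat \<nu> - 1) * (\<kappa> * of_real r) * W 1 r))
        = real m * norm ((2 * of_nat \<nu> + \<kappa> * of_real r) * W 0 r - (2 * of_nat \<nu> - 1) * (\<kappa> * of_real r) * W 1 r)"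
        by (simp only: norm_mult[of "of_nat m"] norm_of_nat)
      then show "norm (of_nat m * ((2 * of_nat \<nu> + \<kappa> * of_real r) * W 0 r - (2 * of_nat \<nu> - 1) * (\<kappa> * of_real r) * W 1 r))
        \<le> real m * (norm ((2 * of_nat \<nu> + \<kappa> * of_real r) * W 0 r) + norm ((2 * of_nat \<nu> - 1) * (\<kappa> * of_real r) * W 1 r))"
        by (simp only:) (intro mult_left_mono norm_triangle_ineq4, simp)
    qed
    also have "\<dots> \<le> y\<^sup>2 * (Cw * y ^ \<nu>) + real m * (((2 * real \<nu> + 1) * y\<^sup>2) * (Cw * y ^ \<nu>) + ((2 * real \<nu> + 1) * y\<^sup>2) * (Cw * y ^ \<nu>))"
      by (intro add_mono mult_left_mono t1 t2 t3) auto
    also have "\<dots> = (1 + 2 * real m * (2 * real \<nu> + 1)) * Cw * y ^ (\<nu> + 2)"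
      by (simp add: power_add power2_eq_square algebra_simps)
    finally have T_bound: "norm (T r) \<le> (1 + 2 * real m * (2 * real \<nu> + 1)) * Cw * y ^ (\<nu> + 2)" .
    have "norm (exp (- (\<kappa> * of_real r)) * T r) = exp (- Re \<kappa> * r) * norm (T r)"
      by (simp add: norm_mult)
    also have "\<dots> \<le> exp (- Re \<kappa> * r) * ((1 + 2 * real m * (2 * real \<nu> + 1)) * Cw * y ^ (\<nu> + 2))"
      by (intro mult_left_mono T_bound) auto
    also have "\<dots> = (1 + 2 * real m * (2 * real \<nu> + 1)) * Cw * (y ^ (\<nu> + 2) * exp (- Re \<kappa> * r))"
      by (simp only: mult_ac)
    also have "\<dots> \<le> (1 + 2 * real m * (2 * real \<nu> + 1)) * Cw * K2"
      unfolding y_def using Cw r by (intro mult_left_mono K2) auto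
    finally show "norm (of_real (r ^ (2 * Suc \<nu>)) * (\<kappa>\<^sup>2 * profile \<nu> \<kappa> r - of_nat (2 * Suc \<nu>) * profile1 \<nu> \<kappa> r))
       \<le> (1 + 2 * real m * (2 * real \<nu> + 1)) * Cw * K2"
      unfolding H_eq[OF r] .
  next
    have W0: "(W 0 \<longlongrightarrow> of_real (sqrt pi * Gamma (2 * real \<nu>))) (at_right 0)"
      unfolding W_def[abs_def] by (rule whittaker_tendsto_0[OF \<nu> \<kappa>])
    have z0: "((\<lambda>r. \<kappa> * complex_of_real r) \<longlongrightarrow> 0) (at_right 0)"
      using tendsto_mult[OF tendsto_const[of \<kappa>] tendsto_of_real[OF tendsto_ident_at[of 0 "{0<..}"]]] by simp
    have W1: "((\<lambda>r. \<kappa> * of_real r * W 1 r) \<longlongrightarrow> 0) (at_right 0)"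
    proof (rule Lim_null_comparison)
      show "\<forall>\<^sub>F r in at_right 0. norm (\<kappa> * of_real r * W 1 r) \<le> norm \<kappa> * r * (Cw * (1 + 2 * norm \<kappa> * r) ^ \<nu>)"
      proof (rule eventually_at_right_less[THEN eventually_mono])
        fix r :: real assume r: "0 < r"
        show "norm (\<kappa> * of_real r * W 1 r) \<le> norm \<kappa> * r * (Cw * (1 + 2 * norm \<kappa> * r) ^ \<nu>)"
          using W_bound[OF r, of 1] r by (simp add: norm_mult mult_left_mono)
      qed
      have "((\<lambda>r. norm \<kappa> * r * (Cw * (1 + 2 * norm \<kappa> * r) ^ \<nu>)) \<longlongrightarrow> norm \<kappa> * 0 * (Cw * (1 + 2 * norm \<kappa> * 0) ^ \<nu>)) (at_right 0)"
        by (intro tendsto_intros)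
      then show "((\<lambda>r. norm \<kappa> * r * (Cw * (1 + 2 * norm \<kappa> * r) ^ \<nu>)) \<longlongrightarrow> 0) (at_right 0)" by simp
    qed
    have "((\<lambda>r. exp (- (\<kappa> * of_real r)) * ((\<kappa> * of_real r)\<^sup>2 * W 0 r + of_nat m * ((2 * of_nat \<nu> + \<kappa> * of_real r) * W 0 r
     - (2 * of_nat \<nu> - 1) * (\<kappa> * of_real r * W 1 r))))
      \<longlongrightarrow> exp (- 0) * (0\<^sup>2 * of_real (sqrt pi * Gamma (2 * real \<nu>)) + of_nat m * ((2 * of_nat \<nu> + 0) * of_real (sqrt pi * Gamma (2 * real \<nu>))
     - (2 * of_nat \<nu> - 1) * 0))) (at_right 0)"
      by (intro tendsto_intros W0 W1 z0)
    then have lim: "((\<lambda>r. exp (- (\<kappa> * of_real r)) * T r) \<longlongrightarrow> of_nat m * (2 * of_nat \<nu>) * of_real (sqrt pi * Gamma (2 * real \<nu>))) (at_right 0)"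
      by (simp add: T_def mult.assoc)
    show "((\<lambda>r. of_real (r ^ (2 * Suc \<nu>)) * (\<kappa>\<^sup>2 * profile \<nu> \<kappa> r - of_nat (2 * Suc \<nu>) * profile1 \<nu> \<kappa> r))
      \<longlongrightarrow> of_nat (2 * Suc \<nu>) * (2 * of_nat \<nu>) * of_real (sqrt pi * Gamma (2 * real \<nu>))) (at_right 0)"
      using lim unfolding m_def
      by (rule Lim_transform_eventually) (rule eventually_at_right_less[THEN eventually_mono], rule H_eq[symmetric])
  qed
qed

text \<open>The factor of \<open>C_coeff m j\<close> common to all \<open>j\<close>. It is also the
  prefactor of the Whittaker formula, divided by 2^(\<nu> - 1/2) because t/2 + z is replaced by t +
  2z, and by sqrt pi because S(w) replaces w^(-1/2).\<close>

definition whittaker_const :: "nat \<Rightarrow> real" where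
  "whittaker_const m = inverse (2 ^ (m - 1) * pi powr (real m / 2) * Gamma ((real m - 1) / 2))"

text \<open>Legendre duplication splits sqrt pi Gamma(2\<nu>) into 2^(2\<nu> - 1) Gamma(\<nu>)
  Gamma(\<nu> + 1/2). The second Gamma factor cancels Gamma((m - 1)/2); the first, with \<nu> (\<nu>
  + 1), cancels the Gamma(\<nu> + 2) in the volume of the unit ball.\<close>

lemma whittaker_const_normalization:
  assumes \<nu>: "\<nu> \<ge> 1"
  shows "whittaker_const (2 * Suc \<nu>) * (real (2 * Suc \<nu>) * (2 * real \<nu>) * (sqrt pi * Gamma (2 * real \<nu>)) * unit_ball_vol (2 * Suc \<nu>)) = 1"
proof -
  have n1: "complex_of_nat \<nu> \<notin> \<int>\<^sub>\<le>\<^sub>0" using \<nu> by (auto elim!: nonpos_Ints_cases' simp: complex_eq_iff)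
  have n2: "complex_of_nat \<nu> + 1/2 \<notin> \<int>\<^sub>\<le>\<^sub>0" by (auto elim!: nonpos_Ints_cases' simp: complex_eq_iff)
  have "complex_of_real (Gamma (real \<nu>) * Gamma (real \<nu> + 1/2)) =
     of_real (exp ((1 - 2 * real \<nu>) * ln 2) * sqrt pi * Gamma (2 * real \<nu>))"
    using Gamma_legendre_duplication[OF n1 n2]
    by (simp flip: Gamma_complex_of_real exp_of_real)
  then have leg: "Gamma (real \<nu>) * Gamma (real \<nu> + 1/2) = exp ((1 - 2 * real \<nu>) * ln 2) * sqrt pi * Gamma (2 * real \<nu>)"
    by (simp only: of_real_eq_iff)
  have "exp ((1 - 2 * real \<nu>) * ln 2) = 2 powr (1 - real (2 * \<nu>))" by (simp add: powr_def)
  also have "\<dots> = 2 / 2 ^ (2 * \<nu>)" by (simp only: powr_diff powr_realpow powr_one zero_less_numeral)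
  finally have leg2: "sqrt pi * Gamma (2 * real \<nu>) = Gamma (real \<nu>) * Gamma (real \<nu> + 1/2) * 2 ^ (2 * \<nu>) / 2"
    using leg by (simp add: field_simps)
  have G: "Gamma (real (2 * Suc \<nu>) / 2 + 1) = (real \<nu> + 1) * (real \<nu> * Gamma (real \<nu>))"
  proof -
    have eq: "real (2 * Suc \<nu>) / 2 + 1 = real \<nu> + 1 + 1" by (simp add: field_simps)
    have "Gamma (real \<nu> + 1 + 1) = (real \<nu> + 1) * Gamma (real \<nu> + 1)"
      by (rule Gamma_plus1) (use \<nu> in \<open>auto elim!: nonpos_Ints_cases'\<close>)
    also have "Gamma (real \<nu> + 1) = real \<nu> * Gamma (real \<nu>)"
      by (rule Gamma_plus1) (use \<nu> in \<open>auto elim!: nonpos_Ints_cases'\<close>)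
    finally show ?thesis unfolding eq .
  qed
  have pos: "Gamma (real \<nu>) > 0" "Gamma (real \<nu> + 1/2) > 0" using \<nu> by (auto intro!: Gamma_real_pos)
  have h: "(real (2 * Suc \<nu>) - 1) / 2 = real \<nu> + 1/2" by (simp add: field_simps)
  have p: "pi powr (real (2 * Suc \<nu>) / 2) > 0" by simp
  define P G1 G2 D where "P = pi powr (real (2 * Suc \<nu>) / 2)" and "G1 = Gamma (real \<nu>)" and "G2 = Gamma (real \<nu> + 1/2)" and "D = (2::real) ^ (2 * \<nu>)"
  have "2 ^ (2 * Suc \<nu> - 1) = 2 * D" by (simp add: D_def)
  then have "whittaker_const (2 * Suc \<nu>) * (real (2 * Suc \<nu>) * (2 * real \<nu>) * (sqrt pi * Gamma (2 * real \<nu>)) * unit_ball_vol (2 * Suc \<nu>))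
    = inverse (2 * D * P * G2) * ((2 * (real \<nu> + 1)) * (2 * real \<nu>) * (G1 * G2 * D / 2) * (P / ((real \<nu> + 1) * (real \<nu> * G1))))"
    unfolding whittaker_const_def h leg2 unit_ball_vol_def G[unfolded of_nat_mult] P_def G1_def G2_def D_def
    using G by simp
  also have "\<dots> = 1"
  proof -
    have "G1 \<noteq> 0" "G2 \<noteq> 0"
      using pos[THEN less_imp_neq, symmetric] unfolding G1_def G2_def by blast+
    moreover have "P \<noteq> 0" "D \<noteq> 0" "real \<nu> \<noteq> 0" "real \<nu> + 1 \<noteq> 0"
      using p \<nu> by (auto simp: P_def D_def)
    ultimately show ?thesis by (simp add: divide_simps)
  qed
  finally show ?thesis .
qed

lemma profile_fundamental:
  fixes \<phi> :: "'a::euclidean_space \<Rightarrow> complex"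
  assumes dim: "DIM('a) = 2 * Suc \<nu>" and \<nu>: "\<nu> \<ge> 1" and \<kappa>: "Re \<kappa> > 0" and \<phi>: "test_function \<phi>"
  shows "(LINT y|lborel. of_real (whittaker_const (2 * Suc \<nu>)) * profile \<nu> \<kappa> (norm y) * (\<kappa>\<^sup>2 * \<phi> y - laplacian \<phi> y)) = \<phi> 0"
proof -
  obtain C B where
    b: "\<And>r. r > 0 \<Longrightarrow> norm (profile \<nu> \<kappa> r) \<le> C * (exp (- (Re \<kappa> / 2) * r) / r ^ (2 * \<nu>))"
    "\<And>r. r > 0 \<Longrightarrow> norm (of_real (r ^ (2 * Suc \<nu>)) * (\<kappa>\<^sup>2 * profile \<nu> \<kappa> r - of_nat (2 * Suc \<nu>) * profile1 \<nu> \<kappa> r)) \<le> B"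
    "((\<lambda>r. of_real (r ^ (2 * Suc \<nu>)) * (\<kappa>\<^sup>2 * profile \<nu> \<kappa> r - of_nat (2 * Suc \<nu>) * profile1 \<nu> \<kappa> r))
      \<longlongrightarrow> of_nat (2 * Suc \<nu>) * (2 * of_nat \<nu>) * of_real (sqrt pi * Gamma (2 * real \<nu>))) (at_right 0)"
    using profile_bounds[OF \<nu> \<kappa>] by blast
  have "(LINT y|lborel. profile \<nu> \<kappa> (norm y) * (\<kappa>\<^sup>2 * \<phi> y - laplacian \<phi> y)) =
    of_nat (2 * Suc \<nu>) * (2 * of_nat \<nu>) * complex_of_real (sqrt pi * Gamma (2 * real \<nu>)) * complex_of_real (unit_ball_vol (real (2 * Suc \<nu>))) * \<phi> 0"
    by (rule fundamental_solution[OF dim _ profile_deriv[OF _ \<kappa>] profile1_deriv[OF _ \<kappa>] b(1) _ b(2,3) \<phi>])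
       (use \<kappa> in auto)
  then have "(LINT y|lborel. of_real (whittaker_const (2 * Suc \<nu>)) * profile \<nu> \<kappa> (norm y) * (\<kappa>\<^sup>2 * \<phi> y - laplacian \<phi> y)) =
    of_real (whittaker_const (2 * Suc \<nu>)) * (of_nat (2 * Suc \<nu>) * (2 * of_nat \<nu>) * complex_of_real (sqrt pi * Gamma (2 * real \<nu>)) * complex_of_real (unit_ball_vol (real (2 * Suc \<nu>))) * \<phi> 0)"
    by (simp only: mult.assoc integral_mult_right_zero)
  also have "\<dots> = of_real (whittaker_const (2 * Suc \<nu>) * (real (2 * Suc \<nu>) * (2 * real \<nu>) * (sqrt pi * Gamma (2 * real \<nu>)) * unit_ball_vol (2 * Suc \<nu>))) * \<phi> 0"
    by (simp only: of_real_mult of_real_of_nat_eq of_real_numeral mult.assoc)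
  also have "\<dots> = \<phi> 0" unfolding whittaker_const_normalization[OF \<nu>] by simp
  finally show ?thesis .
qed

lemma resolvent_kernel_eq_profile:
  fixes K :: "'a::euclidean_space \<Rightarrow> complex"
  assumes dim: "DIM('a) = 2 * Suc \<nu>" and \<nu>: "\<nu> \<ge> 1" and \<mu>: "Im \<mu> > 0"
    and K: "continuous_on (- {0}) K" "is_convolution_kernel (is_resolvent \<mu>) K"
    and x: "x \<noteq> 0"
  shows "K x = of_real (whittaker_const (2 * Suc \<nu>)) * profile \<nu> (- \<i> * \<mu>) (norm x)"
proof -
  define \<kappa> where "\<kappa> = - \<i> * \<mu>"
  have \<kappa>: "Re \<kappa> > 0" "- \<mu>\<^sup>2 = \<kappa>\<^sup>2" using \<mu> by (auto simp: \<kappa>_def power_mult_distrib)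
  define E where "E y = of_real (whittaker_const (2 * Suc \<nu>)) * profile \<nu> \<kappa> (norm y)" for y :: 'a
  have "continuous_on {0<..} (profile \<nu> \<kappa>)"
    using profile_deriv[OF _ \<kappa>(1)] by (force intro: continuous_at_imp_continuous_on has_vector_derivative_continuous)
  then have "continuous_on (- {0}) (\<lambda>y::'a. profile \<nu> \<kappa> (norm y))"
    by (rule continuous_on_compose2) (auto intro!: continuous_intros)
  then have cont: "continuous_on (- {0}) E" unfolding E_def by (intro continuous_intros)
  obtain C where C: "\<And>r. r > 0 \<Longrightarrow> norm (profile \<nu> \<kappa> r) \<le> C * (exp (- (Re \<kappa> / 2) * r) / r ^ (2 * \<nu>))"
  proof (rule profile_bounds[OF \<nu> \<kappa>(1)])
    fix C B :: real
    assume "\<And>r. r > 0 \<Longrightarrow> norm (profile \<nu> \<kappa> r) \<le> C * (exp (- (Re \<kappa> / 2) * r) / r ^ (2 * \<nu>))"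
    then show thesis by (rule that)
  qed
  have int: "integrable lborel E"
  proof (rule Bochner_Integration.integrable_bound)
    show "integrable lborel (\<lambda>y::'a. \<bar>whittaker_const (2 * Suc \<nu>)\<bar> * (C * (exp (- (Re \<kappa> / 2) * norm y) / norm y ^ (2 * \<nu>))))"
      by (intro integrable_mult_right integrable_exp_div_norm_power) (use dim \<kappa> in auto)
    show "E \<in> borel_measurable lborel" using borel_measurable_continuous_off_0[OF cont] by simp
    have "AE y in lborel. y \<noteq> (0::'a)" by (rule AE_lborel_singleton)
    then show "AE y in lborel. norm (E y) \<le> norm (\<bar>whittaker_const (2 * Suc \<nu>)\<bar> * (C * (exp (- (Re \<kappa> / 2) * norm y) / norm y ^ (2 * \<nu>))))"
    proof eventually_elim
      case (elim y)
      then have "norm (E y) \<le> \<bar>whittaker_const (2 * Suc \<nu>)\<bar> * (C * (exp (- (Re \<kappa> / 2) * norm y) / norm y ^ (2 * \<nu>)))"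
        unfolding E_def norm_mult norm_of_real by (intro mult_left_mono C) auto
      then show ?case unfolding real_norm_def by linarith
    qed
  qed
  have fund: "(LINT y|lborel. E y * (- \<mu>\<^sup>2 * \<phi> y - laplacian \<phi> y)) = \<phi> 0" if "test_function \<phi>" for \<phi>
    unfolding E_def \<kappa>(2) by (rule profile_fundamental[OF dim \<nu> \<kappa>(1) that])
  show ?thesis
    using resolvent_kernel_unique[OF int cont fund K x] by (simp add: E_def \<kappa>_def)
qed

section \<open>The superposition formula\<close>

interpretation half_line: sigma_finite_measure half_line
  by (rule sigma_finite_measure_restrict_space[OF sigma_finite_lborel]) simp

interpretation half_line_pair: pair_sigma_finite half_line half_line ..

lemma space_half_line: "t \<in> space half_line \<longleftrightarrow> t > 0"
  by (simp add: space_restrict_space)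

lemma Gamma_powr_eq_integral:
  assumes "q > 0" "a > 0"
  shows "Gamma q * (1 + a) powr - q = (LINT t|half_line. t powr (q - 1) * exp (- (1 + a) * t))"
  using assms by (subst integral_powr_exp) auto

text \<open>This explains the exponent 2\<nu> - j + 1/2 in \<open>T_op\<close>: its Gamma integral
  contributes t^(\<nu> - 1/2) t^(\<nu> - j), and the powers t^(\<nu> - j) are those of the expansion
  of (t + 2z)^\<nu>.\<close>

lemma sum_binomial_powr:
  fixes z :: complex
  assumes t: "t > 0"
  shows "(\<Sum>j=0..\<nu>. of_nat (\<nu> choose j) * (2 * z) ^ j * of_real (t powr (2 * real \<nu> - real j + 1/2 - 1))) =
    of_real (t powr (real \<nu> - 1/2)) * (of_real t + 2 * z) ^ \<nu>"
proof -
  have "t powr (2 * real \<nu> - real j + 1/2 - 1) = t powr (real \<nu> - 1/2) * t ^ (\<nu> - j)" if "j \<le> \<nu>" for j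
  proof -
    have "t powr (2 * real \<nu> - real j + 1/2 - 1) = t powr ((real \<nu> - 1/2) + real (\<nu> - j))"
      using that by (intro arg_cong[where f="\<lambda>q. t powr q"]) (simp add: of_nat_diff)
    then show ?thesis using t by (simp only: powr_add powr_realpow)
  qed
  then have "(\<Sum>j=0..\<nu>. of_nat (\<nu> choose j) * (2 * z) ^ j * of_real (t powr (2 * real \<nu> - real j + 1/2 - 1))) =
    (\<Sum>j=0..\<nu>. of_real (t powr (real \<nu> - 1/2)) * (of_nat (\<nu> choose j) * (2 * z) ^ j * of_real t ^ (\<nu> - j)))"
    by (intro sum.cong) (auto simp: mult_ac)
  also have "\<dots> = of_real (t powr (real \<nu> - 1/2)) * (2 * z + of_real t) ^ \<nu>"
    by (simp only: binomial_ring[of "2 * z"] sum_distrib_left atLeast0AtMost)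
  finally show ?thesis by (simp only: add.commute)
qed

text \<open>One double integral computed in two orders. Integrating \<open>k\<close> first in
  \<open>t\<close> gives the superposition; integrating first in \<open>a\<close> gives S(t + 2z),
  because e^(-(1 + a) t) e^(-2za) = e^(-t) e^(-(t + 2z) a).\<close>

lemma whittaker_eq_superposition:
  assumes z: "Re z > 0"
  shows "whittaker \<nu> 0 z = (\<Sum>j=0..\<nu>. of_real (Gamma (2 * real \<nu> - real j + 1/2) * real (\<nu> choose j)) * (2 * z) ^ j *
    (LINT a|half_line. of_real ((1 + a) powr - (2 * real \<nu> - real j + 1/2)) * (exp (- (2 * z) * of_real a) / of_real (sqrt a))))"
proof -
  define q where "q j = 2 * real \<nu> - real j + 1/2" for j
  define k where "k a t = (exp (- (2 * z) * of_real a) / of_real (sqrt a)) * (of_real (exp (- (1 + a) * t)) *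
     (of_real (t powr (real \<nu> - 1/2)) * (of_real t + 2 * z) ^ \<nu>))" for a t :: real
  define c where "c j = complex_of_nat (\<nu> choose j) * (2 * z) ^ j" for j
  have q_pos: "q j > 0" if "j \<le> \<nu>" for j using that by (simp add: q_def)
  have Re2z: "Re (2 * z) > 0" using z by simp
  have int_j: "integrable half_line (\<lambda>a. of_real ((1 + a) powr - q j) * (exp (- (2 * z) * of_real a) / of_real (sqrt a)))"
    if "j \<le> \<nu>" for j
  proof (rule Bochner_Integration.integrable_bound[OF integrable_laplace_inv_sqrt[OF Re2z]])
    show "(\<lambda>a. of_real ((1 + a) powr - q j) * (exp (- (2 * z) * of_real a) / of_real (sqrt a))) \<in> borel_measurable half_line"
      by (intro measurable_restrict_space1) simp
    show "AE a in half_line. norm (of_real ((1 + a) powr - q j) * (exp (- (2 * z) * of_real a) / of_real (sqrt a)))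
       \<le> norm (exp (- (2 * z) * of_real a) / of_real (sqrt a))"
    proof (rule AE_I2)
      fix a assume "a \<in> space half_line"
      then have "(1 + a) powr - q j \<le> 1" using q_pos[OF that]
        by (simp add: space_half_line powr_minus inverse_le_1_iff ge_one_powr_ge_zero)
      then show "norm (of_real ((1 + a) powr - q j) * (exp (- (2 * z) * of_real a) / of_real (sqrt a)))
        \<le> norm (exp (- (2 * z) * of_real a) / of_real (sqrt a))"
        unfolding norm_mult by (intro mult_left_le_one_le) auto
    qed
  qed
  have inner: "(LINT t|half_line. k a t) =
      (\<Sum>j=0..\<nu>. of_real (Gamma (q j) * real (\<nu> choose j)) * (2 * z) ^ j *
         (of_real ((1 + a) powr - q j) * (exp (- (2 * z) * of_real a) / of_real (sqrt a))))" if a: "a > 0" for a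
  proof -
    define E where "E = exp (- (2 * z) * of_real a) / of_real (sqrt a)"
    have int_t: "integrable half_line (\<lambda>t. complex_of_real (t powr (q j - 1) * exp (- (1 + a) * t)))" if "j \<le> \<nu>" for j
      by (intro integrable_of_real integrable_powr_exp) (use q_pos[OF that] a in auto)
    have "(LINT t|half_line. k a t) = (LINT t|half_line. E * (\<Sum>j=0..\<nu>. c j * of_real (t powr (q j - 1) * exp (- (1 + a) * t))))"
    proof (rule Bochner_Integration.integral_cong)
      fix t assume "t \<in> space half_line"
      then have t: "t > 0" by (simp add: space_half_line)
      show "k a t = E * (\<Sum>j=0..\<nu>. c j * of_real (t powr (q j - 1) * exp (- (1 + a) * t)))"
        unfolding k_def sum_binomial_powr[OF t, symmetric] sum_distrib_left E_def c_def q_def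
        by (intro sum.cong refl) (simp only: of_real_mult mult_ac)
    qed simp
    also have "\<dots> = E * (\<Sum>j=0..\<nu>. c j * (LINT t|half_line. complex_of_real (t powr (q j - 1) * exp (- (1 + a) * t))))"
      unfolding integral_mult_right_zero using int_t
      by (subst Bochner_Integration.integral_sum) (auto simp: integral_mult_right_zero intro!: integrable_mult_right)
    also have "\<dots> = E * (\<Sum>j=0..\<nu>. c j * of_real (Gamma (q j) * (1 + a) powr - q j))"
      using q_pos a by (intro arg_cong2[where f="(*)"] sum.cong refl)
        (simp_all only: integral_complex_of_real Gamma_powr_eq_integral atLeastAtMost_iff)
    also have "\<dots> = (\<Sum>j=0..\<nu>. of_real (Gamma (q j) * real (\<nu> choose j)) * (2 * z) ^ j *
         (of_real ((1 + a) powr - q j) * E))"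
      unfolding sum_distrib_left c_def by (intro sum.cong refl) (simp only: of_real_mult of_real_of_nat_eq mult_ac)
    finally show ?thesis unfolding E_def .
  qed
  have regroup: "(Y / s) * (X * (P * W)) = (P * X' * W) * (Y' / s)" if "X * Y = X' * Y'" for X Y X' Y' P W s :: complex
  proof -
    have "(Y / s) * (X * (P * W)) = (X * Y) * (P * W) / s" by (simp add: mult_ac)
    also have "\<dots> = (P * X' * W) * (Y' / s)" unfolding that by (simp add: mult_ac)
    finally show ?thesis .
  qed
  have outer: "(LINT a|half_line. k a t) = whittaker_integrand \<nu> 0 z t" if t: "t > 0" for t
  proof -
    have "(LINT a|half_line. k a t) = (LINT a|half_line. (of_real (t powr (real \<nu> - 1/2) * exp (- t)) * (of_real t + 2 * z) ^ \<nu>) *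
        (exp (- (of_real t + 2 * z) * of_real a) / of_real (sqrt a)))"
    proof (rule Bochner_Integration.integral_cong)
      fix a
      have "complex_of_real (exp (- (1 + a) * t)) * exp (- (2 * z) * of_real a) =
          of_real (exp (- t)) * exp (- (of_real t + 2 * z) * of_real a)"
        unfolding exp_of_real[symmetric] exp_add[symmetric]
        by (rule arg_cong[where f=exp]) (simp add: algebra_simps)
      then show "k a t = (of_real (t powr (real \<nu> - 1/2) * exp (- t)) * (of_real t + 2 * z) ^ \<nu>) *
        (exp (- (of_real t + 2 * z) * of_real a) / of_real (sqrt a))"
        unfolding k_def of_real_mult by (rule regroup)
    qed simp
    also have "\<dots> = (of_real (t powr (real \<nu> - 1/2) * exp (- t)) * (of_real t + 2 * z) ^ \<nu>) * laplace_inv_sqrt (of_real t + 2 * z)"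
      unfolding laplace_inv_sqrt_def by (rule integral_mult_right_zero)
    finally show ?thesis by (simp add: whittaker_integrand_def kern_power_def)
  qed
  have meas: "case_prod k \<in> borel_measurable (half_line \<Otimes>\<^sub>M half_line)"
  proof -
    have id: "(\<lambda>a. a) \<in> borel_measurable half_line" by (intro measurable_restrict_space1) simp
    have [measurable]: "fst \<in> borel_measurable (half_line \<Otimes>\<^sub>M half_line)" "snd \<in> borel_measurable (half_line \<Otimes>\<^sub>M half_line)"
      by (rule measurable_compose[OF measurable_fst id], rule measurable_compose[OF measurable_snd id])
    show ?thesis unfolding k_def case_prod_beta by measurable
  qed
  \<comment> \<open>Since e^(-at) \<le> 1, |k| is bounded by a product of a function of
    \<open>a\<close> and a function of \<open>t\<close>, each integrable. In \<open>a\<close> the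
    decay comes from Re z > 0, in \<open>t\<close> from e^(-t).\<close>
  define D where "D t = t powr (real \<nu> + 1/2 - 1) * exp (- t) * (t + 2 * norm z) ^ \<nu>" for t
  have int_D: "integrable half_line D" unfolding D_def by (intro integrable_powr_exp_shift) auto
  have k_bound: "norm (k a t) \<le> norm (exp (- (2 * z) * of_real a) / of_real (sqrt a)) * D t" if "a > 0" "t > 0" for a t
  proof -
    have "norm (of_real t + 2 * z) \<le> norm (complex_of_real t) + norm (2 * z)" by (rule norm_triangle_ineq)
    then have "norm (of_real t + 2 * z) ^ \<nu> \<le> (t + 2 * norm z) ^ \<nu>"
      using that by (intro power_mono) (auto simp: norm_mult)
    moreover have "exp (- (1 + a) * t) \<le> exp (- t)" using that by (simp add: left_diff_distrib)
    ultimately have "exp (- (1 + a) * t) * (t powr (real \<nu> - 1/2) * norm (of_real t + 2 * z) ^ \<nu>) \<le>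
       exp (- t) * (t powr (real \<nu> - 1/2) * (t + 2 * norm z) ^ \<nu>)"
      by (intro mult_mono mult_nonneg_nonneg) auto
    also have "\<dots> = D t" by (simp add: D_def mult_ac)
    finally have "norm (complex_of_real (exp (- (1 + a) * t)) * (of_real (t powr (real \<nu> - 1/2)) * (of_real t + 2 * z) ^ \<nu>)) \<le> D t"
      unfolding norm_mult norm_power norm_of_real by simp
    then show ?thesis unfolding k_def norm_mult[of "exp (- (2 * z) * of_real a) / of_real (sqrt a)"]
      by (rule mult_left_mono) simp
  qed
  have k_int: "integrable half_line (k a)" if a: "a > 0" for a
  proof (rule Bochner_Integration.integrable_bound)
    show "integrable half_line (\<lambda>t. norm (exp (- (2 * z) * of_real a) / of_real (sqrt a)) * D t)"
      by (intro integrable_mult_right int_D)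
    show "k a \<in> borel_measurable half_line" unfolding k_def by (intro measurable_restrict_space1) simp
    show "AE t in half_line. norm (k a t) \<le> norm (norm (exp (- (2 * z) * of_real a) / of_real (sqrt a)) * D t)"
      using k_bound[OF a] by (intro AE_I2) (auto simp: space_half_line intro: order_trans[OF _ abs_ge_self])
  qed
  have int: "integrable (half_line \<Otimes>\<^sub>M half_line) (case_prod k)"
  proof (rule half_line_pair.Fubini_integrable[OF meas])
    show "AE a in half_line. integrable half_line (\<lambda>t. case_prod k (a, t))"
      using k_int by (intro AE_I2) (auto simp: space_half_line)
    show "integrable half_line (\<lambda>a. LINT t|half_line. norm (case_prod k (a, t)))"
    proof (rule Bochner_Integration.integrable_bound)
      show "integrable half_line (\<lambda>a. norm (exp (- (2 * z) * of_real a) / of_real (sqrt a)) * (LINT t|half_line. D t))"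
        by (intro integrable_mult_left integrable_norm integrable_laplace_inv_sqrt Re2z)
      show "(\<lambda>a. LINT t|half_line. norm (case_prod k (a, t))) \<in> borel_measurable half_line"
      proof -
        have "(\<lambda>(a, t). norm (k a t)) \<in> borel_measurable (half_line \<Otimes>\<^sub>M half_line)"
          using measurable_compose[OF meas borel_measurable_norm] by (simp add: case_prod_beta')
        from half_line.borel_measurable_lebesgue_integral[OF this] show ?thesis by simp
      qed
      show "AE a in half_line. norm (LINT t|half_line. norm (case_prod k (a, t))) \<le>
         norm (norm (exp (- (2 * z) * of_real a) / of_real (sqrt a)) * (LINT t|half_line. D t))"
      proof (rule AE_I2)
        fix a assume "a \<in> space half_line"
        then have a: "a > 0" by (simp add: space_half_line)
        have "(LINT t|half_line. norm (k a t)) \<le> (LINT t|half_line. norm (exp (- (2 * z) * of_real a) / of_real (sqrt a)) * D t)"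
          by (intro integral_mono integrable_norm k_int a integrable_mult_right int_D k_bound) (auto simp: space_half_line)
        then have "(LINT t|half_line. norm (k a t)) \<le> norm (exp (- (2 * z) * of_real a) / of_real (sqrt a)) * (LINT t|half_line. D t)"
          by (simp only: integral_mult_right_zero)
        moreover have "0 \<le> (LINT t|half_line. norm (k a t))" by simp
        ultimately show "norm (LINT t|half_line. norm (case_prod k (a, t))) \<le>
         norm (norm (exp (- (2 * z) * of_real a) / of_real (sqrt a)) * (LINT t|half_line. D t))"
          unfolding case_prod_conv real_norm_def by linarith
      qed
    qed
  qed
  have "whittaker \<nu> 0 z = (LINT t|half_line. LINT a|half_line. k a t)"
    unfolding whittaker_def by (intro Bochner_Integration.integral_cong) (auto simp: outer space_half_line)
  also have "\<dots> = (LINT a|half_line. LINT t|half_line. k a t)"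
    by (rule half_line_pair.Fubini_integral[OF int])
  also have "\<dots> = (LINT a|half_line. (\<Sum>j=0..\<nu>. of_real (Gamma (q j) * real (\<nu> choose j)) * (2 * z) ^ j *
         (of_real ((1 + a) powr - q j) * (exp (- (2 * z) * of_real a) / of_real (sqrt a)))))"
    by (intro Bochner_Integration.integral_cong refl inner) (simp add: space_half_line)
  also have "\<dots> = (\<Sum>j=0..\<nu>. of_real (Gamma (q j) * real (\<nu> choose j)) * (2 * z) ^ j *
     (LINT a|half_line. of_real ((1 + a) powr - q j) * (exp (- (2 * z) * of_real a) / of_real (sqrt a))))"
    by (subst Bochner_Integration.integral_sum)
       (auto simp only: integral_mult_right_zero atLeastAtMost_iff intro!: integrable_mult_right int_j)
  finally show ?thesis unfolding q_def .
qed

section \<open>From the superposition formula to \<open>T_op\<close>, and the passage to real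
  spectral parameters\<close>

abbreviation (input) superposed :: "nat \<Rightarrow> complex \<Rightarrow> nat \<Rightarrow> 'a::real_normed_vector \<Rightarrow> real \<Rightarrow> complex" where
  "superposed m \<mu> j \<equiv> (\<lambda>x a. exp (\<i> * \<mu> * complex_of_real (norm x * (1 + 2 * a))) *
                (\<mu> * complex_of_real (norm x)) ^ j /
                complex_of_real (norm x ^ (m - 2)))"

lemma T_op_half_line:
  "T_op m j f x = C_coeff m j * (LINT a|half_line. of_real ((1 + a) powr - (2 * real (nu m) - real j + 1/2)) * f x a / of_real (sqrt a))"
  unfolding T_op_def integral_half_line ..

text \<open>With z = - i \<mu> r, the factor (-2i)^j of \<open>C_coeff\<close> combines with (\<mu>
  r)^j to (2z)^j, and the exponential over r (1 + 2a) splits into e^(-z) e^(-2za).\<close>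

lemma profile_eq_superposition:
  fixes x :: "'a::real_normed_vector"
  assumes m: "m = 2 * Suc \<nu>" and \<mu>: "Im \<mu> > 0" and x: "x \<noteq> 0"
  shows "(\<Sum>j=0..nu m. T_op m j (superposed m \<mu> j) x) =
    of_real (whittaker_const m) * profile \<nu> (- \<i> * \<mu>) (norm x)"
proof -
  define r where "r = norm x"
  have r: "r > 0" using x by (simp add: r_def)
  define z where "z = - \<i> * \<mu> * of_real r"
  have z: "Re z > 0" using \<mu> r by (simp add: z_def)
  have nu: "nu m = \<nu>" "m - 2 = 2 * \<nu>" by (simp_all add: m nu_def)
  have T: "T_op m j (superposed m \<mu> j) x = of_real (whittaker_const m) * exp (- z) / of_real r ^ (2 * \<nu>) *
     (of_real (Gamma (2 * real \<nu> - real j + 1/2) * real (\<nu> choose j)) * (2 * z) ^ j *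
    (LINT a|half_line. of_real ((1 + a) powr - (2 * real \<nu> - real j + 1/2)) * (exp (- (2 * z) * of_real a) / of_real (sqrt a))))" for j
  proof -
    let ?I = "LINT a|half_line. of_real ((1 + a) powr - (2 * real \<nu> - real j + 1/2)) * (exp (- (2 * z) * of_real a) / of_real (sqrt a))"
    have "(LINT a|half_line. of_real ((1 + a) powr - (2 * real \<nu> - real j + 1/2)) * superposed m \<mu> j x a / of_real (sqrt a)) =
      (LINT a|half_line. exp (- z) * (\<mu> * of_real r) ^ j / of_real r ^ (2 * \<nu>) *
         (of_real ((1 + a) powr - (2 * real \<nu> - real j + 1/2)) * (exp (- (2 * z) * of_real a) / of_real (sqrt a))))"
    proof (rule Bochner_Integration.integral_cong)
      fix a
      have "exp (\<i> * \<mu> * complex_of_real (norm x * (1 + 2 * a))) = exp (- z) * exp (- (2 * z) * of_real a)"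
        unfolding exp_add[symmetric] by (rule arg_cong[where f=exp]) (simp add: z_def r_def algebra_simps)
      then show "of_real ((1 + a) powr - (2 * real \<nu> - real j + 1/2)) * superposed m \<mu> j x a / of_real (sqrt a) =
        exp (- z) * (\<mu> * of_real r) ^ j / of_real r ^ (2 * \<nu>) *
         (of_real ((1 + a) powr - (2 * real \<nu> - real j + 1/2)) * (exp (- (2 * z) * of_real a) / of_real (sqrt a)))"
        unfolding nu(2) r_def[symmetric] of_real_power
        by (simp only: times_divide_eq_left times_divide_eq_right divide_divide_eq_left divide_divide_eq_right mult_ac)
    qed simp
    also have "\<dots> = exp (- z) * (\<mu> * of_real r) ^ j / of_real r ^ (2 * \<nu>) * ?I"
      by (rule integral_mult_right_zero)
    finally have "T_op m j (superposed m \<mu> j) x = C_coeff m j * (exp (- z) * (\<mu> * of_real r) ^ j / of_real r ^ (2 * \<nu>) * ?I)"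
      unfolding T_op_half_line nu(1) by (simp only:)
    moreover have "C_coeff m j = of_real (whittaker_const m) * of_real (Gamma (2 * real \<nu> - real j + 1/2) * real (\<nu> choose j)) * (- 2 * \<i>) ^ j"
      unfolding C_coeff_def whittaker_const_def nu(1) of_real_mult[symmetric] divide_inverse by (simp only: of_real_mult mult_ac)
    moreover have "(2 * z) ^ j = (- 2 * \<i>) ^ j * (\<mu> * of_real r) ^ j"
      unfolding power_mult_distrib[symmetric] by (rule arg_cong[where f="\<lambda>z. z ^ j"]) (simp add: z_def)
    ultimately show ?thesis
      by (simp only: times_divide_eq_left times_divide_eq_right mult_ac)
  qed
  show ?thesis
    unfolding T nu(1) sum_distrib_left[symmetric] whittaker_eq_superposition[OF z, symmetric]
    by (simp add: profile_def z_def r_def mult_ac)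
qed

text \<open>The antiderivative is 2 sqrt (a / (1 + a)), with limits 0 and 2. This is the majorant at
  real \<mu>, where the exponential gives no decay in \<open>a\<close>.\<close>

lemma integrable_powr_div_sqrt:
  "integrable half_line (\<lambda>a::real. (1 + a) powr - (3/2) / sqrt a)"
proof -
  have "set_integrable lborel (einterval 0 \<infinity>) (\<lambda>a::real. (1 + a) powr - (3/2) / sqrt a)"
  proof (rule interval_integral_FTC_nonneg(1))
    fix a assume "0 < ereal a"
    then have a: "a > 0" by simp
    have "((\<lambda>a. 2 * (sqrt a * inverse (sqrt (1 + a)))) has_real_derivative
       2 * (inverse (sqrt a) / 2 * inverse (sqrt (1 + a)) + - (inverse (sqrt (1 + a)) * (inverse (sqrt (1 + a)) / 2) * inverse (sqrt (1 + a))) * sqrt a)) (at a)"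
    proof -
      have 1: "(sqrt has_real_derivative inverse (sqrt a) / 2) (at a)" by (rule DERIV_real_sqrt[OF a])
      have "((\<lambda>a. 1 + a) has_real_derivative 1) (at a)" by (auto intro!: derivative_eq_intros)
      moreover have "(sqrt has_real_derivative inverse (sqrt (1 + a)) / 2) (at (1 + a))"
        by (rule DERIV_real_sqrt) (use a in simp)
      ultimately have 2: "((\<lambda>a. sqrt (1 + a)) has_real_derivative inverse (sqrt (1 + a)) / 2) (at a)"
        using DERIV_chain2 by fastforce
      show ?thesis
        by (rule DERIV_cmult[OF DERIV_mult[OF 1 DERIV_inverse'[OF 2]]]) (use a in simp)
    qed
    moreover have "2 * (inverse (sqrt a) / 2 * inverse (sqrt (1 + a)) + - (inverse (sqrt (1 + a)) * (inverse (sqrt (1 + a)) / 2) * inverse (sqrt (1 + a))) * sqrt a)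
      = (1 + a) powr - (3/2) / sqrt a"
    proof -
      define s u where "s = sqrt a" and "u = sqrt (1 + a)"
      have su: "s > 0" "u > 0" "s * s = a" "u * u = 1 + a" using a by (auto simp: s_def u_def)
      have "(1 + a) powr (3/2) = (1 + a) powr (1 + 1/2)" by simp
      also have "\<dots> = (1 + a) * u" using a by (simp only: powr_add powr_half_sqrt u_def) simp
      finally have p: "(1 + a) powr - (3/2) = inverse (u * u * u)" unfolding powr_minus su(4) by simp
      have "2 * (inverse s / 2 * inverse u + - (inverse u * (inverse u / 2) * inverse u) * s) = (u * u - s * s) * inverse (u * u * u) / s"
        using su(1,2) by (simp add: field_simps)
      also have "u * u - s * s = 1" by (simp add: su)
      finally show ?thesis unfolding p s_def u_def by simp
    qed
    ultimately show "((\<lambda>a. 2 * (sqrt a * inverse (sqrt (1 + a)))) has_real_derivative (1 + a) powr - (3/2) / sqrt a) (at a)"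
      by simp
    show "isCont (\<lambda>a::real. (1 + a) powr - (3/2) / sqrt a) a"
      using a by (intro continuous_intros) auto
  next
    show "AE a in lborel. 0 < ereal a \<longrightarrow> ereal a < \<infinity> \<longrightarrow> 0 \<le> (1 + a) powr - (3/2) / sqrt a" by simp
    have "((\<lambda>a::real. 2 * (sqrt a * inverse (sqrt (1 + a)))) \<longlongrightarrow> 2 * (sqrt 0 * inverse (sqrt (1 + 0)))) (at_right 0)"
      by (intro tendsto_intros) auto
    then show "(((\<lambda>a. 2 * (sqrt a * inverse (sqrt (1 + a)))) \<circ> real_of_ereal) \<longlongrightarrow> 0) (at_right 0)"
      by (simp add: zero_ereal_def ereal_tendsto_simps)
    have "((\<lambda>a::real. inverse (1 + a)) \<longlongrightarrow> 0) at_top"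
      by (intro tendsto_inverse_0_at_top filterlim_tendsto_add_at_top[OF tendsto_const] filterlim_ident)
    then have "((\<lambda>a::real. 2 * sqrt (1 - inverse (1 + a))) \<longlongrightarrow> 2 * sqrt (1 - 0)) at_top"
      by (intro tendsto_intros)
    then have "((\<lambda>a::real. 2 * sqrt (1 - inverse (1 + a))) \<longlongrightarrow> 2) at_top" by simp
    then have "((\<lambda>a::real. 2 * (sqrt a * inverse (sqrt (1 + a)))) \<longlongrightarrow> 2) at_top"
    proof (rule Lim_transform_eventually)
      show "\<forall>\<^sub>F a::real in at_top. 2 * sqrt (1 - inverse (1 + a)) = 2 * (sqrt a * inverse (sqrt (1 + a)))"
        using eventually_gt_at_top[of 0]
      proof eventually_elim
        case (elim a)
        then have "1 - inverse (1 + a) = a * inverse (1 + a)" by (simp add: field_simps)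
        then show ?case by (simp add: real_sqrt_mult real_sqrt_inverse)
      qed
    qed
    then show "(((\<lambda>a. 2 * (sqrt a * inverse (sqrt (1 + a)))) \<circ> real_of_ereal) \<longlongrightarrow> 2) (at_left \<infinity>)"
      by (simp add: ereal_tendsto_simps)
  qed simp
  then show ?thesis by (simp add: integrable_half_line zero_ereal_def)
qed

text \<open>For real \<mu> and \<epsilon> > 0 the exponential has modulus at most 1, and the power
  of \<mu> + i \<epsilon> stays bounded along a null sequence; \<open>N\<close> collects these
  bounds, and the weight in \<open>a\<close> supplies the integrability.\<close>

lemma T_op_boundary_value:
  fixes x :: "'a::real_normed_vector"
  assumes m: "m = 2 * Suc \<nu>" and \<nu>: "\<nu> \<ge> 1" and j: "j \<le> \<nu>" and \<mu>: "Im \<mu> = 0"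
  shows "((\<lambda>\<epsilon>. T_op m j (superposed m (\<mu> + \<i> * of_real \<epsilon>) j) x) \<longlongrightarrow> T_op m j (superposed m \<mu> j) x) (at_right 0)"
  unfolding tendsto_at_iff_sequentially o_def
proof (intro allI impI)
  fix X :: "nat \<Rightarrow> real" assume X: "\<forall>i. X i \<in> {0<..} - {0}" "X \<longlonglongrightarrow> 0"
  have X_pos: "X i > 0" for i using X(1) by auto
  obtain B where B: "\<And>i. \<bar>X i\<bar> \<le> B"
    using convergent_imp_Bseq[OF convergentI[OF X(2)]] by (auto simp: Bseq_def)
  have nu: "nu m = \<nu>" by (simp add: m nu_def)
  define q where "q = 2 * real \<nu> - real j + 1/2"
  \<comment> \<open>From j \<le> \<nu> the exponent is at least \<nu> + 1/2; the value 3/2 is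
    attained for j = \<nu> = 1, that is, in dimension 4.\<close>
  have q: "q \<ge> 3/2" using j \<nu> by (simp add: q_def)
  define N where "N = ((norm \<mu> + B) * norm x) ^ j / norm x ^ (m - 2)"
  define F where "F \<mu> a = complex_of_real ((1 + a) powr - q) * superposed m \<mu> j x a / of_real (sqrt a)" for \<mu> a
  have "(\<lambda>i. LINT a|half_line. F (\<mu> + \<i> * of_real (X i)) a) \<longlonglongrightarrow> (LINT a|half_line. F \<mu> a)"
  proof (rule integral_dominated_convergence)
    show "F \<mu> \<in> borel_measurable half_line" "F (\<mu> + \<i> * of_real (X i)) \<in> borel_measurable half_line" for i
      unfolding F_def by (intro measurable_restrict_space1; simp)+
    show "integrable half_line (\<lambda>a. (1 + a) powr - (3/2) / sqrt a * N)"
      by (intro integrable_mult_left integrable_powr_div_sqrt)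
    have "(\<lambda>i. F (\<mu> + \<i> * of_real (X i)) a) \<longlonglongrightarrow> F (\<mu> + \<i> * of_real 0) a" for a
      unfolding F_def divide_inverse by (intro tendsto_intros X)
    then show "AE a in half_line. (\<lambda>i. F (\<mu> + \<i> * of_real (X i)) a) \<longlonglongrightarrow> F \<mu> a" by simp
    show "AE a in half_line. norm (F (\<mu> + \<i> * of_real (X i)) a) \<le> (1 + a) powr - (3/2) / sqrt a * N" for i
    proof (rule AE_I2)
      fix a assume "a \<in> space half_line"
      then have a: "a > 0" by (simp add: space_half_line)
      let ?\<mu> = "\<mu> + \<i> * of_real (X i)"
      have "norm (exp (\<i> * ?\<mu> * complex_of_real (norm x * (1 + 2 * a)))) = exp (- (X i * (norm x * (1 + 2 * a))))"
        using \<mu> by (simp add: algebra_simps)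
      also have "\<dots> \<le> 1" using X_pos[of i] a by simp
      finally have e: "norm (exp (\<i> * ?\<mu> * complex_of_real (norm x * (1 + 2 * a)))) \<le> 1" .
      have "norm ?\<mu> \<le> norm \<mu> + B"
        using norm_triangle_ineq[of \<mu> "\<i> * of_real (X i)"] B[of i] by (simp add: norm_mult)
      then have p: "norm (?\<mu> * complex_of_real (norm x)) ^ j \<le> ((norm \<mu> + B) * norm x) ^ j"
        by (intro power_mono) (auto simp: norm_mult intro: mult_right_mono)
      have "norm (superposed m ?\<mu> j x a) \<le> 1 * ((norm \<mu> + B) * norm x) ^ j / norm x ^ (m - 2)"
        unfolding norm_divide norm_mult[of "exp _"] norm_power[of "_ * _"] norm_of_real abs_of_nonneg[OF zero_le_power[OF norm_ge_zero]]
        by (intro divide_right_mono mult_mono e p) auto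
      then have s: "norm (superposed m ?\<mu> j x a) \<le> N" by (simp add: N_def)
      have "(1 + a) powr - q \<le> (1 + a) powr - (3/2)" using a q by (intro powr_mono) auto
      then have "(1 + a) powr - q * norm (superposed m ?\<mu> j x a) / sqrt a \<le> (1 + a) powr - (3/2) * N / sqrt a"
        using a by (intro divide_right_mono mult_mono s) auto
      moreover have "norm (F ?\<mu> a) = (1 + a) powr - q * norm (superposed m ?\<mu> j x a) / sqrt a"
        unfolding F_def norm_divide[of "_ * _" "of_real (sqrt a)"] norm_mult[of "of_real ((1 + a) powr - q)"] norm_of_real
        using a by simp
      ultimately show "norm (F ?\<mu> a) \<le> (1 + a) powr - (3/2) / sqrt a * N" by simp
    qed
  qed
  then show "(\<lambda>i. T_op m j (superposed m (\<mu> + \<i> * of_real (X i)) j) x) \<longlonglongrightarrow> T_op m j (superposed m \<mu> j) x"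
    unfolding T_op_half_line nu q_def[symmetric] F_def by (intro tendsto_mult tendsto_const)
qed

theorem lemma3p5:
  fixes m :: nat
    and G\<^sub>0 :: "complex \<Rightarrow> real ^ 'n \<Rightarrow> complex"
    and \<mu> :: complex
    and x :: "real ^ 'n"
  assumes dim: "CARD('n) = m"
    and m: "m \<ge> 4" "even m"
    and kernel: "free_resolvent_kernel G\<^sub>0"
    and mu: "Im \<mu> \<ge> 0"
    and x: "x \<noteq> 0"
  shows "G\<^sub>0 \<mu> x =
    (\<Sum>j = 0..nu m.
       T_op m j
         (\<lambda>x a. exp (\<i> * \<mu> * complex_of_real (norm x * (1 + 2 * a))) *
                (\<mu> * complex_of_real (norm x)) ^ j /
                complex_of_real (norm x ^ (m - 2))) x)"
proof -
  define \<nu> where "\<nu> = nu m"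
  have \<nu>: "m = 2 * Suc \<nu>" "\<nu> \<ge> 1"
    using m by (auto simp: \<nu>_def nu_def elim!: evenE)
  have dim': "DIM(real ^ 'n) = 2 * Suc \<nu>" using dim \<nu> by simp
  have upper: "G\<^sub>0 \<mu> x = (\<Sum>j=0..nu m. T_op m j (superposed m \<mu> j) x)" if "Im \<mu> > 0" for \<mu>
  proof -
    have "continuous_on (- {0}) (G\<^sub>0 \<mu>)" "is_convolution_kernel (is_resolvent \<mu>) (G\<^sub>0 \<mu>)"
      using kernel that unfolding free_resolvent_kernel_def by blast+
    from resolvent_kernel_eq_profile[OF dim' \<nu>(2) that this x] show ?thesis
      unfolding profile_eq_superposition[OF \<nu>(1) that x] \<nu>(1)[symmetric] .
  qed
  show ?thesis
  proof (cases "Im \<mu> > 0")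
    case True
    then show ?thesis by (rule upper)
  next
    case False
    then have \<mu>0: "Im \<mu> = 0" using mu by simp
    have "((\<lambda>\<epsilon>. G\<^sub>0 (\<mu> + \<i> * complex_of_real \<epsilon>) x) \<longlongrightarrow> G\<^sub>0 \<mu> x) (at_right 0)"
      using kernel \<mu>0 x unfolding free_resolvent_kernel_def by blast
    moreover have "((\<lambda>\<epsilon>. G\<^sub>0 (\<mu> + \<i> * complex_of_real \<epsilon>) x) \<longlongrightarrow> (\<Sum>j=0..nu m. T_op m j (superposed m \<mu> j) x)) (at_right 0)"
    \<comment> \<open>For positive \<epsilon> the shifted parameter lies in the open upper
      half-plane, where the kernel and the superposition already agree; so both candidates are
      limits of one and the same function.\<close>
    proof (rule Lim_transform_eventually)
      show "((\<lambda>\<epsilon>. \<Sum>j=0..nu m. T_op m j (superposed m (\<mu> + \<i> * of_real \<epsilon>) j) x) \<longlongrightarrow>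
        (\<Sum>j=0..nu m. T_op m j (superposed m \<mu> j) x)) (at_right 0)"
        by (intro tendsto_sum T_op_boundary_value[OF \<nu> _ \<mu>0]) (simp add: \<nu>_def)
      show "\<forall>\<^sub>F \<epsilon> in at_right 0. (\<Sum>j=0..nu m. T_op m j (superposed m (\<mu> + \<i> * of_real \<epsilon>) j) x) = G\<^sub>0 (\<mu> + \<i> * complex_of_real \<epsilon>) x"
        using eventually_at_right_less by eventually_elim (rule upper[symmetric], use \<mu>0 in simp)
    qed
    ultimately show ?thesis by (rule tendsto_unique[rotated]) simp
  qed
qed

end
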